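(* Let $n\ge1$, let $\alpha,\beta>0$, let $q_0,q_1,r_0,r_1\in[1,+\infty]$ with $q_0\neq q_1$, and let $\theta=\frac{\alpha}{\alpha+\beta}$. Define $p$ and $r^*$ by $\frac1p=\frac{1-\theta}{q_0}+\frac{\theta}{q_1}$ and $\frac1{r^*}=\frac{1-\theta}{r_0}+\frac{\theta}{r_1}$. For $r\in[1,+\infty]$ consider the assertion $(\ast)_r$: there is a constant $C$ such that every $f\in\dot B^{\alpha,q_0}_{r_0}\cap\dot B^{-\beta,q_1}_{r_1}(\mathbb{R}^n)$ belongs to $L^{p,r}(\mathbb{R}^n)$ and satisfies $$\|f\|_{L^{p,r}}\le C\,\|f\|_{\dot B^{\alpha,q_0}_{r_0}}^{1-\theta}\,\|f\|_{\dot B^{-\beta,q_1}_{r_1}}^{\theta}.$$ Then: 1) If $r>r^*$, then $(\ast)_r$ holds. 2) Moreover, $(\ast)_r$ holds for $r=r^*$ in each of the following cases: (a) $r=r_0=r_1$; (b) $r_0=q_0$ and $r_1=q_1$; (c) $1<p\le 2$ and $r^*=p$. 3) The condition $r\ge r^*$ is sharp: if $r\in[1,+\infty]$ and $r<r^*$, then $(\ast)_r$ does not hold.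
   Context: Littlewood–Paley decomposition: fix a nonnegative $\varphi\in C_c^\infty(\mathbb{R}^n)$ with $\varphi(\xi)=1$ for $|\xi|\le 1/2$ and $\varphi(\xi)=0$ for $|\xi|\ge 1$, and put $\psi(\xi)=\varphi(\xi/2)-\varphi(\xi)$. For $f\in\mathcal{S}'(\mathbb{R}^n)$ and $j\in\mathbb{Z}$, the dyadic block $\Delta_jf$ is defined by $\widehat{\Delta_jf}(\xi)=\psi(2^{-j}\xi)\widehat f(\xi)$. For $s\in\mathbb{R}$ and $q,r\in[1,+\infty]$, the semi-norm of the homogeneous Besov space $\dot B^{s,q}_r(\mathbb{R}^n)$ (first upper index: regularity; second upper index: Lebesgue exponent; lower index: summation exponent) is $\|f\|_{\dot B^{s,q}_r}=\big(\sum_{j\in\mathbb{Z}}2^{jsr}\|\Delta_jf\|_{L^q}^r\big)^{1/r}$, with the supremum over $j$ when $r=+\infty$. Convention: for $\alpha,\beta>0$, $f\in\dot B^{\alpha,q_0}_{r_0}\cap\dot B^{-\beta,q_1}_{r_1}$ means that $f\in\mathcal{S}'(\mathbb{R}^n)$ satisfies $f=\sum_{j\in\mathbb{Z}}\Delta_jf$ (convergence in $\mathcal{S}'$) and that both semi-norms are finite. Lorentz spaces: for $1<p<+\infty$, $1\le r\le+\infty$, $L^{p,r}(\mathbb{R}^n)$ is the set of measurable $f$ (modulo a.e. equality) with $\|f\|_{L^{p,r}}=\big(\int_0^{+\infty}(s^{1/p}f^*(s))^r\frac{ds}{s}\big)^{1/r}<+\infty$ (and $\sup_{s>0}s^{1/p}f^*(s)$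 when $r=+\infty$), where $d_f(t)$ is the Lebesgue measure of $\{x:|f(x)|\ge t\}$ and $f^*(s)=\inf\{t:d_f(t)\le s\}$; equivalently, up to equivalence of norms, $L^{p,r}$ is the real interpolation space $[L^1,L^\infty]_{1-1/p,r}$. Note that $q_0\ne q_1$ forces $1<p<+\infty$. *)

theory Defs
  imports "HOL-Probability.Essential_Supremum"
begin

section \<open>Powers in the extended nonnegative reals\<close>

text \<open>Only used with exponents \<open>0 < a < \<infinity>\<close>, where \<open>\<infinity>\<close> to the power \<open>a\<close> is \<open>\<infinity>\<close>.\<close>

definition epowr :: "ennreal \<Rightarrow> real \<Rightarrow> ennreal"
  where "epowr x a = (if x = \<infinity> then \<infinity> else ennreal (enn2real x powr a))"


section \<open>Schwartz functions and tempered distributions\<close>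

definition iter_deriv ::
    "'a::euclidean_space list \<Rightarrow> ('a \<Rightarrow> 'b::real_normed_vector) \<Rightarrow> 'a \<Rightarrow> 'b"
  where "iter_deriv bs f = foldr (\<lambda>b g x. frechet_derivative g (at x) b) bs f"

definition smooth :: "('a::euclidean_space \<Rightarrow> 'b::real_normed_vector) \<Rightarrow> bool"
  where "smooth f \<longleftrightarrow> (\<forall>bs \<in> lists Basis. iter_deriv bs f differentiable_on UNIV)"

definition schwartz_seminorm :: "nat \<Rightarrow> ('a::euclidean_space \<Rightarrow> complex) \<Rightarrow> ennreal"
  where "schwartz_seminorm N f =
    (SUP bs \<in> {bs \<in> lists Basis. length bs \<le> N}. SUP x.
       ennreal ((1 + norm x) ^ N * norm (iter_deriv bs f x)))"

definition schwartz :: "('a::euclidean_space \<Rightarrow> complex) set"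
  where "schwartz = {f. smooth f \<and> (\<forall>N. schwartz_seminorm N f < \<infinity>)}"

text \<open>A distribution is represented by a functional on all functions; its values outside
  \<^const>\<open>schwartz\<close> are unconstrained and never used.\<close>

definition tempered :: "(('a::euclidean_space \<Rightarrow> complex) \<Rightarrow> complex) \<Rightarrow> bool"
  where "tempered u \<longleftrightarrow>
    (\<forall>f \<in> schwartz. \<forall>g \<in> schwartz. u (\<lambda>x. f x + g x) = u f + u g) \<and>
    (\<forall>c. \<forall>f \<in> schwartz. u (\<lambda>x. c * f x) = c * u f) \<and>
    (\<exists>(C::real) N. \<forall>f \<in> schwartz. ennreal (norm (u f)) \<le> ennreal C * schwartz_seminorm N f)"

definition represents ::
    "('a::euclidean_space \<Rightarrow> complex) \<Rightarrow> (('a \<Rightarrow> complex) \<Rightarrow> complex) \<Rightarrow> bool"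
  where "represents g u \<longleftrightarrow> g \<in> borel_measurable lborel \<and>
    (\<forall>f \<in> schwartz. integrable lborel (\<lambda>x. g x * f x) \<and> u f = (LINT x|lborel. g x * f x))"


section \<open>Fourier transform\<close>

definition fourier :: "('a::euclidean_space \<Rightarrow> complex) \<Rightarrow> 'a \<Rightarrow> complex"
  where "fourier f \<xi> = (LINT x|lborel. cis (- (x \<bullet> \<xi>)) * f x)"

definition inv_fourier :: "('a::euclidean_space \<Rightarrow> complex) \<Rightarrow> 'a \<Rightarrow> complex"
  where "inv_fourier f x =
    complex_of_real (1 / (2 * pi) ^ DIM('a)) * (LINT \<xi>|lborel. cis (x \<bullet> \<xi>) * f \<xi>)"

definition dist_fourier ::
    "(('a::euclidean_space \<Rightarrow> complex) \<Rightarrow> complex) \<Rightarrow> ('a \<Rightarrow> complex) \<Rightarrow> complex"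
  where "dist_fourier u f = u (fourier f)"

definition dist_inv_fourier ::
    "(('a::euclidean_space \<Rightarrow> complex) \<Rightarrow> complex) \<Rightarrow> ('a \<Rightarrow> complex) \<Rightarrow> complex"
  where "dist_inv_fourier u f = u (inv_fourier f)"

definition dist_mult ::
    "('a::euclidean_space \<Rightarrow> real) \<Rightarrow> (('a \<Rightarrow> complex) \<Rightarrow> complex) \<Rightarrow> ('a \<Rightarrow> complex) \<Rightarrow> complex"
  where "dist_mult m u f = u (\<lambda>x. complex_of_real (m x) * f x)"


section \<open>Littlewood--Paley decomposition\<close>

text \<open>Compactness of the support follows from the last condition.\<close>

definition lp_cutoff :: "('a::euclidean_space \<Rightarrow> real) \<Rightarrow> bool"
  where "lp_cutoff \<phi> \<longleftrightarrow> smooth \<phi> \<and> (\<forall>\<xi>. 0 \<le> \<phi> \<xi>) \<and>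
    (\<forall>\<xi>. norm \<xi> \<le> 1/2 \<longrightarrow> \<phi> \<xi> = 1) \<and> (\<forall>\<xi>. 1 \<le> norm \<xi> \<longrightarrow> \<phi> \<xi> = 0)"

definition lp_psi :: "('a::euclidean_space \<Rightarrow> real) \<Rightarrow> 'a \<Rightarrow> real"
  where "lp_psi \<phi> \<xi> = \<phi> (\<xi> /\<^sub>R 2) - \<phi> \<xi>"

definition dyadic_block ::
    "('a::euclidean_space \<Rightarrow> real) \<Rightarrow> int \<Rightarrow> (('a \<Rightarrow> complex) \<Rightarrow> complex) \<Rightarrow> ('a \<Rightarrow> complex) \<Rightarrow> complex"
  where "dyadic_block \<phi> j u = dist_inv_fourier
    (dist_mult (\<lambda>\<xi>. lp_psi \<phi> ((2 powr (- real_of_int j)) *\<^sub>R \<xi>)) (dist_fourier u))"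


section \<open>Lebesgue, Besov and Lorentz norms\<close>

definition Lq_norm :: "ennreal \<Rightarrow> ('a::euclidean_space \<Rightarrow> complex) \<Rightarrow> ennreal"
  where "Lq_norm q g =
    (if q = \<infinity> then esssup lborel (\<lambda>x. ennreal (norm (g x)))
     else epowr (\<integral>\<^sup>+ x. ennreal (norm (g x) powr enn2real q) \<partial>lborel) (1 / enn2real q))"

text \<open>A representing function is unique up to null sets, so the infimum is its norm; it is
  \<open>\<infinity>\<close> if the distribution is not given by a function.\<close>

definition dist_Lq_norm :: "ennreal \<Rightarrow> (('a::euclidean_space \<Rightarrow> complex) \<Rightarrow> complex) \<Rightarrow> ennreal"
  where "dist_Lq_norm q u = (INF g \<in> {g. represents g u}. Lq_norm q g)"

definition besov_seminorm ::
    "('a::euclidean_space \<Rightarrow> real) \<Rightarrow> real \<Rightarrow> ennreal \<Rightarrow> ennreal \<Rightarrow> (('a \<Rightarrow> complex) \<Rightarrow> complex) \<Rightarrow> ennreal"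
  where "besov_seminorm \<phi> s q r u =
    (if r = \<infinity>
     then (SUP j::int. ennreal (2 powr (real_of_int j * s)) * dist_Lq_norm q (dyadic_block \<phi> j u))
     else epowr
       (\<Sum>\<^sub>\<infinity>j::int. ennreal (2 powr (real_of_int j * s * enn2real r)) *
          epowr (dist_Lq_norm q (dyadic_block \<phi> j u)) (enn2real r))
       (1 / enn2real r))"

text \<open>For finite semi-norms with regularity \<open>\<alpha>\<close> and \<open>-\<beta>\<close> the series converges absolutely when
  tested against any Schwartz function, so the order of summation is immaterial.\<close>

definition besov_inter ::
    "('a::euclidean_space \<Rightarrow> real) \<Rightarrow> real \<Rightarrow> ennreal \<Rightarrow> ennreal \<Rightarrow> real \<Rightarrow> ennreal \<Rightarrow> ennreal \<Rightarrow>
      (('a \<Rightarrow> complex) \<Rightarrow> complex) set"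
  where "besov_inter \<phi> \<alpha> q0 r0 \<beta> q1 r1 = {u. tempered u \<and>
    (\<forall>f \<in> schwartz. ((\<lambda>j::int. dyadic_block \<phi> j u f) has_sum u f) UNIV) \<and>
    besov_seminorm \<phi> \<alpha> q0 r0 u < \<infinity> \<and> besov_seminorm \<phi> (- \<beta>) q1 r1 u < \<infinity>}"

definition distribution_fun :: "('a::euclidean_space \<Rightarrow> complex) \<Rightarrow> ennreal \<Rightarrow> ennreal"
  where "distribution_fun g t = emeasure lborel {x. t \<le> ennreal (norm (g x))}"

definition rearrangement :: "('a::euclidean_space \<Rightarrow> complex) \<Rightarrow> real \<Rightarrow> ennreal"
  where "rearrangement g s = Inf {t. distribution_fun g t \<le> ennreal s}"

definition lorentz_norm :: "real \<Rightarrow> ennreal \<Rightarrow> ('a::euclidean_space \<Rightarrow> complex) \<Rightarrow> ennreal"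
  where "lorentz_norm p r g =
    (if r = \<infinity> then (SUP s \<in> {0<..}. ennreal (s powr (1 / p)) * rearrangement g s)
     else epowr
       (\<integral>\<^sup>+ s \<in> {0<..}.
          epowr (ennreal (s powr (1 / p)) * rearrangement g s) (enn2real r) / ennreal s \<partial>lborel)
       (1 / enn2real r))"

definition besov_lorentz_ineq ::
    "('a::euclidean_space \<Rightarrow> real) \<Rightarrow> real \<Rightarrow> ennreal \<Rightarrow> ennreal \<Rightarrow> real \<Rightarrow> ennreal \<Rightarrow> ennreal \<Rightarrow>
      real \<Rightarrow> real \<Rightarrow> ennreal \<Rightarrow> bool"
  where "besov_lorentz_ineq \<phi> \<alpha> q0 r0 \<beta> q1 r1 \<theta> p r \<longleftrightarrow>
    (\<exists>C::real. \<forall>u \<in> besov_inter \<phi> \<alpha> q0 r0 \<beta> q1 r1.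
       \<exists>g. represents g u \<and> lorentz_norm p r g < \<infinity> \<and>
         lorentz_norm p r g \<le> ennreal C *
           epowr (besov_seminorm \<phi> \<alpha> q0 r0 u) (1 - \<theta>) *
           epowr (besov_seminorm \<phi> (- \<beta>) q1 r1 u) \<theta>)"

end

theory Submission
  imports "HOL-Probability.Probability" Defs
begin

text \<open>
  The inequality holds for every \<open>r \<ge> r*\<close>, the endpoint included. Put \<open>\<parallel>\<Delta>\<^sub>j f\<parallel>\<^bsub>q\<^sub>0\<^esub> = 2\<^bsup>-j\<alpha>\<^esup> a\<^sub>j\<close>
  and \<open>\<parallel>\<Delta>\<^sub>j f\<parallel>\<^bsub>q\<^sub>1\<^esub> = 2\<^bsup>j\<beta>\<^esup> b\<^sub>j\<close>. Replacing \<open>a\<^sub>j\<close> by \<open>sup\<^sub>k 2\<^bsup>-\<epsilon>|j-k|\<^esup> a\<^sub>k\<close>, and likewise \<open>b\<^sub>j\<close>, costs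
  only a constant in the summation norms and makes both sequences slowly varying. For each \<open>J\<close> let
  \<open>t s\<^bsup>1/q\<^sub>0\<^esup> = 2\<^bsup>-J\<alpha>\<^esup> a\<^sub>J\<close> and \<open>t s\<^bsup>1/q\<^sub>1\<^esup> = 2\<^bsup>J\<beta>\<^esup> b\<^sub>J\<close>. Chebyshev's inequality with exponent \<open>q\<^sub>0\<close> for
  \<open>j \<ge> J\<close> and \<open>q\<^sub>1\<close> for \<open>j < J\<close> bounds the set where \<open>\<Delta>\<^sub>j f\<close> exceeds \<open>2\<^bsup>-\<epsilon>|j-J|\<^esup> t\<close>; summing over \<open>j\<close>
  gives \<open>f*(K s) \<le> K t\<close>. The levels \<open>s = s\<^sub>J\<close> are quasi-geometric in \<open>J\<close> because the sequences vary
  slowly, so they discretise the Lorentz integral, and \<open>t s\<^bsup>1/p\<^esup> = a\<^sub>J\<^bsup>1-\<theta>\<^esup> b\<^sub>J\<^bsup>\<theta>\<^esup>\<close> lies in \<open>\<ell>\<^bsup>r*\<^esup>\<close>.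

  For the sharpness, superpose \<open>N\<close> wave packets at frequencies \<open>2\<^bsup>3i\<^esup>\<close>, of height \<open>\<mu>\<^sub>i\<^bsup>-1/p\<^esup>\<close> on far apart balls
  of measure about \<open>\<mu>\<^sub>i = \<lambda> 2\<^bsup>-3i(\<alpha>+\<beta>)/\<delta>\<^esup>\<close> with \<open>\<delta> = 1/q\<^sub>0 - 1/q\<^sub>1\<close>; a large \<open>\<lambda>\<close> makes the
  uncertainty principle harmless. All nonzero normalised blocks then have comparable size, so the
  right-hand side grows like \<open>N\<^bsup>1/r*\<^esup>\<close> while the Lorentz norm is at least of order \<open>N\<^bsup>1/r\<^esup>\<close>.
\<close>

section \<open>Integration on Euclidean space\<close>

text \<open>Blocks are given only as functionals, with norms that are infima over representing
  functions. One function per block must serve both Lebesgue exponents, so uniqueness of the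
  representing function is proved first, from test functions alone. Conversely, the function
  representing u is built by summing the blocks pointwise and exchanging this sum with the pairing.
  The value \<epsilon> = min \<alpha> \<beta> / 3 cuts the guaranteed decay 2^(-3 \<epsilon> |j -
  J|) into three equal parts: one is lost to slow variation, one scales down the height t, one the
  measure s. Heights and measures then both sum to a constant times t and s. The counterexample is
  prescribed on the Fourier side because multipliers act pointwise there, so that a block is one
  multiplier times one packet. Returning to physical space with bounds uniform in all parameters
  requires the kernel of the multiplier, hence decay of transforms and an inversion formula, which
  comes from Gaussian regularisation. The uncertainty principle appears as the condition that a
  packet be at least as wide as the kernel, 2^(-k) <= R.\<close>

lemma nn_integral_lborel_affine:
  fixes f :: "'a::euclidean_space \<Rightarrow> ennreal"
  assumes [measurable]: "f \<in> borel_measurable borel" and c: "c > 0"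
  shows "(\<integral>\<^sup>+ x. f x \<partial>lborel) = ennreal (c ^ DIM('a)) * (\<integral>\<^sup>+ x. f (t + c *\<^sub>R x) \<partial>lborel)"
  by (subst lborel_affine[of c t])
     (use c in \<open>simp_all add: nn_integral_density nn_integral_distr nn_integral_cmult\<close>)

lemma integrable_lborel_affine:
  fixes f :: "'a::euclidean_space \<Rightarrow> 'b::{banach, second_countable_topology}"
  assumes f: "integrable lborel f" and c: "c > 0"
  shows "integrable lborel (\<lambda>x. f (t + c *\<^sub>R x))"
proof -
  have [measurable]: "f \<in> borel_measurable borel" using f by (auto dest: borel_measurable_integrable)
  have "(\<integral>\<^sup>+ x. ennreal (norm (f x)) \<partial>lborel) < \<infinity>"
    using f by (simp add: integrable_iff_bounded)
  then show ?thesis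
    unfolding integrable_iff_bounded
    using c by (subst (asm) nn_integral_lborel_affine[where t = t and c = c])
      (auto simp: ennreal_mult_less_top)
qed

lemma integral_lborel_affine:
  fixes f :: "'a::euclidean_space \<Rightarrow> 'b::{banach, second_countable_topology}"
  assumes [measurable]: "f \<in> borel_measurable borel" and c: "c > 0"
  shows "(LINT x|lborel. f x) = c ^ DIM('a) *\<^sub>R (LINT x|lborel. f (t + c *\<^sub>R x))"
  by (subst lborel_affine[of c t])
     (use c in \<open>simp_all add: integral_density integral_distr\<close>)

text \<open>\<open>lborel\<close> is the image of the product measure over \<open>Basis\<close>, so
  this is Fubini for product functions. It serves the decay weights and the Gaussian.\<close>

lemma
  fixes f :: "'a::euclidean_space \<Rightarrow> real \<Rightarrow> 'b::{real_normed_field, banach, second_countable_topology}"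
  assumes f: "\<And>b. b \<in> Basis \<Longrightarrow> integrable lborel (f b)"
  shows integrable_prod_Basis: "integrable lborel (\<lambda>x. \<Prod>b\<in>Basis. f b (x \<bullet> b))"
    and integral_prod_Basis:
      "(LINT x|lborel. (\<Prod>b\<in>Basis. f b (x \<bullet> b))) = (\<Prod>b\<in>Basis. (LINT t|lborel. f b t))"
proof -
  interpret product_sigma_finite "\<lambda>_::'a. lborel :: real measure" ..
  have [measurable]: "f b \<in> borel_measurable borel" if "b \<in> Basis" for b
    using f[OF that] by auto
  have [measurable]: "(\<lambda>x. f b (x \<bullet> b)) \<in> borel_measurable borel" if "b \<in> Basis" for b
    using that by measurable
  have m: "(\<lambda>x. \<Prod>b\<in>Basis. f b (x \<bullet> b)) \<in> borel_measurable borel"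
    by measurable
  have m2: "(\<lambda>g. \<Sum>b\<in>Basis. g b *\<^sub>R b) \<in> measurable (Pi\<^sub>M Basis (\<lambda>_::'a. lborel)) borel"
    by measurable
  have eq: "(\<Prod>b\<in>Basis. f b ((\<Sum>a\<in>Basis. g a *\<^sub>R a) \<bullet> b)) = (\<Prod>b\<in>Basis. f b (g b))" for g
    by (rule prod.cong) (auto simp: inner_sum_left inner_Basis if_distrib cong: if_cong)
  show "integrable lborel (\<lambda>x. \<Prod>b\<in>Basis. f b (x \<bullet> b))"
    unfolding lborel_eq[where 'a='a] using m m2
    by (subst integrable_distr_eq) (auto simp: eq intro!: product_integrable_prod f)
  show "(LINT x|lborel. (\<Prod>b\<in>Basis. f b (x \<bullet> b))) = (\<Prod>b\<in>Basis. (LINT t|lborel. f b t))"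
    unfolding lborel_eq[where 'a='a] using m m2
    by (subst integral_distr) (auto simp: eq intro!: product_integral_prod f)
qed

text \<open>Each of the n coordinate factors 1 + (x . b)^2 is at most (1 + |x|)^2. This is why the
  exponent is 2 n: the one-dimensional integral of 1 / (1 + t^2) then suffices.\<close>

lemma integrable_inverse_power_norm:
  fixes N :: nat
  assumes N: "2 * DIM('a::euclidean_space) \<le> N"
  shows "integrable lborel (\<lambda>x::'a. 1 / (1 + norm x) ^ N)"
proof (rule Bochner_Integration.integrable_bound)
  have "integrable lborel (\<lambda>x::real. inverse (1 + x\<^sup>2))"
    using integrable_inverse_1_plus_square
    by (auto simp: set_integrable_def einterval_def)
  then show "integrable lborel (\<lambda>x::'a. \<Prod>b\<in>Basis. inverse (1 + (x \<bullet> b)\<^sup>2))"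
    by (rule integrable_prod_Basis)
  show "(\<lambda>x::'a. 1 / (1 + norm x) ^ N) \<in> borel_measurable lborel"
    by measurable
  have "norm (1 / (1 + norm x) ^ N) \<le> norm (\<Prod>b\<in>Basis. inverse (1 + (x \<bullet> b)\<^sup>2))" for x :: 'a
  proof -
    have 1: "1 + (x \<bullet> b)\<^sup>2 \<le> (1 + norm x)\<^sup>2" if "b \<in> Basis" for b
    proof -
      have "(x \<bullet> b)\<^sup>2 \<le> (norm x)\<^sup>2" using Basis_le_norm[OF that, of x]
        by (metis abs_ge_zero abs_le_square_iff abs_norm_cancel)
      then show ?thesis using norm_ge_zero[of x] unfolding power2_sum by (smt (verit) mult_nonneg_nonneg one_power2)
    qed
    have 2: "(\<Prod>b\<in>Basis. 1 + (x \<bullet> b)\<^sup>2) \<le> (\<Prod>b\<in>(Basis::'a set). (1 + norm x)\<^sup>2)"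
      by (rule prod_mono) (use 1 in auto)
    also have "\<dots> = (1 + norm x) ^ (2 * DIM('a))"
      by (simp add: power_mult)
    also have "\<dots> \<le> (1 + norm x) ^ N"
      using N by (intro power_increasing) auto
    finally have "(\<Prod>b\<in>Basis. 1 + (x \<bullet> b)\<^sup>2) \<le> (1 + norm x) ^ N" .
    moreover have "(\<Prod>b\<in>Basis. 1 + (x \<bullet> b)\<^sup>2) > 0"
      by (intro prod_pos) (auto intro: add_pos_nonneg)
    moreover have "norm (\<Prod>b\<in>Basis. inverse (1 + (x \<bullet> b)\<^sup>2)) = \<bar>inverse (\<Prod>b\<in>Basis. (1 + (x \<bullet> b)\<^sup>2))\<bar>"
      unfolding prod_inversef[symmetric] by (simp add: o_def)
    ultimately show ?thesis
      by (simp del: prod_inversef prod_dividef add: inverse_eq_divide[symmetric] le_imp_inverse_le)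
  qed
  then show "AE x::'a in lborel. norm (1 / (1 + norm x) ^ N) \<le> norm (\<Prod>b\<in>Basis. inverse (1 + (x \<bullet> b)\<^sup>2))"
    by (intro AE_I2)
qed

section \<open>Schwartz functions\<close>

lemma smooth_continuous: "smooth f \<Longrightarrow> continuous_on UNIV f"
  by (auto simp: smooth_def iter_deriv_def intro!: differentiable_imp_continuous_on dest!: bspec[of _ _ "[]"])

lemma schwartz_continuous: "f \<in> schwartz \<Longrightarrow> continuous_on UNIV f"
  by (simp add: schwartz_def smooth_continuous)

lemma schwartz_measurable: "f \<in> schwartz \<Longrightarrow> f \<in> borel_measurable borel"
  by (intro borel_measurable_continuous_onI schwartz_continuous)

lemma schwartz_seminorm_ge:
  "ennreal ((1 + norm x) ^ N * norm (f x)) \<le> schwartz_seminorm N f"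
proof -
  have "(SUP x. ennreal ((1 + norm x) ^ N * norm (f x))) \<le> schwartz_seminorm N f"
    unfolding schwartz_seminorm_def
    by (rule SUP_upper2[of "[]"]) (auto simp: iter_deriv_def)
  then show ?thesis
    by (meson SUP_upper UNIV_I order_trans)
qed

lemma schwartz_decay:
  assumes "f \<in> schwartz"
  obtains C where "C \<ge> 0" "\<And>x. norm (f x) \<le> C / (1 + norm x) ^ N"
proof -
  have fin: "schwartz_seminorm N f < \<infinity>" using assms by (auto simp: schwartz_def)
  then obtain C where C: "C \<ge> 0" "schwartz_seminorm N f = ennreal C"
    by (cases "schwartz_seminorm N f") auto
  have "norm (f x) \<le> C / (1 + norm x) ^ N" for x
  proof -
    have "(1 + norm x) ^ N * norm (f x) \<le> C"
      using schwartz_seminorm_ge[of x N f] C by simp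
    moreover have "(1 + norm x) ^ N > 0" by (simp add: add_pos_nonneg)
    ultimately show ?thesis by (simp add: pos_le_divide_eq mult.commute)
  qed
  with C that show ?thesis by blast
qed

lemma schwartz_integrable: "f \<in> schwartz \<Longrightarrow> integrable lborel f"
  for f :: "'a::euclidean_space \<Rightarrow> complex"
proof -
  assume f: "f \<in> schwartz"
  obtain C where C: "C \<ge> 0" "\<And>x. norm (f x) \<le> C / (1 + norm x) ^ (2 * DIM('a))"
    using schwartz_decay[OF f] by blast
  have "integrable lborel (\<lambda>x::'a. C * (1 / (1 + norm x) ^ (2 * DIM('a))))"
    by (intro integrable_mult_right integrable_inverse_power_norm) simp
  then show ?thesis
    by (rule Bochner_Integration.integrable_bound) (use C schwartz_measurable[OF f] in auto)
qed

lemma schwartz_bounded: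
  assumes "f \<in> schwartz" obtains C where "C \<ge> 0" "\<And>x. norm (f x) \<le> C"
  using schwartz_decay[OF assms, of 0] by auto

lemma continuous_compact_support_bounded:
  fixes f :: "'a::euclidean_space \<Rightarrow> 'b::real_normed_vector"
  assumes "continuous_on UNIV f" and "\<And>x. r \<le> norm x \<Longrightarrow> f x = 0"
  obtains C where "C \<ge> 0" "\<And>x. norm (f x) \<le> C"
proof -
  have "compact (f ` cball 0 r)"
    by (intro compact_continuous_image continuous_on_subset[OF assms(1)]) auto
  then obtain B where B: "\<And>x. norm x \<le> r \<Longrightarrow> norm (f x) \<le> B"
    by (fastforce dest!: compact_imp_bounded simp: bounded_iff)
  have "norm (f x) \<le> max 0 B" for x
    using assms(2)[of x] B[of x] by (cases "norm x \<le> r") auto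
  then show ?thesis using that[of "max 0 B"] by simp
qed

lemma continuous_compact_support_integrable:
  fixes f :: "'a::euclidean_space \<Rightarrow> 'b::{banach, second_countable_topology}"
  assumes c: "continuous_on UNIV f" and z: "\<And>x. r \<le> norm x \<Longrightarrow> f x = 0"
  shows "integrable lborel f"
proof -
  obtain C where C: "C \<ge> 0" "\<And>x. norm (f x) \<le> C"
    by (rule continuous_compact_support_bounded[OF c z]) auto
  have "integrable lborel (\<lambda>x::'a. C * indicator (cball 0 r) x)"
    by (intro integrable_mult_right integrable_real_indicator emeasure_lborel_cball_finite) auto
  then show ?thesis
    by (rule Bochner_Integration.integrable_bound)
       (use C z in \<open>auto intro!: borel_measurable_continuous_onI c split: split_indicator\<close>)
qed

section \<open>Iterated derivatives and bump functions\<close>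

lemma iter_deriv_Cons: "iter_deriv (b # bs) f = (\<lambda>x. frechet_derivative (iter_deriv bs f) (at x) b)"
  by (simp add: iter_deriv_def)

lemma iter_deriv_Nil: "iter_deriv [] f = f"
  by (simp add: iter_deriv_def)

lemma smooth_differentiable:
  "smooth f \<Longrightarrow> bs \<in> lists Basis \<Longrightarrow> iter_deriv bs f differentiable (at x)"
  unfolding smooth_def differentiable_on_def by auto

lemma smooth_has_derivative:
  "smooth f \<Longrightarrow> bs \<in> lists Basis \<Longrightarrow>
    (iter_deriv bs f has_derivative frechet_derivative (iter_deriv bs f) (at x)) (at x)"
  using smooth_differentiable frechet_derivative_works by blast

lemma smooth_iter_deriv_continuous:
  "smooth f \<Longrightarrow> bs \<in> lists Basis \<Longrightarrow> continuous_on UNIV (iter_deriv bs f)"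
  by (auto simp: smooth_def intro!: differentiable_imp_continuous_on)

lemma has_derivative_affine_bounded_linear:
  assumes L: "bounded_linear L" and f: "(f has_derivative D) (at (a + c *\<^sub>R x))"
  shows "((\<lambda>x. C *\<^sub>R L (f (a + c *\<^sub>R x))) has_derivative (\<lambda>v. (C * c) *\<^sub>R L (D v))) (at x)"
proof -
  have lin: "linear D" using f has_derivative_linear by blast
  have "((\<lambda>x. f (a + c *\<^sub>R x)) has_derivative (\<lambda>v. D (c *\<^sub>R v))) (at x)"
    by (rule has_derivative_compose[where f="\<lambda>x. a + c *\<^sub>R x" and g=f, OF _ f])
       (auto intro!: derivative_eq_intros)
  then have "((\<lambda>x. C *\<^sub>R L (f (a + c *\<^sub>R x))) has_derivative (\<lambda>v. C *\<^sub>R L (D (c *\<^sub>R v)))) (at x)"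
    by (intro has_derivative_scaleR_right bounded_linear.has_derivative[OF L])
  then show ?thesis
    by (simp add: linear_scale[OF lin] linear_scale[OF bounded_linear.linear[OF L]])
qed

lemma iter_deriv_affine:
  fixes f :: "'a::euclidean_space \<Rightarrow> 'b::real_normed_vector"
  assumes L: "bounded_linear L" and f: "smooth f" and bs: "bs \<in> lists Basis"
  shows "iter_deriv bs (\<lambda>x. L (f (a + c *\<^sub>R x))) =
    (\<lambda>x. c ^ length bs *\<^sub>R L (iter_deriv bs f (a + c *\<^sub>R x)))"
  using bs
proof (induction bs)
  case Nil
  then show ?case by (simp add: iter_deriv_Nil)
next
  case (Cons b bs)
  then have bs: "bs \<in> lists Basis" by auto
  have "frechet_derivative (\<lambda>x. c ^ length bs *\<^sub>R L (iter_deriv bs f (a + c *\<^sub>R x))) (at x) =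
     (\<lambda>v. (c ^ length bs * c) *\<^sub>R L (frechet_derivative (iter_deriv bs f) (at (a + c *\<^sub>R x)) v))" for x
    by (rule frechet_derivative_at[symmetric])
       (intro has_derivative_affine_bounded_linear[OF L] smooth_has_derivative f bs)
  then show ?case
    using Cons.IH by (simp add: iter_deriv_Cons mult.commute)
qed

lemma smooth_affine:
  fixes f :: "'a::euclidean_space \<Rightarrow> 'b::real_normed_vector"
  assumes L: "bounded_linear L" and f: "smooth f"
  shows "smooth (\<lambda>x. L (f (a + c *\<^sub>R x)))"
  unfolding smooth_def
proof
  fix bs :: "'a list" assume bs: "bs \<in> lists Basis"
  show "iter_deriv bs (\<lambda>x. L (f (a + c *\<^sub>R x))) differentiable_on UNIV"
    unfolding iter_deriv_affine[OF L f bs] differentiable_on_def differentiable_def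
    using has_derivative_affine_bounded_linear[OF L smooth_has_derivative[OF f bs]] by blast
qed

text \<open>The strict inequality makes the region open; the function is locally zero there, and
  hence so is each derivative.\<close>

lemma iter_deriv_support:
  fixes f :: "'a::euclidean_space \<Rightarrow> 'b::real_normed_vector"
  assumes z: "\<And>x. r < norm x \<Longrightarrow> f x = 0" and x: "r < norm x"
  shows "iter_deriv bs f x = 0"
  using x
proof (induction bs arbitrary: x)
  case Nil
  then show ?case using z by (simp add: iter_deriv_Nil)
next
  case (Cons b bs)
  have o: "open {x::'a. r < norm x}"
    by (intro open_Collect_less continuous_intros)
  have "((\<lambda>_. 0) has_derivative (\<lambda>_. 0)) (at x)" by simp
  then have "(iter_deriv bs f has_derivative (\<lambda>_. 0)) (at x)"
    by (rule has_derivative_transform_within_open[OF _ o]) (use Cons in auto)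
  then show ?case
    by (simp add: iter_deriv_Cons frechet_derivative_at[symmetric])
qed

lemma iter_deriv_bounded:
  fixes f :: "'a::euclidean_space \<Rightarrow> 'b::real_normed_vector"
  assumes f: "smooth f" and z: "\<And>x. r < norm x \<Longrightarrow> f x = 0" and bs: "bs \<in> lists Basis"
  shows "\<exists>C\<ge>0. \<forall>x. norm (iter_deriv bs f x) \<le> C"
proof -
  have "\<exists>C. 0 \<le> C \<and> (\<forall>x. norm (iter_deriv bs f x) \<le> C)"
    using continuous_compact_support_bounded[OF smooth_iter_deriv_continuous[OF f bs], of "r + 1"]
      iter_deriv_support[of r f _ bs] z by (smt (verit))
  then show ?thesis by blast
qed

text \<open>Only finitely many lists of basis vectors have length at most N, so the supremum over
  lists is dominated by a finite sum of the individual bounds.\<close>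

lemma smooth_compact_support_schwartz:
  fixes f :: "'a::euclidean_space \<Rightarrow> complex"
  assumes f: "smooth f" and z: "\<And>x. r < norm x \<Longrightarrow> f x = 0"
  shows "f \<in> schwartz"
proof -
  have "schwartz_seminorm N f < \<infinity>" for N
  proof -
    let ?S = "{bs \<in> lists (Basis::'a set). length bs \<le> N}"
    have fin: "finite ?S"
      using finite_lists_length_le[of "Basis::'a set" N] by (simp add: lists_eq_set)
    have "\<forall>bs\<in>?S. \<exists>C\<ge>0. \<forall>x. norm (iter_deriv bs f x) \<le> C"
      using iter_deriv_bounded[OF f z] by (metis (mono_tags, lifting) mem_Collect_eq)
    then obtain C where C: "\<And>bs x. bs \<in> ?S \<Longrightarrow> 0 \<le> C bs \<and> norm (iter_deriv bs f x) \<le> C bs"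
      by metis
    have "schwartz_seminorm N f \<le> (\<Sum>bs\<in>?S. ennreal ((1 + \<bar>r\<bar>) ^ N * C bs))"
      unfolding schwartz_seminorm_def
    proof (intro SUP_least)
      fix bs and x :: 'a assume bs: "bs \<in> ?S"
      have "(1 + norm x) ^ N * norm (iter_deriv bs f x) \<le> (1 + \<bar>r\<bar>) ^ N * C bs"
      proof (cases "r < norm x")
        case True
        then show ?thesis using iter_deriv_support[where f=f and r=r and x=x and bs=bs] z C[OF bs] by simp
      next
        case False
        then show ?thesis using C[OF bs, of x] by (intro mult_mono power_mono) auto
      qed
      then have "ennreal ((1 + norm x) ^ N * norm (iter_deriv bs f x)) \<le> ennreal ((1 + \<bar>r\<bar>) ^ N * C bs)"
        by (rule ennreal_leI)
      also have "\<dots> \<le> (\<Sum>bs\<in>?S. ennreal ((1 + \<bar>r\<bar>) ^ N * C bs))"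
        using member_le_sum[OF bs, of "\<lambda>bs. ennreal ((1 + \<bar>r\<bar>) ^ N * C bs)"] fin by auto
      finally show "ennreal ((1 + norm x) ^ N * norm (iter_deriv bs f x)) \<le> \<dots>" .
    qed
    also have "\<dots> < \<infinity>" using fin by simp
    finally show ?thesis .
  qed
  then show ?thesis using f by (simp add: schwartz_def)
qed

text \<open>These translated dilates of \<phi> are the only test functions on which the uniqueness
  of the representing function rests.\<close>

lemma lp_cutoff_schwartz:
  fixes \<phi> :: "'a::euclidean_space \<Rightarrow> real"
  assumes "lp_cutoff \<phi>" and "c > 0"
  shows "(\<lambda>x. complex_of_real (\<phi> (a + c *\<^sub>R x))) \<in> schwartz"
proof (rule smooth_compact_support_schwartz)
  show "smooth (\<lambda>x. complex_of_real (\<phi> (a + c *\<^sub>R x)))"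
    by (intro smooth_affine bounded_linear_of_real) (use assms in \<open>auto simp: lp_cutoff_def\<close>)
  fix x :: 'a assume x: "(1 + norm a) / c < norm x"
  have "c * norm x - norm a \<le> norm (a + c *\<^sub>R x)"
    using norm_diff_ineq[of "c *\<^sub>R x" a] assms(2) by (simp add: add.commute[of a])
  moreover have "1 + norm a < c * norm x"
    using x assms(2) by (simp add: field_simps)
  ultimately have "1 \<le> norm (a + c *\<^sub>R x)" by linarith
  then show "complex_of_real (\<phi> (a + c *\<^sub>R x)) = 0"
    using assms by (auto simp: lp_cutoff_def)
qed

lemma lp_cutoff_continuous: "lp_cutoff \<phi> \<Longrightarrow> continuous_on UNIV \<phi>"
  by (simp add: lp_cutoff_def smooth_continuous)

lemma lp_cutoff_bounded:
  assumes "lp_cutoff \<phi>"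
  obtains C where "C \<ge> 0" "\<And>x. \<bar>\<phi> x\<bar> \<le> C"
  by (rule continuous_compact_support_bounded[OF lp_cutoff_continuous[OF assms], of 1])
     (use assms in \<open>auto simp: lp_cutoff_def\<close>)

lemma lp_cutoff_integrable: "lp_cutoff \<phi> \<Longrightarrow> integrable lborel \<phi>"
  by (rule continuous_compact_support_integrable[where r=1])
     (auto simp: lp_cutoff_continuous lp_cutoff_def)

lemma integral_pos_if_one_near_zero:
  fixes f :: "'a::euclidean_space \<Rightarrow> real"
  assumes "integrable lborel f" and "\<And>x. 0 \<le> f x" and "\<And>x. norm x \<le> 1/2 \<Longrightarrow> f x = 1"
  shows "0 < (LINT x|lborel. f x)"
proof -
  have "0 < measure lborel (cball (0::'a) (1/2))"
    using content_ball_pos[of "1/2" "0::'a"] measure_mono_fmeasurable[of "ball (0::'a) (1/2)" "cball 0 (1/2)" lborel]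
    by (simp add: fmeasurableI emeasure_lborel_cball_finite ball_subset_cball)
  also have "\<dots> = (LINT x|lborel. indicator (cball (0::'a) (1/2)) x)"
    by simp
  also have "\<dots> \<le> (LINT x|lborel. f x)"
    using assms
    by (intro integral_mono integrable_real_indicator emeasure_lborel_cball_finite)
       (auto split: split_indicator)
  finally show ?thesis .
qed

lemma lp_cutoff_integral_pos:
  assumes "lp_cutoff \<phi>" shows "0 < (LINT x|lborel. \<phi> x)"
  by (rule integral_pos_if_one_near_zero[OF lp_cutoff_integrable[OF assms]])
     (use assms in \<open>auto simp: lp_cutoff_def\<close>)

section \<open>Uniqueness of the representing function\<close>

lemma (in pair_sigma_finite) integrable_pair_mult:
  fixes f :: "'a \<Rightarrow> 'c::{real_normed_field, banach, second_countable_topology}"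
  assumes f: "integrable M1 f" and g: "integrable M2 g"
  shows "integrable (M1 \<Otimes>\<^sub>M M2) (\<lambda>(x, y). f x * g y)"
proof (rule Fubini_integrable)
  have [measurable]: "f \<in> borel_measurable M1" "g \<in> borel_measurable M2"
    using f g by (auto dest: borel_measurable_integrable)
  show "(\<lambda>(x, y). f x * g y) \<in> borel_measurable (M1 \<Otimes>\<^sub>M M2)" by measurable
  show "integrable M1 (\<lambda>x. LINT y|M2. norm (case (x, y) of (x, y) \<Rightarrow> f x * g y))"
    using f by (simp add: norm_mult)
  show "AE x in M1. integrable M2 (\<lambda>y. case (x, y) of (x, y) \<Rightarrow> f x * g y)"
    using g by simp
qed

text \<open>Boxes are an intersection-stable generator of the Borel sets, so a Dynkin argument
  spreads the vanishing integral to every Borel set; \<open>D0\<close> is what complements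
  need.\<close>

lemma integral_zero_on_boxes:
  fixes D :: "'a::euclidean_space \<Rightarrow> 'b::{banach, second_countable_topology}"
  assumes D: "integrable lborel D" and D0: "(LINT x|lborel. D x) = 0"
    and box: "\<And>l u. (LINT x:box l u|lborel. D x) = 0"
  shows "AE x in lborel. D x = 0"
proof (rule sigma_finite_measure.density_zero[OF lborel.sigma_finite_measure_axioms D])
  fix A :: "'a set" assume "A \<in> sets lborel"
  then have A: "A \<in> sigma_sets UNIV (range (\<lambda>(a, b). box a b))"
    by (simp add: borel_eq_box)
  have "Int_stable (range (\<lambda>(a, b). box a b :: 'a set))"
    by (auto simp: Int_stable_def box_Int_box)
  moreover have "range (\<lambda>(a, b). box a b :: 'a set) \<subseteq> Pow UNIV" by simp
  ultimately show "(LINT x:A|lborel. D x) = 0"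
    using A
  proof (induction rule: sigma_sets_induct_disjoint)
    case (basic A)
    then show ?case using box by auto
  next
    case empty
    then show ?case by (simp add: set_lebesgue_integral_def)
  next
    case (compl A)
    then have A: "A \<in> sets lborel" by (simp add: borel_eq_box)
    have "indicator (UNIV - A) x *\<^sub>R D x = D x - indicator A x *\<^sub>R D x" for x
      by (auto split: split_indicator)
    then have "(LINT x:UNIV - A|lborel. D x) = (LINT x|lborel. D x) - (LINT x:A|lborel. D x)"
      unfolding set_lebesgue_integral_def
      using D integrable_mult_indicator[OF A D] by simp
    then show ?case using D0 compl by simp
  next
    case (union A)
    have [measurable]: "A i \<in> sets borel" for i
      using union(2) by (auto simp: borel_eq_box)
    have "(LINT x:(\<Union>i. A i)|lborel. D x) = (\<Sum>i. (LINT x:A i|lborel. D x))"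
    proof (rule lebesgue_integral_countable_add)
      show "set_integrable lborel (\<Union>i. A i) D"
        unfolding set_integrable_def by (rule integrable_mult_indicator[OF _ D]) simp
    qed (use union(1) in \<open>auto simp: disjoint_family_on_def\<close>)
    then show ?case using union by simp
  qed
qed

lemma AE_notin_frontier_box: "AE x in lborel. x \<notin> cbox l u - box l u"
proof -
  have "emeasure lborel (cbox l u - box l u) = emeasure lborel (cbox l u) - emeasure lborel (box l u)"
    by (rule emeasure_Diff) (auto simp: emeasure_lborel_box_eq box_subset_cbox)
  also have "\<dots> = 0" by (simp add: emeasure_lborel_box_eq emeasure_lborel_cbox_eq box_subset_cbox)
  finally show ?thesis by (intro AE_not_in) (auto simp: null_sets_def)
qed

text \<open>The integrals mollify the indicator of the box by a bump shrinking at rate 1 / (m + 1).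
  Off the frontier the indicator is locally constant at x, so each integrand is eventually constant
  in m.\<close>

lemma bump_mean_box_tendsto:
  fixes f :: "'a::euclidean_space \<Rightarrow> real"
  assumes f: "integrable lborel f" and x: "x \<notin> cbox l u - box l u"
  shows "(\<lambda>m. LINT y|lborel. indicator (box l u) (x + y /\<^sub>R real (Suc m)) * f y)
    \<longlonglongrightarrow> indicator (box l u) x * (LINT y|lborel. f y)"
proof -
  have [measurable]: "f \<in> borel_measurable borel" using f by (auto dest: borel_measurable_integrable)
  have "(\<lambda>m. LINT y|lborel. indicator (box l u) (x + y /\<^sub>R real (Suc m)) * f y)
    \<longlonglongrightarrow> (LINT y|lborel. indicator (box l u) x * f y)"
  proof (rule integral_dominated_convergence[where w="\<lambda>y. \<bar>f y\<bar>"])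
    show "integrable lborel (\<lambda>y. \<bar>f y\<bar>)" using f by simp
    have "(\<lambda>m. indicator (box l u) (x + y /\<^sub>R real (Suc m)) * f y) \<longlonglongrightarrow> indicator (box l u) x * f y" for y
    proof -
      have lim: "(\<lambda>m. x + inverse (real (Suc m)) *\<^sub>R y) \<longlonglongrightarrow> x + 0 *\<^sub>R y"
        by (intro tendsto_intros LIMSEQ_inverse_real_of_nat)
      have "eventually (\<lambda>m. indicator (box l u) (x + y /\<^sub>R real (Suc m)) = (indicator (box l u) x :: real)) sequentially"
      proof (cases "x \<in> box l u")
        case True
        then show ?thesis
          using topological_tendstoD[OF lim, of "box l u"] by (simp add: open_box indicator_def)
      next
        case False
        then have "x \<in> - cbox l u" using x by auto
        then show ?thesis
          using topological_tendstoD[OF lim, of "- cbox l u"] False box_subset_cbox[of l u]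
          by (auto simp: indicator_def open_Compl closed_cbox elim!: eventually_mono)
      qed
      then show ?thesis
        by (intro tendsto_eventually) (auto elim: eventually_mono)
    qed
    then show "AE y in lborel. (\<lambda>m. indicator (box l u) (x + y /\<^sub>R real (Suc m)) * f y) \<longlonglongrightarrow> indicator (box l u) x * f y"
      by (intro AE_I2)
    show "AE y in lborel. norm (indicator (box l u) (x + y /\<^sub>R real (Suc m)) * f y) \<le> \<bar>f y\<bar>" for m
      by (intro AE_I2) (auto split: split_indicator)
  qed measurable
  then show ?thesis by simp
qed

text \<open>The indicator of a box is not a test function, but its mollification at scale 1 / k is a
  superposition of test functions \<open>T a\<close> with a in the box. Fubini shows that d
  annihilates it, and dominated convergence removes the mollification.\<close>

lemma integral_against_box_zero:
  fixes d :: "'a::euclidean_space \<Rightarrow> complex" and \<phi> :: "'a \<Rightarrow> real"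
  assumes phi: "lp_cutoff \<phi>"
    and [measurable]: "d \<in> borel_measurable borel"
    and int: "\<And>f. f \<in> schwartz \<Longrightarrow> integrable lborel (\<lambda>x. d x * f x)"
    and zero: "\<And>f. f \<in> schwartz \<Longrightarrow> (LINT x|lborel. d x * f x) = 0"
  shows "integrable lborel (\<lambda>x. indicator (box l u) x *\<^sub>R d x)"
    and "(LINT x:box l u|lborel. d x) = 0"
proof -
  \<comment> \<open>With the reflection, the substitution a = x + y / k turns \<phi>'(y) into
    \<phi>(k (x - a)), a dilate with a positive factor as \<open>lp_cutoff_schwartz\<close>
    demands.\<close>
  define \<phi>' where "\<phi>' y = \<phi> (- y)" for y
  have [measurable]: "\<phi> \<in> borel_measurable borel"
    by (intro borel_measurable_continuous_onI lp_cutoff_continuous phi)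
  have [measurable]: "\<phi>' \<in> borel_measurable borel" unfolding \<phi>'_def by measurable
  have phi0: "0 \<le> \<phi> x" and phi1: "1 \<le> norm x \<Longrightarrow> \<phi> x = 0" for x
    using phi by (auto simp: lp_cutoff_def)
  obtain M where M: "M \<ge> 0" "\<And>x. \<bar>\<phi> x\<bar> \<le> M" using lp_cutoff_bounded[OF phi] by blast
  have iphi': "integrable lborel \<phi>'"
    unfolding \<phi>'_def
    by (rule continuous_compact_support_integrable[where r=1])
       (auto intro!: continuous_on_compose2[OF lp_cutoff_continuous[OF phi]] continuous_intros phi1)
  have cpos: "0 < (LINT y|lborel. \<phi>' y)"
    by (rule integral_pos_if_one_near_zero[OF iphi']) (use phi in \<open>auto simp: lp_cutoff_def \<phi>'_def\<close>)
  \<comment> \<open>Local integrability is itself read off from a test function: the dilate of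
    \<phi> by 1 / (2 L) equals 1 on the ball of radius L.\<close>
  have loc: "integrable lborel (\<lambda>x. indicator (ball 0 L) x *\<^sub>R d x)" if "L > 0" for L
  proof (rule Bochner_Integration.integrable_bound)
    show "integrable lborel (\<lambda>x. d x * complex_of_real (\<phi> (0 + (1 / (2 * L)) *\<^sub>R x)))"
      using that by (intro int lp_cutoff_schwartz phi) simp
    have "\<phi> ((1 / (2 * L)) *\<^sub>R x) = 1" if "norm x < L" for x
      using phi that \<open>L > 0\<close> by (auto simp: lp_cutoff_def field_simps)
    then show "AE x in lborel. norm (indicator (ball 0 L) x *\<^sub>R d x) \<le> norm (d x * complex_of_real (\<phi> (0 + (1 / (2 * L)) *\<^sub>R x)))"
      by (intro AE_I2) (auto split: split_indicator simp: norm_mult)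
    show "(\<lambda>x. indicator (ball 0 L) x *\<^sub>R d x) \<in> borel_measurable lborel"
      using \<open>d \<in> borel_measurable borel\<close> by (intro borel_measurable_scaleR borel_measurable_indicator) simp_all
  qed
  obtain L where L: "L > 0" "box l u \<subseteq> ball 0 L"
    using bounded_subset_ballD[OF bounded_box[of l u], of 0] by auto
  have id: "integrable lborel (\<lambda>x. indicator (ball 0 (L + 1)) x *\<^sub>R d x)"
    using L by (intro loc) simp
  show ib: "integrable lborel (\<lambda>x. indicator (box l u) x *\<^sub>R d x)"
  proof (rule Bochner_Integration.integrable_bound[OF loc[OF L(1)]])
    show "AE x in lborel. norm (indicator (box l u) x *\<^sub>R d x) \<le> norm (indicator (ball 0 L) x *\<^sub>R d x)"
      using L(2) by (intro AE_I2) (auto split: split_indicator)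
  qed measurable
  have ibox: "integrable lborel (\<lambda>a. indicator (box l u) a :: real)"
    by (intro integrable_real_indicator) (auto simp: emeasure_lborel_box_eq)

  have step: "(LINT x|lborel. d x * of_real (LINT y|lborel. indicator (box l u) (x + y /\<^sub>R real (Suc m)) * \<phi>' y)) = 0" for m
  proof -
    define k where "k = real (Suc m)"
    have k: "k > 0" "k \<ge> 1" by (auto simp: k_def)
    define T where "T a x = complex_of_real (\<phi> (- (k *\<^sub>R a) + k *\<^sub>R x))" for a x
    have T: "T a \<in> schwartz" for a unfolding T_def by (intro lp_cutoff_schwartz phi k)
    have sub: "(LINT y|lborel. indicator (box l u) (x + y /\<^sub>R k) * \<phi>' y) =
       k ^ DIM('a) * (LINT a|lborel. indicator (box l u) a * \<phi> (- (k *\<^sub>R a) + k *\<^sub>R x))" for x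
      using k
      by (subst (2) integral_lborel_affine[where t=x and c="1/k"])
         (auto simp: \<phi>'_def algebra_simps power_divide inverse_eq_divide)
    have T0: "indicator (box l u) a * norm (T a x) \<le> indicator (box l u) a * (M * indicator (ball 0 (L + 1)) x)" for a x
    proof (cases "a \<in> box l u \<and> T a x \<noteq> 0")
      case True
      then have "norm (- (k *\<^sub>R a) + k *\<^sub>R x) < 1" using phi1 unfolding T_def by force
      moreover have "- (k *\<^sub>R a) + k *\<^sub>R x = k *\<^sub>R (x - a)" by (simp add: algebra_simps)
      ultimately have "k * norm (x - a) < 1" using k by simp
      then have "norm (x - a) < 1" using k
        by (smt (verit) mult_le_cancel_right1 norm_ge_zero)
      moreover have "norm a < L" using True L by auto
      ultimately have "norm x < L + 1" by (smt (verit) norm_triangle_sub)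
      then show ?thesis using M(2) by (auto simp: T_def intro!: mult_left_mono)
    qed (use M in \<open>auto split: split_indicator\<close>)
    have prod: "integrable (lborel \<Otimes>\<^sub>M lborel) (\<lambda>(x, a). indicator (box l u) a *\<^sub>R (d x * T a x))"
    proof (rule Bochner_Integration.integrable_bound)
      show "integrable (lborel \<Otimes>\<^sub>M lborel) (\<lambda>(x, a). (indicator (ball 0 (L + 1)) x *\<^sub>R d x) * of_real (indicator (box l u) a * M))"
        by (rule pair_sigma_finite.integrable_pair_mult[OF lborel_pair.pair_sigma_finite_axioms]) (use ibox id in auto)
      show "AE z in lborel \<Otimes>\<^sub>M lborel. norm (case z of (x, a) \<Rightarrow> indicator (box l u) a *\<^sub>R (d x * T a x))
         \<le> norm (case z of (x, a) \<Rightarrow> (indicator (ball 0 (L + 1)) x *\<^sub>R d x) * complex_of_real (indicator (box l u) a * M))"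
      proof (intro AE_I2, clarify)
        fix x a
        show "norm (indicator (box l u) a *\<^sub>R (d x * T a x)) \<le> norm ((indicator (ball 0 (L + 1)) x *\<^sub>R d x) * complex_of_real (indicator (box l u) a * M))"
          using mult_left_mono[OF T0[of a x], of "norm (d x)"] M by (simp add: norm_mult abs_mult ac_simps)
      qed
      show "(\<lambda>(x, a). indicator (box l u) a *\<^sub>R (d x * T a x)) \<in> borel_measurable (lborel \<Otimes>\<^sub>M lborel)"
        unfolding T_def by measurable
    qed
    have "(LINT x|lborel. (LINT a|lborel. indicator (box l u) a *\<^sub>R (d x * T a x))) =
       (LINT a|lborel. (LINT x|lborel. indicator (box l u) a *\<^sub>R (d x * T a x)))"
      using lborel_pair.Fubini_integral[OF prod] by simp
    also have "\<dots> = 0" using zero[OF T] by simp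
    finally have z: "(LINT x|lborel. (LINT a|lborel. indicator (box l u) a *\<^sub>R (d x * T a x))) = 0" .
    have "(LINT a|lborel. indicator (box l u) a *\<^sub>R (d x * T a x)) =
        d x * of_real (LINT a|lborel. indicator (box l u) a * \<phi> (- (k *\<^sub>R a) + k *\<^sub>R x))" for x
      unfolding T_def integral_complex_of_real[symmetric] integral_mult_right_zero[symmetric]
      by (rule Bochner_Integration.integral_cong) (auto simp: scaleR_conv_of_real)
    then have "d x * of_real (LINT y|lborel. indicator (box l u) (x + y /\<^sub>R k) * \<phi>' y) =
        of_real (k ^ DIM('a)) * (LINT a|lborel. indicator (box l u) a *\<^sub>R (d x * T a x))" for x
      unfolding sub by simp
    then show ?thesis
      unfolding k_def[symmetric] using z by (simp del: of_real_power)
  qed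
  have "(\<lambda>m. LINT x|lborel. d x * of_real (LINT y|lborel. indicator (box l u) (x + y /\<^sub>R real (Suc m)) * \<phi>' y))
     \<longlonglongrightarrow> (LINT x|lborel. d x * of_real (indicator (box l u) x * (LINT y|lborel. \<phi>' y)))"
  proof (rule integral_dominated_convergence[where w="\<lambda>x. norm (indicator (ball 0 (L + 1)) x *\<^sub>R d x) * (LINT y|lborel. \<phi>' y)"])
    show "integrable lborel (\<lambda>x. norm (indicator (ball 0 (L + 1)) x *\<^sub>R d x) * (LINT y|lborel. \<phi>' y))"
      by (intro integrable_mult_left integrable_norm id)
    show "AE x in lborel. (\<lambda>m. d x * of_real (LINT y|lborel. indicator (box l u) (x + y /\<^sub>R real (Suc m)) * \<phi>' y))
      \<longlonglongrightarrow> d x * of_real (indicator (box l u) x * (LINT y|lborel. \<phi>' y))"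
      using AE_notin_frontier_box[of l u]
    proof eventually_elim
      case (elim x)
      show ?case by (intro tendsto_mult tendsto_of_real tendsto_const bump_mean_box_tendsto iphi' elim)
    qed
    fix m
    have "norm (d x * of_real (LINT y|lborel. indicator (box l u) (x + y /\<^sub>R real (Suc m)) * \<phi>' y))
      \<le> norm (indicator (ball 0 (L + 1)) x *\<^sub>R d x) * (LINT y|lborel. \<phi>' y)" for x
    proof -
      let ?I = "LINT y|lborel. indicator (box l u) (x + y /\<^sub>R real (Suc m)) * \<phi>' y"
      have pos: "0 \<le> \<phi>' y" for y using phi0 by (simp add: \<phi>'_def)
      have "?I \<ge> 0" by (rule Bochner_Integration.integral_nonneg) (auto simp: pos)
      moreover have "?I \<le> (LINT y|lborel. \<phi>' y)"
        by (rule integral_mono[OF Bochner_Integration.integrable_bound[OF iphi'] iphi'])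
           (auto simp: pos split: split_indicator)
      moreover have "?I = 0" if x: "x \<notin> ball 0 (L + 1)"
      proof -
        have "indicator (box l u) (x + y /\<^sub>R real (Suc m)) * \<phi>' y = 0" for y
        proof (cases "norm y < 1")
          case True
          have "norm (y /\<^sub>R real (Suc m)) \<le> norm y" by (simp add: field_simps)
          then have "norm (x + y /\<^sub>R real (Suc m)) > L"
            using x norm_diff_ineq[of x "y /\<^sub>R real (Suc m)"] True by simp
          then have "x + y /\<^sub>R real (Suc m) \<notin> box l u" using L(2) by force
          then show ?thesis by simp
        qed (auto simp: \<phi>'_def phi1)
        then show ?thesis by (simp only: Bochner_Integration.integral_zero)
      qed
      ultimately show ?thesis
        using cpos by (cases "x \<in> ball 0 (L + 1)") (auto simp: norm_mult intro!: mult_left_mono)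
    qed
    then show "AE x in lborel. norm (d x * of_real (LINT y|lborel. indicator (box l u) (x + y /\<^sub>R real (Suc m)) * \<phi>' y))
      \<le> norm (indicator (ball 0 (L + 1)) x *\<^sub>R d x) * (LINT y|lborel. \<phi>' y)"
      by (intro AE_I2)
  qed measurable
  then have "(LINT x|lborel. d x * of_real (indicator (box l u) x * (LINT y|lborel. \<phi>' y))) = 0"
    unfolding step by (simp add: LIMSEQ_const_iff)
  also have "(LINT x|lborel. d x * of_real (indicator (box l u) x * (LINT y|lborel. \<phi>' y)))
    = of_real (LINT y|lborel. \<phi>' y) * (LINT x:box l u|lborel. d x)"
    unfolding set_lebesgue_integral_def integral_mult_right_zero[symmetric]
    by (rule Bochner_Integration.integral_cong) (auto simp: scaleR_conv_of_real)
  finally show "(LINT x:box l u|lborel. d x) = 0" using cpos by simp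
qed

lemma represents_unique:
  fixes \<phi> :: "'a::euclidean_space \<Rightarrow> real" and g g' :: "'a \<Rightarrow> complex"
  assumes phi: "lp_cutoff \<phi>" and g: "represents g u" and g': "represents g' u"
  shows "AE x in lborel. g x = g' x"
proof -
  define d where "d x = g x - g' x" for x
  have m: "g \<in> borel_measurable borel" "g' \<in> borel_measurable borel"
    using g g' by (auto simp: represents_def)
  then have [measurable]: "d \<in> borel_measurable borel" unfolding d_def by measurable
  have int: "integrable lborel (\<lambda>x. d x * f x)" "(LINT x|lborel. d x * f x) = 0" if "f \<in> schwartz" for f
    using g g' that by (auto simp: represents_def d_def left_diff_distrib)
  note box = integral_against_box_zero[OF phi \<open>d \<in> borel_measurable borel\<close> int]
  \<comment> \<open>The difference d is only locally integrable, so it is cut off to growing cubes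
    before \<open>integral_zero_on_boxes\<close> applies.\<close>
  have "AE x in lborel. indicator (box (- real k *\<^sub>R One) (real k *\<^sub>R One)) x *\<^sub>R d x = 0" for k
  proof (rule integral_zero_on_boxes)
    let ?K = "box (- real k *\<^sub>R One) (real k *\<^sub>R One) :: 'a set"
    show "integrable lborel (\<lambda>x. indicator ?K x *\<^sub>R d x)" by (rule box(1))
    have "(LINT x:?K|lborel. d x) = 0" by (rule box(2))
    then show "(LINT x|lborel. indicator ?K x *\<^sub>R d x) = 0"
      by (simp add: set_lebesgue_integral_def)
    fix l u :: 'a
    obtain l' u' where B: "box l u \<inter> ?K = box l' u'" by (simp add: box_Int_box)
    have "(LINT x:box l' u'|lborel. d x) = 0" by (rule box(2))
    then have "(LINT x:box l u \<inter> ?K|lborel. d x) = 0" unfolding B .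
    then show "(LINT x:box l u|lborel. indicator ?K x *\<^sub>R d x) = 0"
      by (simp add: set_lebesgue_integral_def indicator_inter_arith)
  qed
  then have "AE x in lborel. \<forall>k. indicator (box (- real k *\<^sub>R One) (real k *\<^sub>R One)) x *\<^sub>R d x = 0"
    unfolding AE_all_countable by blast
  then show ?thesis
  proof eventually_elim
    case (elim x)
    have "x \<in> (\<Union>k::nat. box (- real k *\<^sub>R One) (real k *\<^sub>R One))"
      using UN_box_eq_UNIV by auto
    then obtain k :: nat where "x \<in> box (- real k *\<^sub>R One) (real k *\<^sub>R One)" by blast
    then have "d x = 0" using elim[rule_format, of k] by simp
    then show ?case by (simp add: d_def)
  qed
qed

section \<open>Extended powers and sums over the integers\<close>

lemma epowr_ennreal: "0 \<le> x \<Longrightarrow> epowr (ennreal x) a = ennreal (x powr a)"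
  by (simp add: epowr_def)

lemma epowr_mono: "x \<le> y \<Longrightarrow> 0 \<le> a \<Longrightarrow> epowr x a \<le> epowr y a"
  by (auto simp: epowr_def top_unique less_top intro!: ennreal_leI powr_mono2 enn2real_mono)

lemma epowr_inverse: "0 < a \<Longrightarrow> epowr (epowr x a) (1 / a) = x"
  by (cases x) (simp_all add: epowr_def powr_powr)

lemma epowr_inverse': "0 < a \<Longrightarrow> epowr (epowr x (1 / a)) a = x"
  by (cases x) (simp_all add: epowr_def powr_powr)

text \<open>Rewriting the Besov sum as an integral over counting measure gives access to Tonelli and
  monotonicity.\<close>

lemma infsum_ennreal_nn_integral:
  "(\<Sum>\<^sub>\<infinity>j::int. f j) = (\<integral>\<^sup>+ j. (f j :: ennreal) \<partial>count_space UNIV)"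
proof (rule antisym)
  have *: "(\<Sum>\<^sub>\<infinity>j. f j) = (SUP F\<in>{F. finite F}. sum f F)"
    by (subst nonneg_infsum_complete) auto
  show "(\<Sum>\<^sub>\<infinity>j. f j) \<le> (\<integral>\<^sup>+ j. f j \<partial>count_space UNIV)"
    unfolding *
  proof (rule SUP_least)
    fix F :: "int set" assume "F \<in> {F. finite F}"
    then have "sum f F = (\<integral>\<^sup>+ j. f j * indicator F j \<partial>count_space UNIV)"
      by (subst nn_integral_count_space_indicator[symmetric]) (auto simp: nn_integral_count_space_finite)
    also have "\<dots> \<le> (\<integral>\<^sup>+ j. f j \<partial>count_space UNIV)"
      by (intro nn_integral_mono) (auto split: split_indicator)
    finally show "sum f F \<le> \<dots>" .
  qed
  have "(\<integral>\<^sup>+ j. f j \<partial>count_space UNIV) = (\<integral>\<^sup>+ n. f (int_decode n) \<partial>count_space UNIV)"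
    by (rule nn_integral_bij_count_space[symmetric]) (rule bij_int_decode)
  also have "\<dots> = (\<Sum>n. f (int_decode n))" by (rule nn_integral_count_space_nat)
  also have "\<dots> = (SUP n. \<Sum>i<n. f (int_decode i))" by (rule suminf_eq_SUP)
  also have "\<dots> \<le> (\<Sum>\<^sub>\<infinity>j. f j)"
  proof (rule SUP_least)
    fix n :: nat
    have "(\<Sum>i<n. f (int_decode i)) = sum f (int_decode ` {..<n})"
      by (subst sum.reindex) (auto intro: inj_on_subset[OF inj_int_decode])
    also have "\<dots> \<le> (\<Sum>\<^sub>\<infinity>j. f j)" unfolding * by (rule SUP_upper) auto
    finally show "(\<Sum>i<n. f (int_decode i)) \<le> (\<Sum>\<^sub>\<infinity>j. f j)" .
  qed
  finally show "(\<integral>\<^sup>+ j. f j \<partial>count_space UNIV) \<le> (\<Sum>\<^sub>\<infinity>j. f j)" .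
qed

lemma nn_integral_count_space_ge:
  "f j \<le> (\<integral>\<^sup>+ j. (f j :: ennreal) \<partial>count_space (UNIV :: int set))"
proof -
  have "f j = (\<integral>\<^sup>+ i. f i * indicator {j} i \<partial>count_space UNIV)"
    by (simp add: nn_integral_indicator_singleton)
  also have "\<dots> \<le> (\<integral>\<^sup>+ j. f j \<partial>count_space UNIV)"
    by (intro nn_integral_mono) (auto split: split_indicator)
  finally show ?thesis .
qed

text \<open>The sum does not depend on the centre J, so the same K serves every level.\<close>

lemma two_sided_geometric:
  assumes e: "(e::real) > 0"
  obtains K where "K \<ge> 1" and "\<And>J. (\<integral>\<^sup>+ j. ennreal (2 powr (- e * \<bar>real_of_int (j - J)\<bar>)) \<partial>count_space UNIV) = ennreal K"
proof -
  let ?f = "\<lambda>j::int. ennreal (2 powr (- e * \<bar>real_of_int j\<bar>))"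
  define K where "K = (\<integral>\<^sup>+ j. ?f j \<partial>count_space UNIV)"
  define z where "z = 2 powr (- e)"
  have z: "0 < z" "z < 1" using e powr_less_mono[of "- e" 0 2] by (auto simp: z_def)
  have zn: "2 powr (- (e * real n)) = z ^ n" for n
    unfolding z_def by (subst powr_realpow[symmetric]) (simp_all add: powr_powr)
  \<comment> \<open>The index 0 is counted twice; the bound is only there to show that K is
    finite.\<close>
  have "K \<le> (\<integral>\<^sup>+ j. ?f j * indicator {0..} j + ?f j * indicator {..0} j \<partial>count_space UNIV)"
    unfolding K_def by (intro nn_integral_mono) (auto split: split_indicator)
  also have "\<dots> = (\<integral>\<^sup>+ j. ?f j * indicator {0..} j \<partial>count_space UNIV) + (\<integral>\<^sup>+ j. ?f j * indicator {..0} j \<partial>count_space UNIV)"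
    by (rule nn_integral_add) auto
  also have "(\<integral>\<^sup>+ j. ?f j * indicator {0..} j \<partial>count_space UNIV) = (\<integral>\<^sup>+ n. ?f (int n) \<partial>count_space UNIV)"
    by (subst nn_integral_count_space_indicator[symmetric], simp)
       (rule nn_integral_bij_count_space[symmetric], rule bij_betwI[where g=nat], auto)
  also have "(\<integral>\<^sup>+ j. ?f j * indicator {..0} j \<partial>count_space UNIV) = (\<integral>\<^sup>+ n. ?f (- int n) \<partial>count_space UNIV)"
    by (subst nn_integral_count_space_indicator[symmetric], simp)
       (rule nn_integral_bij_count_space[symmetric], rule bij_betwI[where g="\<lambda>j. nat (- j)"], auto)
  also have "(\<integral>\<^sup>+ n. ?f (int n) \<partial>count_space UNIV) = (\<Sum>n. ennreal (z ^ n))"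
    by (simp add: nn_integral_count_space_nat zn)
  also have "(\<integral>\<^sup>+ n. ?f (- int n) \<partial>count_space UNIV) = (\<Sum>n. ennreal (z ^ n))"
    by (simp add: nn_integral_count_space_nat zn)
  also have "(\<Sum>n. ennreal (z ^ n)) = ennreal (\<Sum>n. z ^ n)"
    using z by (intro suminf_ennreal2) (auto intro!: summable_geometric)
  finally have fin: "K < \<infinity>" by (auto simp: less_top[symmetric] top_unique)
  have "1 \<le> K" using nn_integral_count_space_ge[of ?f 0] by (simp add: K_def)
  with fin have K: "ennreal (enn2real K) = K" "1 \<le> enn2real K"
    using enn2real_mono[of 1 K] by (simp_all add: less_top)
  have "(\<integral>\<^sup>+ j. ennreal (2 powr (- e * \<bar>real_of_int (j - J)\<bar>)) \<partial>count_space UNIV) = K" for J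
    unfolding K_def
    by (rule nn_integral_bij_count_space[of "\<lambda>j. j - J" UNIV UNIV ?f])
       (rule bij_betwI[where g="\<lambda>j. j + J"], auto)
  then show ?thesis using K that[of "enn2real K"] by simp
qed

section \<open>Lebesgue norms\<close>

lemma enn2real_ge_1: "1 \<le> q \<Longrightarrow> q \<noteq> \<infinity> \<Longrightarrow> 1 \<le> enn2real q"
  by (metis enn2real_1 enn2real_mono infinity_ennreal_def less_top)

lemma Lq_norm_le_iff:
  assumes "1 \<le> q" "q \<noteq> \<infinity>" "0 \<le> N"
  shows "Lq_norm q g \<le> ennreal N \<longleftrightarrow>
    (\<integral>\<^sup>+ x. ennreal (norm (g x) powr enn2real q) \<partial>lborel) \<le> ennreal (N powr enn2real q)"
proof -
  have q: "0 < enn2real q" using enn2real_ge_1[OF assms(1,2)] by simp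
  have "epowr I (1 / enn2real q) \<le> ennreal N \<longleftrightarrow> I \<le> ennreal (N powr enn2real q)" for I
  proof
    assume "epowr I (1 / enn2real q) \<le> ennreal N"
    from epowr_mono[OF this, of "enn2real q"] q show "I \<le> ennreal (N powr enn2real q)"
      using assms by (simp add: epowr_inverse' epowr_ennreal)
  next
    assume "I \<le> ennreal (N powr enn2real q)"
    from epowr_mono[OF this, of "1 / enn2real q"] q show "epowr I (1 / enn2real q) \<le> ennreal N"
      using assms by (simp add: epowr_ennreal powr_powr)
  qed
  then show ?thesis using assms by (simp add: Lq_norm_def)
qed

lemma Lq_norm_infty_le_iff:
  assumes [measurable]: "g \<in> borel_measurable borel" and "0 \<le> N"
  shows "Lq_norm \<infinity> g \<le> ennreal N \<longleftrightarrow> (AE x in lborel. norm (g x) \<le> N)"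
proof
  assume *: "Lq_norm \<infinity> g \<le> ennreal N"
  have "AE x in lborel. ennreal (norm (g x)) \<le> esssup lborel (\<lambda>x. ennreal (norm (g x)))"
    by (rule esssup_AE)
  then show "AE x in lborel. norm (g x) \<le> N"
  proof eventually_elim
    case (elim x)
    then have "ennreal (norm (g x)) \<le> ennreal N" using * by (simp add: Lq_norm_def)
    then show ?case using assms by simp
  qed
next
  assume *: "AE x in lborel. norm (g x) \<le> N"
  show "Lq_norm \<infinity> g \<le> ennreal N"
    unfolding Lq_norm_def using * by (simp, intro esssup_I) (auto simp: ennreal_leI elim: eventually_mono)
qed

lemma Lq_norm_cong_AE:
  assumes [measurable]: "f \<in> borel_measurable borel" "g \<in> borel_measurable borel"
    and "AE x in lborel. f x = g x"
  shows "Lq_norm q f = Lq_norm q g"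
proof -
  have "(\<integral>\<^sup>+ x. ennreal (norm (f x) powr enn2real q) \<partial>lborel) = (\<integral>\<^sup>+ x. ennreal (norm (g x) powr enn2real q) \<partial>lborel)"
    by (rule nn_integral_cong_AE) (use assms(3) in \<open>auto elim: eventually_mono\<close>)
  moreover have "esssup lborel (\<lambda>x. ennreal (norm (f x))) = esssup lborel (\<lambda>x. ennreal (norm (g x)))"
    by (rule esssup_AE_cong) (use assms(3) in \<open>auto elim: eventually_mono\<close>)
  ultimately show ?thesis by (simp add: Lq_norm_def)
qed

text \<open>Chebyshev's inequality. One factor \<delta> is used to lower the height; the other
  survives as \<delta>^k <= \<delta> in the measure, which makes the bound the same for all q. For q
  = \<infinity> the exponent of s is 0 and the level set is null.\<close>

lemma Lq_norm_weak_type: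
  fixes g :: "'a::euclidean_space \<Rightarrow> complex"
  assumes [measurable]: "g \<in> borel_measurable borel" and q: "1 \<le> q"
    and d: "0 < \<delta>" "\<delta> \<le> 1" and ts: "0 < t" "0 < s"
    and N: "Lq_norm q g \<le> ennreal (\<delta>\<^sup>2 * (t * s powr (1 / enn2real q)))"
  shows "emeasure lborel {x. \<delta> * t < norm (g x)} \<le> ennreal (\<delta> * s)"
proof (cases "q = \<infinity>")
  case True
  have "AE x in lborel. norm (g x) \<le> \<delta>\<^sup>2 * t"
    using N ts unfolding True by (subst (asm) Lq_norm_infty_le_iff) auto
  then have "AE x in lborel. x \<notin> {x. \<delta> * t < norm (g x)}"
  proof eventually_elim
    case (elim x)
    have "\<delta>\<^sup>2 * t \<le> \<delta> * t" using d ts by (intro mult_right_mono) (auto simp: power2_eq_square mult_left_le_one_le)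
    with elim show ?case by auto
  qed
  then have "emeasure lborel {x. \<delta> * t < norm (g x)} = 0"
    by (subst (asm) AE_iff_measurable[OF _ refl]) auto
  then show ?thesis by simp
next
  case False
  define k where "k = enn2real q"
  have k: "1 \<le> k" using enn2real_ge_1[OF q False] by (simp add: k_def)
  have I: "(\<integral>\<^sup>+ x. ennreal (norm (g x) powr k) \<partial>lborel) \<le> ennreal ((\<delta>\<^sup>2 * (t * s powr (1 / k))) powr k)"
    using N ts unfolding k_def by (subst (asm) Lq_norm_le_iff[OF q False]) auto
  have pos: "0 < (\<delta> * t) powr k" using d ts by simp
  have "emeasure lborel {x. \<delta> * t < norm (g x)} = (\<integral>\<^sup>+ x. indicator {x. \<delta> * t < norm (g x)} x \<partial>lborel)"
    by simp
  also have "\<dots> \<le> (\<integral>\<^sup>+ x. ennreal (1 / (\<delta> * t) powr k) * ennreal (norm (g x) powr k) \<partial>lborel)"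
  proof (intro nn_integral_mono)
    fix x
    show "indicator {x. \<delta> * t < norm (g x)} x \<le> ennreal (1 / (\<delta> * t) powr k) * ennreal (norm (g x) powr k)"
    proof (cases "\<delta> * t < norm (g x)")
      case True
      then have "(\<delta> * t) powr k \<le> norm (g x) powr k" using d ts k by (intro powr_mono2) auto
      then have "1 \<le> 1 / (\<delta> * t) powr k * norm (g x) powr k" using pos by (simp add: field_simps)
      then show ?thesis using True by (simp add: ennreal_mult'[symmetric] ennreal_ge_1)
    qed simp
  qed
  also have "\<dots> = ennreal (1 / (\<delta> * t) powr k) * (\<integral>\<^sup>+ x. ennreal (norm (g x) powr k) \<partial>lborel)"
    by (rule nn_integral_cmult) measurable
  also have "\<dots> \<le> ennreal (1 / (\<delta> * t) powr k) * ennreal ((\<delta>\<^sup>2 * (t * s powr (1 / k))) powr k)"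
    by (intro mult_left_mono I) auto
  also have "\<dots> = ennreal (\<delta> powr k * s)"
  proof -
    have "(\<delta>\<^sup>2 * (t * s powr (1 / k))) powr k = (\<delta> * t) powr k * \<delta> powr k * s"
      using d ts k by (simp add: powr_mult powr_powr power2_eq_square ac_simps)
    then show ?thesis using pos by (simp add: ennreal_mult'[symmetric])
  qed
  also have "\<dots> \<le> ennreal (\<delta> * s)"
    using d ts k powr_mono'[of 1 k \<delta>] by (intro ennreal_leI mult_right_mono) auto
  finally show ?thesis .
qed

lemma ennreal_mult_add:
  "0 \<le> a \<Longrightarrow> 0 \<le> b \<Longrightarrow> 0 \<le> c \<Longrightarrow> 0 \<le> d \<Longrightarrow>
    ennreal a * ennreal b + ennreal c * ennreal d = ennreal (a * b + c * d)"
  by (simp add: ennreal_mult)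

text \<open>A substitute for Hoelder's inequality that treats all q alike: with w = |g| / N one has
  w <= w^k + 1, hence |g f| <= N (K w^k + |f|), and w^k has integral at most 1.\<close>

lemma nn_integral_Lq_pairing:
  fixes g f :: "'a::euclidean_space \<Rightarrow> complex"
  assumes [measurable]: "g \<in> borel_measurable borel" and q: "1 \<le> q" and N: "0 < N" "Lq_norm q g \<le> ennreal N"
    and f: "integrable lborel f" and K: "0 \<le> K" "\<And>x. norm (f x) \<le> K"
  shows "(\<integral>\<^sup>+ x. ennreal (norm (g x * f x)) \<partial>lborel) \<le> ennreal (N * (K + (LINT x|lborel. norm (f x))))"
proof -
  have [measurable]: "f \<in> borel_measurable borel" using f by (auto dest: borel_measurable_integrable)
  have If: "(\<integral>\<^sup>+ x. ennreal (norm (f x)) \<partial>lborel) = ennreal (LINT x|lborel. norm (f x))"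
    by (rule nn_integral_eq_integral) (use f in auto)
  have If0: "0 \<le> (LINT x|lborel. norm (f x))" by simp
  show ?thesis
  proof (cases "q = \<infinity>")
    case True
    have "AE x in lborel. norm (g x) \<le> N"
      using N unfolding True by (subst (asm) Lq_norm_infty_le_iff) auto
    then have "(\<integral>\<^sup>+ x. ennreal (norm (g x * f x)) \<partial>lborel) \<le> (\<integral>\<^sup>+ x. ennreal N * ennreal (norm (f x)) \<partial>lborel)"
    proof (intro nn_integral_mono_AE, eventually_elim)
      case (elim x)
      then show ?case using N by (auto simp: norm_mult ennreal_mult'[symmetric] intro!: ennreal_leI mult_right_mono)
    qed
    also have "\<dots> = ennreal (N * (LINT x|lborel. norm (f x)))"
      using N by (simp add: nn_integral_cmult If ennreal_mult')
    also have "\<dots> \<le> ennreal (N * (K + (LINT x|lborel. norm (f x))))"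
      using N K by (intro ennreal_leI mult_left_mono) auto
    finally show ?thesis .
  next
    case False
    define k where "k = enn2real q"
    have k: "1 \<le> k" using enn2real_ge_1[OF q False] by (simp add: k_def)
    have I: "(\<integral>\<^sup>+ x. ennreal (norm (g x) powr k) \<partial>lborel) \<le> ennreal (N powr k)"
      using N unfolding k_def by (subst (asm) Lq_norm_le_iff[OF q False]) auto
    have "(\<integral>\<^sup>+ x. ennreal (norm (g x * f x)) \<partial>lborel)
      \<le> (\<integral>\<^sup>+ x. ennreal (N * K / N powr k) * ennreal (norm (g x) powr k) + ennreal N * ennreal (norm (f x)) \<partial>lborel)"
    proof (intro nn_integral_mono)
      fix x
      define w where "w = norm (g x) / N"
      have w: "w \<ge> 0" using N by (simp add: w_def)
      have 1: "w \<le> w powr k + 1"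
        using w k powr_mono[of 1 k w] by (cases "w \<le> 1") (auto simp: add_increasing)
      have "norm (g x * f x) = N * (w * norm (f x))" using N by (simp add: norm_mult w_def)
      also have "\<dots> \<le> N * ((w powr k + 1) * norm (f x))"
        using 1 N by (intro mult_left_mono mult_right_mono) auto
      also have "\<dots> = N * (w powr k * norm (f x) + norm (f x))" by (simp add: algebra_simps)
      also have "\<dots> \<le> N * (w powr k * K + norm (f x))"
        using N K by (intro mult_left_mono add_right_mono) auto
      also have "\<dots> = N * K / N powr k * norm (g x) powr k + N * norm (f x)"
        using N by (simp add: w_def powr_divide algebra_simps)
      finally have "ennreal (norm (g x * f x)) \<le> ennreal (N * K / N powr k * norm (g x) powr k + N * norm (f x))"
        by (rule ennreal_leI)
      also have "\<dots> = ennreal (N * K / N powr k) * ennreal (norm (g x) powr k) + ennreal N * ennreal (norm (f x))"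
        by (rule ennreal_mult_add[symmetric]) (use N K in auto)
      finally show "ennreal (norm (g x * f x)) \<le> ennreal (N * K / N powr k) * ennreal (norm (g x) powr k) + ennreal N * ennreal (norm (f x))" .
    qed
    also have "\<dots> = ennreal (N * K / N powr k) * (\<integral>\<^sup>+ x. ennreal (norm (g x) powr k) \<partial>lborel) + ennreal N * (\<integral>\<^sup>+ x. ennreal (norm (f x)) \<partial>lborel)"
      by (subst nn_integral_add) (auto simp: nn_integral_cmult)
    also have "\<dots> \<le> ennreal (N * K / N powr k) * ennreal (N powr k) + ennreal N * (\<integral>\<^sup>+ x. ennreal (norm (f x)) \<partial>lborel)"
      by (intro add_right_mono mult_left_mono I) auto
    also have "\<dots> = ennreal (N * (K + (LINT x|lborel. norm (f x))))"
    proof -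
      have *: "N * K / N powr k * N powr k = N * K" using N by simp
      show ?thesis
        unfolding If distrib_left using N K If0
        by (subst ennreal_mult_add) (simp_all only: * mult_nonneg_nonneg divide_nonneg_nonneg powr_ge_zero less_imp_le)
    qed
    finally show ?thesis .
  qed
qed

lemma dist_Lq_norm_eq:
  fixes \<phi> :: "'a::euclidean_space \<Rightarrow> real" and g :: "'a \<Rightarrow> complex"
  assumes "lp_cutoff \<phi>" "represents g u"
  shows "dist_Lq_norm q u = Lq_norm q g"
proof -
  have "Lq_norm q g' = Lq_norm q g" if "represents g' u" for g'
    using represents_unique[OF assms(1) that assms(2)] that assms(2)
    by (intro Lq_norm_cong_AE) (auto simp: represents_def)
  then have "dist_Lq_norm q u = (INF g'\<in>{g. represents g u}. Lq_norm q g)"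
    unfolding dist_Lq_norm_def by (intro INF_cong) simp_all
  also have "\<dots> = Lq_norm q g"
    by (rule cINF_const) (use assms(2) in blast)
  finally show ?thesis .
qed

section \<open>Dyadic sums in Lorentz spaces\<close>

text \<open>The r-th power of a supremum is at most the sum of the r-th powers, and the weights
  satisfy w^r <= w for r >= 1. Tonelli therefore costs the same factor K for every r. One positive
  entry of x already makes y positive everywhere, which later permits division.\<close>

lemma slowly_varying_majorant:
  fixes x :: "int \<Rightarrow> real"
  assumes e: "\<epsilon> > 0" and x: "\<And>k. 0 \<le> x k" "\<And>k. x k \<le> 1" and pos: "0 < x k0"
    and K: "\<And>J. (\<integral>\<^sup>+ j. ennreal (2 powr (- \<epsilon> * \<bar>real_of_int (j - J)\<bar>)) \<partial>count_space UNIV) = ennreal K"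
  obtains y where "\<And>j. x j \<le> y j" "\<And>j. 0 < y j" "\<And>j. y j \<le> 1"
    "\<And>j k. y k \<le> 2 powr (\<epsilon> * \<bar>real_of_int (k - j)\<bar>) * y j"
    "\<And>r. 1 \<le> r \<Longrightarrow> (\<integral>\<^sup>+ j. ennreal (y j powr r) \<partial>count_space UNIV)
        \<le> ennreal K * (\<integral>\<^sup>+ j. ennreal (x j powr r) \<partial>count_space UNIV)"
proof -
  define w where "w j k = 2 powr (- \<epsilon> * \<bar>real_of_int (j - k)\<bar>)" for j k
  have wjj: "w j j = 1" for j by (simp add: w_def)
  have w: "0 < w j k" "w j k \<le> 1" for j k
    using powr_mono[of "- \<epsilon> * \<bar>real_of_int (j - k)\<bar>" 0 2] e by (auto simp: w_def)
  define y where "y j = (SUP k. w j k * x k)" for j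
  have wx: "w j k * x k \<le> 1" "0 \<le> w j k * x k" for j k
    using w[of j k] x[of k] by (auto intro: mult_le_one)
  have bdd: "bdd_above (range (\<lambda>k. w j k * x k))" for j
    using wx by (auto intro!: bdd_aboveI)
  have ge: "w j k * x k \<le> y j" for j k unfolding y_def by (rule cSUP_upper[OF _ bdd]) simp
  have 1: "x j \<le> y j" for j using ge[of j j] wjj by simp
  have 2: "0 < y j" for j
    using ge[of j k0] mult_pos_pos[OF w(1)[of j k0] pos] by linarith
  have 3: "y j \<le> 1" for j unfolding y_def by (rule cSUP_least) (use wx in auto)
  have 4: "y k \<le> 2 powr (\<epsilon> * \<bar>real_of_int (k - j)\<bar>) * y j" for j k
    unfolding y_def[of k]
  proof (rule cSUP_least)
    fix l
    have "\<bar>real_of_int (j - l)\<bar> \<le> \<bar>real_of_int (k - j)\<bar> + \<bar>real_of_int (k - l)\<bar>" by linarith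
    then have "- \<epsilon> * \<bar>real_of_int (k - l)\<bar> \<le> \<epsilon> * \<bar>real_of_int (k - j)\<bar> + - \<epsilon> * \<bar>real_of_int (j - l)\<bar>"
      using mult_left_mono[of _ _ \<epsilon>] e by (fastforce simp: algebra_simps)
    then have "w k l \<le> 2 powr (\<epsilon> * \<bar>real_of_int (k - j)\<bar>) * w j l"
      unfolding w_def powr_add[symmetric] by (intro powr_mono) auto
    then have "w k l * x l \<le> 2 powr (\<epsilon> * \<bar>real_of_int (k - j)\<bar>) * w j l * x l"
      using x by (intro mult_right_mono) auto
    also have "\<dots> \<le> 2 powr (\<epsilon> * \<bar>real_of_int (k - j)\<bar>) * y j"
      unfolding mult.assoc by (intro mult_left_mono ge) auto
    finally show "w k l * x l \<le> 2 powr (\<epsilon> * \<bar>real_of_int (k - j)\<bar>) * y j" .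
  qed simp
  have 5: "(\<integral>\<^sup>+ j. ennreal (y j powr r) \<partial>count_space UNIV)
        \<le> ennreal K * (\<integral>\<^sup>+ j. ennreal (x j powr r) \<partial>count_space UNIV)" if r: "1 \<le> r" for r
  proof -
    have "ennreal (y j powr r) \<le> (\<integral>\<^sup>+ k. ennreal (w j k) * ennreal (x k powr r) \<partial>count_space UNIV)" for j
    proof (cases "\<integral>\<^sup>+ k. ennreal (w j k) * ennreal (x k powr r) \<partial>count_space UNIV")
      case (real S)
      have "w j k * x k \<le> S powr (1 / r)" for k
      proof -
        have "ennreal (w j k) * ennreal (x k powr r) \<le> ennreal S"
          using nn_integral_count_space_ge[of "\<lambda>k. ennreal (w j k) * ennreal (x k powr r)" k] real by simp
        then have *: "w j k * x k powr r \<le> S"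
          using w[of j k] real by (simp add: ennreal_mult'[symmetric])
        have "(w j k * x k) powr r = w j k powr r * x k powr r"
          using w[of j k] x by (simp add: powr_mult)
        also have "\<dots> \<le> w j k * x k powr r"
          using w[of j k] r powr_mono'[of 1 r "w j k"] by (intro mult_right_mono) auto
        finally have "((w j k * x k) powr r) powr (1 / r) \<le> S powr (1 / r)"
          using * r by (intro powr_mono2) auto
        then show ?thesis using r wx[of j k] by (simp add: powr_powr)
      qed
      then have "y j \<le> S powr (1 / r)" unfolding y_def by (intro cSUP_least) auto
      then have "y j powr r \<le> (S powr (1 / r)) powr r" using 2[of j] r by (intro powr_mono2) auto
      then show ?thesis using r real by (simp add: powr_powr ennreal_leI)
    qed simp
    then have "(\<integral>\<^sup>+ j. ennreal (y j powr r) \<partial>count_space UNIV)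
      \<le> (\<integral>\<^sup>+ j. (\<integral>\<^sup>+ k. ennreal (w j k) * ennreal (x k powr r) \<partial>count_space UNIV) \<partial>count_space UNIV)"
      by (intro nn_integral_mono)
    also have "\<dots> = (\<integral>\<^sup>+ k. (\<integral>\<^sup>+ j. ennreal (w j k) * ennreal (x k powr r) \<partial>count_space UNIV) \<partial>count_space UNIV)"
      by (rule nn_integral_count_space_nn_integral) auto
    also have "\<dots> = (\<integral>\<^sup>+ k. ennreal K * ennreal (x k powr r) \<partial>count_space UNIV)"
      unfolding w_def by (simp add: nn_integral_multc K[simplified])
    also have "\<dots> = ennreal K * (\<integral>\<^sup>+ k. ennreal (x k powr r) \<partial>count_space UNIV)"
      by (rule nn_integral_cmult) simp
    finally show ?thesis .
  qed
  show ?thesis by (rule that[OF 1 2 3 4 5])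
qed

lemma emeasure_UN_int_le:
  fixes E :: "int \<Rightarrow> 'a::euclidean_space set"
  assumes [measurable]: "\<And>j. E j \<in> sets borel"
  shows "emeasure lborel (\<Union>j. E j) \<le> (\<integral>\<^sup>+ j. emeasure lborel (E j) \<partial>count_space UNIV)"
proof -
  have "emeasure lborel (\<Union>j. E j) = (\<integral>\<^sup>+ x. indicator (\<Union>j. E j) x \<partial>lborel)" by simp
  also have "\<dots> \<le> (\<integral>\<^sup>+ x. (\<integral>\<^sup>+ j. indicator (E j) x \<partial>count_space UNIV) \<partial>lborel)"
  proof (intro nn_integral_mono)
    fix x
    show "indicator (\<Union>j. E j) x \<le> (\<integral>\<^sup>+ j. (indicator (E j) x :: ennreal) \<partial>count_space UNIV)"
    proof (cases "x \<in> (\<Union>j. E j)")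
      case True
      then obtain j where "x \<in> E j" by auto
      then show ?thesis
        using nn_integral_count_space_ge[of "\<lambda>j. indicator (E j) x" j] True by simp
    qed simp
  qed
  also have "\<dots> = (\<integral>\<^sup>+ j. (\<integral>\<^sup>+ x. indicator (E j) x \<partial>lborel) \<partial>count_space UNIV)"
    by (rule nn_integral_count_space_nn_integral) auto
  finally show ?thesis by simp
qed

text \<open>The union of the exceptional sets has measure at most K s, and outside it the series is
  bounded term by term by the sum of the \<delta> j t, that is by K t.\<close>

lemma rearrangement_sum_le:
  fixes g :: "int \<Rightarrow> 'a::euclidean_space \<Rightarrow> complex"
  assumes meas[measurable]: "\<And>j. g j \<in> borel_measurable borel"
    and K: "(\<integral>\<^sup>+ j. ennreal (\<delta> j) \<partial>count_space UNIV) = ennreal K" "0 < K" and d: "\<And>j. 0 \<le> \<delta> j"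
    and t: "0 < t" and s: "0 < s"
    and E: "\<And>j. emeasure lborel {x. \<delta> j * t < norm (g j x)} \<le> ennreal (\<delta> j * s)"
    and s': "K * s \<le> s'"
  shows "rearrangement (\<lambda>x. LINT j|count_space UNIV. g j x) s' \<le> ennreal (K * t)"
proof -
  let ?G = "\<lambda>x. LINT j|count_space UNIV. g j x"
  let ?E = "\<Union>j. {x. \<delta> j * t < norm (g j x)}"
  have "emeasure lborel ?E \<le> (\<integral>\<^sup>+ j. emeasure lborel {x. \<delta> j * t < norm (g j x)} \<partial>count_space UNIV)"
    by (rule emeasure_UN_int_le) measurable
  also have "\<dots> \<le> (\<integral>\<^sup>+ j. ennreal (\<delta> j) * ennreal s \<partial>count_space UNIV)"
    using E d s by (intro nn_integral_mono) (simp add: ennreal_mult)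
  also have "\<dots> = ennreal (K * s)"
    using K s by (simp add: nn_integral_multc ennreal_mult')
  also have "\<dots> \<le> ennreal s'" using s' by (rule ennreal_leI)
  finally have Es: "emeasure lborel ?E \<le> ennreal s'" .
  have off: "norm (?G x) \<le> K * t" if "x \<notin> ?E" for x
  proof -
    have le: "norm (g j x) \<le> \<delta> j * t" for j using that by (auto simp: not_less)
    \<comment> \<open>Where the series is not absolutely convergent, the integral over counting
      measure is 0 by convention and the bound holds trivially.\<close>
    have "ennreal (norm (?G x)) \<le> (\<integral>\<^sup>+ j. ennreal (norm (g j x)) \<partial>count_space UNIV)"
      by (cases "integrable (count_space UNIV) (\<lambda>j. g j x)")
         (auto intro: integral_norm_bound_ennreal simp: not_integrable_integral_eq)
    also have "\<dots> \<le> (\<integral>\<^sup>+ j. ennreal (\<delta> j) * ennreal t \<partial>count_space UNIV)"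
      using le d t by (intro nn_integral_mono) (simp add: ennreal_mult'[symmetric] ennreal_leI)
    also have "\<dots> = ennreal (K * t)"
      using K t by (simp add: nn_integral_multc ennreal_mult')
    finally show ?thesis using K t by simp
  qed
  \<comment> \<open>\<open>distribution_fun\<close> counts points where the level is attained, so
    the level K t itself may catch points outside ?E. Levels u above it do not, and u is then
    lowered to K t.\<close>
  have "rearrangement ?G s' \<le> u" if u: "ennreal (K * t) < u" for u
  proof -
    have "{x. u \<le> ennreal (norm (?G x))} \<subseteq> ?E"
    proof
      fix x assume "x \<in> {x. u \<le> ennreal (norm (?G x))}"
      then have "ennreal (K * t) < ennreal (norm (?G x))" using u by auto
      then have "K * t < norm (?G x)" using K t by (simp add: ennreal_less_iff)
      then show "x \<in> ?E" using off[of x] by fastforce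
    qed
    then have "distribution_fun ?G u \<le> emeasure lborel ?E"
      unfolding distribution_fun_def by (intro emeasure_mono) auto
    also note Es
    finally show ?thesis unfolding rearrangement_def by (intro Inf_lower) simp
  qed
  then show ?thesis by (rule dense_ge)
qed

section \<open>Discretising the Lorentz norm along quasi-geometric levels\<close>

lemma quasi_geometric_interval:
  fixes \<rho> :: "int \<Rightarrow> real"
  assumes pos: "\<And>j. 0 < \<rho> j" and c: "1 < c" and dec: "\<And>j. c * \<rho> (j + 1) \<le> \<rho> j" and y: "0 < y"
  obtains j where "\<rho> (j + 1) \<le> y" "y \<le> \<rho> j"
proof -
  have up: "c ^ n * \<rho> (j + int n) \<le> \<rho> j" for n j
  proof (induction n arbitrary: j)
    case (Suc n)
    have "c ^ Suc n * \<rho> (j + int (Suc n)) = c * (c ^ n * \<rho> ((j + 1) + int n))" by (simp add: ac_simps)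
    also have "\<dots> \<le> c * \<rho> (j + 1)" using Suc[of "j + 1"] c by simp
    also have "\<dots> \<le> \<rho> j" by (rule dec)
    finally show ?case .
  qed simp
  obtain n where n: "\<rho> 0 / y < c ^ n" using real_arch_pow[OF c] by blast
  have "c ^ n * \<rho> (int n) \<le> \<rho> 0" using up[of n 0] by simp
  also have "\<dots> < c ^ n * y" using n y by (simp add: field_simps)
  finally have lo: "\<rho> (int n) \<le> y" using c by simp
  obtain m where m: "y / \<rho> 0 < c ^ m" using real_arch_pow[OF c] by blast
  have "y < c ^ m * \<rho> 0" using m pos by (simp add: field_simps)
  also have "\<dots> \<le> \<rho> (- int m)" using up[of m "- int m"] by simp
  finally have hi: "y < \<rho> (- int m)" .
  define P where "P i \<longleftrightarrow> \<rho> (- int m + int i) \<le> y" for i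
  have "P (m + n)" using lo by (simp add: P_def)
  then have L: "P (LEAST i. P i)" by (rule LeastI)
  have "\<not> P 0" using hi by (simp add: P_def)
  then obtain i where i: "(LEAST i. P i) = Suc i" using L by (metis not0_implies_Suc)
  then have "\<not> P i" using not_less_Least[of i P] by simp
  then show ?thesis using L i that[of "- int m + int i"] by (auto simp: P_def algebra_simps)
qed

text \<open>Enclose s^\<delta> between two consecutive values of \<rho> and take the power 1 /
  \<delta>. This reverses order for negative \<delta>, so the lower end comes from index j + 1 if
  \<delta> > 0 and from index j if \<delta> < 0.\<close>

lemma quasi_geometric_covering:
  fixes \<rho> :: "int \<Rightarrow> real"
  assumes pos: "\<And>j. 0 < \<rho> j" and c: "1 < c" and dec: "\<And>j. c * \<rho> (j + 1) \<le> \<rho> j"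
    and c': "\<And>j. \<rho> j \<le> c' * \<rho> (j + 1)" "0 < c'" and d: "\<delta> \<noteq> 0" and s: "0 < s"
  shows "\<exists>j. \<rho> j powr (1 / \<delta>) \<le> s \<and> s \<le> c' powr (1 / \<bar>\<delta>\<bar>) * \<rho> j powr (1 / \<delta>)"
proof -
  obtain j where j: "\<rho> (j + 1) \<le> s powr \<delta>" "s powr \<delta> \<le> \<rho> j"
    by (rule quasi_geometric_interval[where \<rho>=\<rho> and y="s powr \<delta>", OF pos c dec]) (use s in auto)
  have s': "(s powr \<delta>) powr (1 / \<delta>) = s" using s d by (simp add: powr_powr)
  show ?thesis
  proof (cases "\<delta> > 0")
    case True
    have "\<rho> (j + 1) powr (1 / \<delta>) \<le> s"
      using powr_mono2[OF _ _ j(1), of "1 / \<delta>"] True pos[of "j + 1"] s' by simp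
    moreover have "s \<le> (c' * \<rho> (j + 1)) powr (1 / \<delta>)"
      using powr_mono2[OF _ _ order_trans[OF j(2) c'(1)], of "1 / \<delta>"] True s' by simp
    ultimately show ?thesis using True c'(2) pos[of "j + 1"] by (auto simp: powr_mult intro!: exI[of _ "j + 1"])
  next
    case False
    with d have d: "\<delta> < 0" by simp
    have "\<rho> j powr (1 / \<delta>) \<le> s"
      using powr_mono2'[OF _ _ j(2), of "1 / \<delta>"] d s s' by simp
    moreover have "s \<le> (\<rho> j / c') powr (1 / \<delta>)"
    proof -
      have "\<rho> j / c' \<le> s powr \<delta>" using order_trans[OF c'(1)[of j] mult_left_mono[OF j(1), of c']] c'(2) by (simp add: field_simps)
      from powr_mono2'[OF _ _ this, of "1 / \<delta>"] d pos[of j] c' s' show ?thesis by simp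
    qed
    moreover have "(\<rho> j / c') powr (1 / \<delta>) = c' powr (1 / \<bar>\<delta>\<bar>) * \<rho> j powr (1 / \<delta>)"
    proof -
      have "1 / \<bar>\<delta>\<bar> = - (1 / \<delta>)" using d by simp
      then have "c' powr (1 / \<bar>\<delta>\<bar>) = inverse (c' powr (1 / \<delta>))" by (simp only: powr_minus)
      moreover have "(\<rho> j / c') powr (1 / \<delta>) = \<rho> j powr (1 / \<delta>) / c' powr (1 / \<delta>)"
        by (rule powr_divide)
      ultimately show ?thesis by (simp only: divide_inverse mult.commute)
    qed
    ultimately show ?thesis by auto
  qed
qed

lemma weighted_rearrangement_le:
  fixes G :: "'a::euclidean_space \<Rightarrow> complex" and s t :: "int \<Rightarrow> real"
  assumes K: "0 < K" and L: "1 \<le> \<Lambda>" and st: "\<And>j. 0 < s j" "\<And>j. 0 < t j" and p: "0 < p"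
    and re: "\<And>j u. K * s j \<le> u \<Longrightarrow> rearrangement G u \<le> ennreal (K * t j)"
    and u: "K * s j \<le> u" "u \<le> \<Lambda> * (K * s j)"
  shows "ennreal (u powr (1 / p)) * rearrangement G u
    \<le> ennreal ((\<Lambda> * K) powr (1 / p) * K * (t j * s j powr (1 / p)))"
proof -
  have u0: "0 < u" using mult_pos_pos[OF K st(1)[of j]] u(1) by linarith
  have "u powr (1 / p) \<le> (\<Lambda> * (K * s j)) powr (1 / p)"
    by (rule powr_mono2[OF _ _ u(2)]) (use u0 p in simp_all)
  also have "\<dots> = (\<Lambda> * K) powr (1 / p) * s j powr (1 / p)"
    unfolding mult.assoc[symmetric, of \<Lambda>] by (rule powr_mult)
  finally have "ennreal (u powr (1 / p)) * rearrangement G u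
      \<le> ennreal ((\<Lambda> * K) powr (1 / p) * s j powr (1 / p)) * ennreal (K * t j)"
    by (rule mult_mono[OF ennreal_leI re[OF u(1)]]) auto
  also have "\<dots> = ennreal ((\<Lambda> * K) powr (1 / p) * K * (t j * s j powr (1 / p)))"
    by (subst ennreal_mult'[symmetric]) (simp_all only: mult_ac powr_ge_zero mult_nonneg_nonneg)
  finally show ?thesis .
qed

lemma lorentz_norm_le_sup:
  fixes G :: "'a::euclidean_space \<Rightarrow> complex" and s t :: "int \<Rightarrow> real"
  assumes K: "0 < K" and L: "1 \<le> \<Lambda>" and st: "\<And>j. 0 < s j" "\<And>j. 0 < t j" and p: "0 < p"
    and cover: "\<And>u. 0 < u \<Longrightarrow> \<exists>j. K * s j \<le> u \<and> u \<le> \<Lambda> * (K * s j)"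
    and re: "\<And>j u. K * s j \<le> u \<Longrightarrow> rearrangement G u \<le> ennreal (K * t j)"
    and S: "\<And>j. t j * s j powr (1 / p) \<le> S"
  shows "lorentz_norm p \<infinity> G \<le> ennreal ((\<Lambda> * K) powr (1 / p) * K * S)"
  unfolding lorentz_norm_def if_P[OF refl]
proof (rule SUP_least)
  fix u :: real assume "u \<in> {0<..}"
  then obtain j where j: "K * s j \<le> u" "u \<le> \<Lambda> * (K * s j)" using cover[of u] by auto
  have "ennreal (u powr (1 / p)) * rearrangement G u
      \<le> ennreal ((\<Lambda> * K) powr (1 / p) * K * (t j * s j powr (1 / p)))"
    by (rule weighted_rearrangement_le[where s=s and t=t, OF K L st p re j])
  also have "\<dots> \<le> ennreal ((\<Lambda> * K) powr (1 / p) * K * S)"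
    using K by (intro ennreal_leI mult_left_mono S) auto
  finally show "ennreal (u powr (1 / p)) * rearrangement G u \<le> ennreal ((\<Lambda> * K) powr (1 / p) * K * S)" .
qed

text \<open>The intervals from K s j to \<Lambda> K s j cover the half-line. They may overlap, but
  summing over all of them only increases the bound. Replacing 1 / u by its value at the left end,
  each contributes at most \<Lambda> - 1 to the measure ds / s.\<close>

lemma lorentz_norm_le_sum:
  fixes G :: "'a::euclidean_space \<Rightarrow> complex" and s t :: "int \<Rightarrow> real"
  assumes K: "0 < K" and L: "1 \<le> \<Lambda>" and st: "\<And>j. 0 < s j" "\<And>j. 0 < t j" and p: "0 < p"
    and cover: "\<And>u. 0 < u \<Longrightarrow> \<exists>j. K * s j \<le> u \<and> u \<le> \<Lambda> * (K * s j)"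
    and re: "\<And>j u. K * s j \<le> u \<Longrightarrow> rearrangement G u \<le> ennreal (K * t j)"
    and r: "1 \<le> r" and S0: "0 \<le> S"
    and S: "(\<integral>\<^sup>+ j. ennreal ((t j * s j powr (1 / p)) powr r) \<partial>count_space UNIV) \<le> ennreal S"
  shows "lorentz_norm p (ennreal r) G \<le> ennreal ((\<Lambda> * K) powr (1 / p) * K * (\<Lambda> * S) powr (1 / r))"
proof -
  define D where "D = (\<Lambda> * K) powr (1 / p) * K"
  have D: "0 < D" using K L by (simp add: D_def)
  define c where "c j = t j * s j powr (1 / p)" for j
  have c: "0 < c j" for j using st(1)[of j] st(2)[of j] by (simp add: c_def)
  have pt: "ennreal (u powr (1 / p)) * rearrangement G u \<le> ennreal (D * c j)"
    if "K * s j \<le> u" "u \<le> \<Lambda> * (K * s j)" for u j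
    unfolding D_def c_def by (rule weighted_rearrangement_le[where s=s and t=t, OF K L st p re that])
  have "(\<integral>\<^sup>+ u \<in> {0<..}. epowr (ennreal (u powr (1 / p)) * rearrangement G u) r / ennreal u \<partial>lborel)
    \<le> (\<integral>\<^sup>+ u. (\<integral>\<^sup>+ j. ennreal ((D * c j) powr r / (K * s j)) * indicator {K * s j..\<Lambda> * (K * s j)} u \<partial>count_space UNIV) \<partial>lborel)"
  proof (intro nn_integral_mono)
    fix u :: real
    show "epowr (ennreal (u powr (1 / p)) * rearrangement G u) r / ennreal u * indicator {0<..} u
      \<le> (\<integral>\<^sup>+ j. ennreal ((D * c j) powr r / (K * s j)) * indicator {K * s j..\<Lambda> * (K * s j)} u \<partial>count_space UNIV)"
    proof (cases "u > 0")
      case True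
      then obtain j where j: "K * s j \<le> u" "u \<le> \<Lambda> * (K * s j)" using cover[of u] by auto
      have Ks: "0 < K * s j" using K st(1)[of j] by simp
      have "epowr (ennreal (u powr (1 / p)) * rearrangement G u) r \<le> epowr (ennreal (D * c j)) r"
        by (rule epowr_mono[OF pt[OF j]]) (use r in simp)
      also have "\<dots> = ennreal ((D * c j) powr r)" using D c[of j] by (simp add: epowr_ennreal)
      finally have "epowr (ennreal (u powr (1 / p)) * rearrangement G u) r / ennreal u
        \<le> ennreal ((D * c j) powr r) / ennreal u"
        by (rule divide_right_mono_ennreal)
      also have "\<dots> = ennreal ((D * c j) powr r / u)" using True by (simp add: divide_ennreal)
      also have "\<dots> \<le> ennreal ((D * c j) powr r / (K * s j))"
        using j Ks by (intro ennreal_leI divide_left_mono) auto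
      also have "\<dots> = ennreal ((D * c j) powr r / (K * s j)) * indicator {K * s j..\<Lambda> * (K * s j)} u"
        using j by simp
      also have "\<dots> \<le> (\<integral>\<^sup>+ j. ennreal ((D * c j) powr r / (K * s j)) * indicator {K * s j..\<Lambda> * (K * s j)} u \<partial>count_space UNIV)"
        by (rule nn_integral_count_space_ge[where j=j and f="\<lambda>j. ennreal ((D * c j) powr r / (K * s j)) * indicator {K * s j..\<Lambda> * (K * s j)} u"])
      finally show ?thesis using True by simp
    qed simp
  qed
  also have "\<dots> = (\<integral>\<^sup>+ j. (\<integral>\<^sup>+ u. ennreal ((D * c j) powr r / (K * s j)) * indicator {K * s j..\<Lambda> * (K * s j)} u \<partial>lborel) \<partial>count_space UNIV)"
    by (rule nn_integral_count_space_nn_integral) auto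
  also have "\<dots> \<le> (\<integral>\<^sup>+ j. ennreal (\<Lambda> * D powr r) * ennreal (c j powr r) \<partial>count_space UNIV)"
  proof (intro nn_integral_mono)
    fix j
    have Ks: "0 < K * s j" using K st(1)[of j] by simp
    have "(\<integral>\<^sup>+ u. ennreal ((D * c j) powr r / (K * s j)) * indicator {K * s j..\<Lambda> * (K * s j)} u \<partial>lborel)
      = ennreal ((D * c j) powr r / (K * s j)) * ennreal (\<Lambda> * (K * s j) - K * s j)"
      using Ks L by (subst nn_integral_cmult_indicator) (auto simp: mult_le_cancel_right1)
    also have "\<dots> = ennreal ((D * c j) powr r / (K * s j) * (\<Lambda> * (K * s j) - K * s j))"
      using Ks by (intro ennreal_mult'[symmetric]) auto
    also have "\<dots> = ennreal ((D * c j) powr r * (\<Lambda> - 1))"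
    proof -
      have "a / k * (\<Lambda> * k - k) = a * (\<Lambda> - 1)" if "k \<noteq> 0" for a k :: real
        using that by (simp add: field_simps)
      from this[OF less_imp_neq[OF Ks, symmetric], of "(D * c j) powr r"] show ?thesis by (rule arg_cong)
    qed
    also have "\<dots> \<le> ennreal (\<Lambda> * D powr r * c j powr r)"
      using D c[of j] L by (intro ennreal_leI) (simp add: powr_mult mult_ac mult_left_mono)
    also have "\<dots> = ennreal (\<Lambda> * D powr r) * ennreal (c j powr r)"
      using L by (simp add: ennreal_mult')
    finally show "(\<integral>\<^sup>+ u. ennreal ((D * c j) powr r / (K * s j)) * indicator {K * s j..\<Lambda> * (K * s j)} u \<partial>lborel) \<le> \<dots>" .
  qed
  also have "\<dots> = ennreal (\<Lambda> * D powr r) * (\<integral>\<^sup>+ j. ennreal (c j powr r) \<partial>count_space UNIV)"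
    by (rule nn_integral_cmult) simp
  also have "\<dots> \<le> ennreal (\<Lambda> * D powr r) * ennreal S"
    using S by (intro mult_left_mono) (auto simp: c_def)
  also have "\<dots> = ennreal ((D * (\<Lambda> * S) powr (1 / r)) powr r)"
  proof -
    have "(D * (\<Lambda> * S) powr (1 / r)) powr r = D powr r * ((\<Lambda> * S) powr (1 / r)) powr r"
      by (rule powr_mult)
    also have "((\<Lambda> * S) powr (1 / r)) powr r = \<Lambda> * S"
      using L S0 r by (simp add: powr_powr)
    also have "D powr r * (\<Lambda> * S) = \<Lambda> * D powr r * S" by (simp only: mult_ac)
    finally have *: "(D * (\<Lambda> * S) powr (1 / r)) powr r = \<Lambda> * D powr r * S" .
    show ?thesis unfolding * by (rule ennreal_mult'[symmetric]) (use L in auto)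
  qed
  finally have "epowr (\<integral>\<^sup>+ u \<in> {0<..}. epowr (ennreal (u powr (1 / p)) * rearrangement G u) r / ennreal u \<partial>lborel) (1 / r)
     \<le> epowr (ennreal ((D * (\<Lambda> * S) powr (1 / r)) powr r)) (1 / r)"
    by (rule epowr_mono) (use r in simp)
  also have "\<dots> = ennreal (D * (\<Lambda> * S) powr (1 / r))"
    using r D by (simp add: epowr_ennreal powr_powr)
  finally have *: "epowr (\<integral>\<^sup>+ u \<in> {0<..}. epowr (ennreal (u powr (1 / p)) * rearrangement G u) r / ennreal u \<partial>lborel) (1 / r)
     \<le> ennreal (D * (\<Lambda> * S) powr (1 / r))" .
  have e: "enn2real (ennreal r) = r" "ennreal r \<noteq> \<infinity>" using r by auto
  show ?thesis unfolding lorentz_norm_def if_not_P[OF e(2)] e(1) D_def[symmetric] by (rule *)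
qed

section \<open>The inequality\<close>

lemma besov_seminorm_finite_exponent:
  assumes "r \<noteq> \<infinity>"
  shows "besov_seminorm \<phi> s q r u = epowr
       (\<integral>\<^sup>+ j. ennreal (2 powr (real_of_int j * s * enn2real r)) *
          epowr (dist_Lq_norm q (dyadic_block \<phi> j u)) (enn2real r) \<partial>count_space UNIV)
       (1 / enn2real r)"
  unfolding besov_seminorm_def if_not_P[OF assms] infsum_ennreal_nn_integral ..

lemma epowr_powr_mult:
  "0 < a \<Longrightarrow> 0 \<le> r \<Longrightarrow> ennreal (a powr r) * epowr x r = epowr (ennreal a * x) r"
  by (cases x) (auto simp: epowr_def ennreal_mult_top powr_mult ennreal_mult'[symmetric] ennreal_mult_eq_top_iff)

lemma besov_seminorm_ge:
  assumes r: "1 \<le> r"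
  shows "ennreal (2 powr (real_of_int j * s)) * dist_Lq_norm q (dyadic_block \<phi> j u)
    \<le> besov_seminorm \<phi> s q r u"
proof (cases "r = \<infinity>")
  case True
  then show ?thesis unfolding besov_seminorm_def if_P[OF True] by (intro SUP_upper) simp
next
  case False
  define d where "d j = dist_Lq_norm q (dyadic_block \<phi> j u)" for j
  have r1: "0 < enn2real r" using enn2real_ge_1[OF r False] by simp
  have "epowr (ennreal (2 powr (real_of_int j * s)) * d j) (enn2real r)
      = ennreal (2 powr (real_of_int j * s * enn2real r)) * epowr (d j) (enn2real r)"
    using r1 by (subst epowr_powr_mult[symmetric]) (simp_all add: powr_powr)
  also have "\<dots> \<le> (\<integral>\<^sup>+ j. ennreal (2 powr (real_of_int j * s * enn2real r)) * epowr (d j) (enn2real r) \<partial>count_space UNIV)"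
    by (rule nn_integral_count_space_ge[where f="\<lambda>j. ennreal (2 powr (real_of_int j * s * enn2real r)) * epowr (d j) (enn2real r)"])
  finally have "epowr (epowr (ennreal (2 powr (real_of_int j * s)) * d j) (enn2real r)) (1 / enn2real r)
    \<le> epowr (\<integral>\<^sup>+ j. ennreal (2 powr (real_of_int j * s * enn2real r)) * epowr (d j) (enn2real r) \<partial>count_space UNIV) (1 / enn2real r)"
    by (rule epowr_mono) (use r1 in simp)
  then show ?thesis
    unfolding besov_seminorm_finite_exponent[OF False] epowr_inverse[OF r1] d_def .
qed

text \<open>Dividing by A brings the weighted block norms into [0, 1], where powers decrease in the
  exponent. Some entry is positive, since otherwise the semi-norm would be 0.\<close>

lemma besov_seminorm_normalised:
  assumes r: "1 \<le> r" and A: "besov_seminorm \<phi> s q r u = ennreal A" "0 < A"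
  obtains x k0 where "\<And>j. 0 \<le> x j" "\<And>j. x j \<le> 1" "0 < x k0"
    "\<And>j. dist_Lq_norm q (dyadic_block \<phi> j u) = ennreal (A * 2 powr (- (real_of_int j * s)) * x j)"
    "r \<noteq> \<infinity> \<Longrightarrow> (\<integral>\<^sup>+ j. ennreal (x j powr enn2real r) \<partial>count_space UNIV) \<le> 1"
proof -
  define d where "d j = dist_Lq_norm q (dyadic_block \<phi> j u)" for j
  define z where "z j = 2 powr (real_of_int j * s)" for j
  have z: "0 < z j" for j by (simp add: z_def)
  have zi: "2 powr (- (real_of_int j * s)) = 1 / z j" for j
    by (simp add: z_def powr_minus_divide)
  have le: "ennreal (z j) * d j \<le> ennreal A" for j
    using besov_seminorm_ge[OF r, of j s q \<phi> u] unfolding A d_def z_def .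
  have dfin: "d j \<noteq> \<infinity>" for j
  proof
    assume "d j = \<infinity>"
    then show False using le[of j] z[of j] by (simp add: ennreal_mult_top top_unique)
  qed
  define e where "e j = enn2real (d j)" for j
  have e: "d j = ennreal (e j)" "0 \<le> e j" for j using dfin[of j] by (auto simp: e_def less_top)
  define x where "x j = z j * e j / A" for j
  have x0: "0 \<le> x j" for j using z[of j] e(2)[of j] A by (simp add: x_def)
  have x1: "x j \<le> 1" for j
    using le[of j] z[of j] e(2)[of j] A by (simp add: x_def e(1) ennreal_mult'[symmetric])
  have dx: "d j = ennreal (A * 2 powr (- (real_of_int j * s)) * x j)" for j
    using z[of j] A by (simp add: e(1) zi x_def)
  have sum: "(\<integral>\<^sup>+ j. ennreal (x j powr enn2real r) \<partial>count_space UNIV) \<le> 1"  if rf: "r \<noteq> \<infinity>"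
  proof -
    define k where "k = enn2real r"
    have k: "1 \<le> k" using enn2real_ge_1[OF r rf] by (simp add: k_def)
    let ?I = "\<integral>\<^sup>+ j. ennreal (2 powr (real_of_int j * s * k)) * epowr (d j) k \<partial>count_space UNIV"
    have "epowr ?I (1 / k) = ennreal A"
      using A(1) unfolding besov_seminorm_finite_exponent[OF rf] d_def k_def .
    then have "?I = epowr (ennreal A) k" using epowr_inverse'[of k ?I] k by simp
    then have I: "?I = ennreal (A powr k)" using A by (simp add: epowr_ennreal)
    have "ennreal (x j powr k) = ennreal (1 / A powr k) * (ennreal (2 powr (real_of_int j * s * k)) * epowr (d j) k)" for j
    proof -
      have "ennreal (2 powr (real_of_int j * s * k)) * epowr (d j) k = ennreal ((z j * e j) powr k)"
        unfolding e(1) using e(2)[of j]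
        by (simp add: epowr_ennreal ennreal_mult'[symmetric] powr_mult z_def powr_powr)
      moreover have "x j powr k = 1 / A powr k * (z j * e j) powr k"
        by (simp add: x_def powr_divide)
      ultimately show ?thesis by (simp only: ennreal_mult' divide_nonneg_nonneg zero_le_one powr_ge_zero)
    qed
    then have "(\<integral>\<^sup>+ j. ennreal (x j powr k) \<partial>count_space UNIV) = ennreal (1 / A powr k) * ?I"
      by (simp add: nn_integral_cmult)
    also have "\<dots> = 1" unfolding I using A by (simp add: ennreal_mult'[symmetric])
    finally show ?thesis by (simp add: k_def)
  qed
  have "\<exists>k0. 0 < x k0"
  proof (rule ccontr)
    assume "\<not> ?thesis"
    then have "x j = 0" for j using x0[of j] by (metis less_eq_real_def)
    then have d0: "d j = 0" for j using dx[of j] by simp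
    have "besov_seminorm \<phi> s q r u = 0"
    proof (cases "r = \<infinity>")
      case True
      show ?thesis unfolding besov_seminorm_def if_P[OF True] d0[unfolded d_def] by simp
    next
      case False
      show ?thesis unfolding besov_seminorm_finite_exponent[OF False] d0[unfolded d_def] 
        by (simp add: epowr_def)
    qed
    then show False using A by simp
  qed
  then obtain k0 where "0 < x k0" by blast
  then show ?thesis using that[of x k0] x0 x1 dx sum unfolding d_def by blast
qed

section \<open>From the blocks to a function representing the distribution\<close>

text \<open>Summation is written as integration over counting measure, so that exchanging the series
  with the pairing is Fubini. Absolute convergence is asked for only after testing against
  f.\<close>

lemma represents_has_sum:
  fixes g :: "int \<Rightarrow> 'a::euclidean_space \<Rightarrow> complex"
  assumes rep: "\<And>j. represents (g j) (v j)"
    and sum: "\<And>f. f \<in> schwartz \<Longrightarrow> ((\<lambda>j. v j f) has_sum u f) UNIV"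
    and fin: "\<And>f. f \<in> schwartz \<Longrightarrow>
      (\<integral>\<^sup>+ j. (\<integral>\<^sup>+ x. ennreal (norm (g j x * f x)) \<partial>lborel) \<partial>count_space UNIV) < \<infinity>"
  shows "represents (\<lambda>x. LINT j|count_space UNIV. g j x) u"
proof -
  interpret P: pair_sigma_finite "count_space (UNIV :: int set)" "lborel :: 'a measure"
    by (intro pair_sigma_finite.intro sigma_finite_measure_count_space lborel.sigma_finite_measure_axioms)
  have [measurable]: "g j \<in> borel_measurable borel" for j using rep[of j] by (simp add: represents_def)
  have gm: "(\<lambda>(x, j). g j x) \<in> borel_measurable (lborel \<Otimes>\<^sub>M count_space UNIV)"
    using measurable_pair_swap[OF measurable_pair_measure_countable1[of UNIV "\<lambda>(j, x). g j x" lborel borel]]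
    by simp
  have Gm: "(\<lambda>x. LINT j|count_space UNIV. g j x) \<in> borel_measurable lborel"
    by (rule sigma_finite_measure.borel_measurable_lebesgue_integral[OF sigma_finite_measure_count_space gm])
  have "integrable lborel (\<lambda>x. (LINT j|count_space UNIV. g j x) * f x) \<and>
     u f = (LINT x|lborel. (LINT j|count_space UNIV. g j x) * f x)" if f: "f \<in> schwartz" for f
  proof -
    have [measurable]: "f \<in> borel_measurable borel" by (rule schwartz_measurable[OF f])
    have vi: "integrable lborel (\<lambda>x. g j x * f x)" "v j f = (LINT x|lborel. g j x * f x)" for j
      using rep[of j] f by (auto simp: represents_def)
    have I: "integrable (count_space UNIV \<Otimes>\<^sub>M lborel) (\<lambda>(j, x). g j x * f x)"
    proof (rule P.Fubini_integrable)
      show "(\<lambda>(j, x). g j x * f x) \<in> borel_measurable (count_space UNIV \<Otimes>\<^sub>M lborel)"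
        by (rule measurable_pair_measure_countable1) auto
      have "(\<integral>\<^sup>+ j. ennreal (norm (LINT x|lborel. norm (g j x * f x))) \<partial>count_space UNIV)
          = (\<integral>\<^sup>+ j. (\<integral>\<^sup>+ x. ennreal (norm (g j x * f x)) \<partial>lborel) \<partial>count_space UNIV)"
        by (intro nn_integral_cong, subst nn_integral_eq_integral) (use vi in auto)
      also have "\<dots> < \<infinity>" by (rule fin[OF f])
      finally show "integrable (count_space UNIV) (\<lambda>j. LINT x|lborel. norm (case (j, x) of (j, x) \<Rightarrow> g j x * f x))"
        by (simp add: integrable_iff_bounded)
      show "AE j in count_space UNIV. integrable lborel (\<lambda>x. case (j, x) of (j, x) \<Rightarrow> g j x * f x)"
        using vi by simp
    qed
    have eq: "(LINT j|count_space UNIV. g j x * f x) = (LINT j|count_space UNIV. g j x) * f x" for x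
      by simp
    have 1: "integrable lborel (\<lambda>x. (LINT j|count_space UNIV. g j x) * f x)"
      using P.integrable_snd[OF I] unfolding eq .
    have 2: "(LINT x|lborel. (LINT j|count_space UNIV. g j x) * f x) = (LINT j|count_space UNIV. v j f)"
      using P.Fubini_integral[OF I] unfolding eq vi(2) .
    have 3: "integrable (count_space UNIV) (\<lambda>j. v j f)"
      using P.integrable_fst[OF I] unfolding vi(2) .
    have "(LINT j|count_space UNIV. v j f) = infsum (\<lambda>j. v j f) UNIV"
      using infsetsum_infsum[of "\<lambda>j. v j f" UNIV] 3 by (simp add: abs_summable_on_def infsetsum_def)
    also have "\<dots> = u f" by (rule infsumI[OF sum[OF f]])
    finally show ?thesis using 1 2 by simp
  qed
  then show ?thesis using Gm by (simp add: represents_def)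
qed

text \<open>An infimum equal to 0 provides representing functions of arbitrarily small norm, and
  each of them bounds |v f| by its norm times a constant depending on f.\<close>

lemma pairing_zero_if_dist_Lq_norm_zero:
  assumes rep: "dist_Lq_norm q v = 0" and q: "1 \<le> q" and f: "f \<in> schwartz"
  shows "v f = 0"
proof (rule ccontr)
  assume nz: "v f \<noteq> 0"
  obtain M where M: "0 \<le> M" "\<And>x. norm (f x) \<le> M" by (rule schwartz_bounded[OF f]) auto
  define c where "c = M + (LINT x|lborel. norm (f x)) + 1"
  have c: "0 < c" using M by (simp add: c_def add_nonneg_pos)
  define N where "N = norm (v f) / (2 * c)"
  have N: "0 < N" using nz c by (simp add: N_def)
  have "(INF g \<in> {g. represents g v}. Lq_norm q g) < ennreal N"
    using rep N by (simp add: dist_Lq_norm_def)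
  then obtain g where g: "represents g v" "Lq_norm q g < ennreal N"
    by (auto simp: INF_less_iff)
  have vg: "v f = (LINT x|lborel. g x * f x)" "integrable lborel (\<lambda>x. g x * f x)"
    using g f by (auto simp: represents_def)
  have "ennreal (norm (v f)) \<le> (\<integral>\<^sup>+ x. ennreal (norm (g x * f x)) \<partial>lborel)"
    unfolding vg(1) by (rule integral_norm_bound_ennreal[OF vg(2)])
  also have "\<dots> \<le> ennreal (N * (M + (LINT x|lborel. norm (f x))))"
    by (rule nn_integral_Lq_pairing[OF _ q N less_imp_le[OF g(2)] schwartz_integrable[OF f] M])
       (use g in \<open>simp add: represents_def\<close>)
  also have "\<dots> \<le> ennreal (N * c)" using N by (intro ennreal_leI mult_left_mono) (auto simp: c_def)
  finally have "norm (v f) \<le> N * c" using N c by simp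
  then show False using nz c by (simp add: N_def)
qed

text \<open>This settles the degenerate case in which normalising by the semi-norm is impossible:
  all blocks vanish, and u is their sum.\<close>

lemma besov_seminorm_zero_imp_zero:
  assumes z: "besov_seminorm \<phi> s q r u = 0" and r: "1 \<le> r" and q: "1 \<le> q"
    and sum: "((\<lambda>j. dyadic_block \<phi> j u f) has_sum u f) UNIV" and f: "f \<in> schwartz"
  shows "u f = 0"
proof -
  have "ennreal (2 powr (real_of_int j * s)) * dist_Lq_norm q (dyadic_block \<phi> j u) \<le> 0" for j
    using besov_seminorm_ge[OF r, of j s q \<phi> u] z by simp
  then have "dist_Lq_norm q (dyadic_block \<phi> j u) = 0" for j by (auto simp: ennreal_eq_0_iff)
  then have "dyadic_block \<phi> j u f = 0" for j
    using pairing_zero_if_dist_Lq_norm_zero q f by blast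
  then have "((\<lambda>j::int. 0 :: complex) has_sum u f) UNIV" using sum by simp
  then show ?thesis using has_sum_0 has_sum_unique by (metis (mono_tags))
qed

lemma rearrangement_zero: "0 < s \<Longrightarrow> rearrangement (\<lambda>x. 0) s = 0"
proof -
  have "rearrangement (\<lambda>x. 0) s \<le> u" if "0 < u" for u :: ennreal
    unfolding rearrangement_def using that
    by (intro Inf_lower) (simp add: distribution_fun_def not_le[symmetric])
  then show ?thesis by (metis dense_ge le_zero_eq)
qed

lemma lorentz_norm_zero: "lorentz_norm p r (\<lambda>x. 0) = 0"
proof (cases "r = \<infinity>")
  case True
  have "(SUP s\<in>{0<..}. ennreal (s powr (1 / p)) * rearrangement (\<lambda>x. 0) s) = (SUP s\<in>({0<..} :: real set). 0)"
    by (rule SUP_cong) (auto simp: rearrangement_zero)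
  then show ?thesis unfolding lorentz_norm_def if_P[OF True] by simp
next
  case False
  have "(\<integral>\<^sup>+ s \<in> {0<..}. epowr (ennreal (s powr (1 / p)) * rearrangement (\<lambda>x. 0) s) (enn2real r) / ennreal s \<partial>lborel)
    = (\<integral>\<^sup>+ s. 0 \<partial>(lborel :: real measure))"
    by (rule nn_integral_cong) (auto simp: rearrangement_zero epowr_def split: split_indicator)
  also have "\<dots> = 0" by simp
  finally have *: "(\<integral>\<^sup>+ s \<in> {0<..}. epowr (ennreal (s powr (1 / p)) * rearrangement (\<lambda>x. 0) s) (enn2real r) / ennreal s \<partial>lborel) = 0" .
  show ?thesis unfolding lorentz_norm_def if_not_P[OF False] * by (simp add: epowr_def)
qed

text \<open>Since \<open>enn2real \<infinity> = 0\<close> and \<open>1 / 0 = 0\<close>, the term \<open>1 / enn2real q\<close> is the reciprocal of \<open>q\<close>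
  also for \<open>q = \<infinity>\<close>.\<close>

lemma ennreal_divide_exponent:
  assumes "1 \<le> q" "0 \<le> c"
  shows "ennreal c / q = ennreal (c * (1 / enn2real q))"
proof (cases "q = \<infinity>")
  case False
  then have "q = ennreal (enn2real q)" by (simp add: less_top)
  moreover have "0 < enn2real q" using enn2real_ge_1[OF assms(1) False] by simp
  ultimately have "ennreal c / q = ennreal (c / enn2real q)"
    using divide_ennreal[OF assms(2)] by metis
  then show ?thesis by simp
qed simp

lemma interpolated_reciprocal:
  assumes "1 \<le> r0" "1 \<le> r1" "0 < \<theta>" "\<theta> < 1"
  shows "ennreal (1 - \<theta>) / r0 + ennreal \<theta> / r1 =
    ennreal ((1 - \<theta>) * (1 / enn2real r0) + \<theta> * (1 / enn2real r1))"
proof -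
  have "0 \<le> 1 / enn2real r0" "0 \<le> 1 / enn2real r1" by auto
  then show ?thesis
    using assms
    by (simp only: ennreal_divide_exponent less_imp_le diff_ge_0_iff_ge ennreal_plus mult_nonneg_nonneg)
qed

lemma inverse_exponents_neq:
  assumes "1 \<le> q0" "1 \<le> q1" "q0 \<noteq> q1"
  shows "1 / enn2real q0 \<noteq> 1 / enn2real q1"
proof
  assume *: "1 / enn2real q0 = 1 / enn2real q1"
  have "enn2real q = 0 \<longleftrightarrow> q = \<infinity>" if "1 \<le> q" for q
    using enn2real_ge_1[OF that] by fastforce
  then have **: "q0 = \<infinity> \<longleftrightarrow> q1 = \<infinity>" using * assms by (metis div_by_0 divide_eq_0_iff zero_neq_one)
  have "q0 \<noteq> \<infinity>" using ** assms(3) by auto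
  then have "enn2real q0 = enn2real q1" "q0 < top" "q1 < top"
    using * ** by (auto simp: less_top)
  then have "q0 = q1" by (metis ennreal_enn2real)
  then show False using assms by simp
qed

text \<open>Distinct reciprocals cannot both be 0, so the right-hand side is positive; it is also
  finite, which excludes p <= 0, where \<open>ennreal p\<close> is 0 with reciprocal \<infinity>.
  The equation may then be read in the reals.\<close>

lemma interpolated_exponent:
  assumes q: "1 \<le> q0" "1 \<le> q1" "q0 \<noteq> q1" and th: "0 < \<theta>" "\<theta> < 1"
    and p: "1 / ennreal p = ennreal (1 - \<theta>) / q0 + ennreal \<theta> / q1"
  shows "0 < p" and "1 / p = (1 - \<theta>) * (1 / enn2real q0) + \<theta> * (1 / enn2real q1)"
proof -
  let ?i0 = "1 / enn2real q0" and ?i1 = "1 / enn2real q1"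
  define v where "v = (1 - \<theta>) * ?i0 + \<theta> * ?i1"
  have i: "0 \<le> ?i0" "0 \<le> ?i1" "?i0 \<noteq> ?i1" using inverse_exponents_neq[OF q] by auto
  then have "0 < ?i0 \<or> 0 < ?i1" by linarith
  then have v: "0 < v"
    unfolding v_def using th i
    by (metis add_nonneg_pos add_pos_nonneg diff_gt_0_iff_gt less_imp_le mult_nonneg_nonneg mult_pos_pos)
  have pv: "1 / ennreal p = ennreal v"
    unfolding p v_def by (rule interpolated_reciprocal[OF q(1,2) th])
  show p0: "0 < p"
  proof (rule ccontr)
    assume "\<not> 0 < p"
    then have "ennreal p = 0" by (simp add: ennreal_eq_0_iff)
    then have "1 / ennreal p = \<infinity>" by (simp add: ennreal_divide_eq_top_iff)
    then show False using pv by simp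
  qed
  have "1 / ennreal p = ennreal (1 / p)"
    using p0 divide_ennreal[of 1 p] by simp
  then show "1 / p = v" using pv v p0 by simp
qed

text \<open>A finite r forces a finite rstar, so the extended equation becomes v = 1 / rstar in the
  reals, and v r >= 1 restates rstar <= r.\<close>

lemma summation_exponent_ge:
  assumes r: "1 \<le> r0" "1 \<le> r1" and th: "0 < \<theta>" "\<theta> < 1"
    and rs: "1 / rstar = ennreal (1 - \<theta>) / r0 + ennreal \<theta> / r1"
    and le: "rstar \<le> r" and fin: "r \<noteq> \<infinity>"
  shows "1 \<le> ((1 - \<theta>) * (1 / enn2real r0) + \<theta> * (1 / enn2real r1)) * enn2real r"
proof -
  let ?k0 = "1 / enn2real r0" and ?k1 = "1 / enn2real r1"
  define v where "v = (1 - \<theta>) * ?k0 + \<theta> * ?k1"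
  have v0: "0 \<le> v" unfolding v_def using th by simp
  have rv: "1 / rstar = ennreal v"
    unfolding rs v_def by (rule interpolated_reciprocal[OF r th])
  have rfin: "rstar < top" using le fin by (auto simp: less_top top_unique)
  define s where "s = enn2real rstar"
  have s: "rstar = ennreal s" "0 \<le> s" using rfin by (auto simp: s_def)
  have s0: "0 < s"
  proof (rule ccontr)
    assume "\<not> 0 < s"
    then have "rstar = 0" using s by simp
    then have "1 / rstar = \<infinity>" by (simp add: ennreal_divide_eq_top_iff)
    then show False using rv by simp
  qed
  have "1 / rstar = ennreal (1 / s)" using divide_ennreal[of 1 s] s0 s(1) by simp
  then have "v = 1 / s" using rv v0 s0 by simp
  moreover have "s \<le> enn2real r" unfolding s_def using le fin by (intro enn2real_mono) (auto simp: less_top)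
  ultimately show ?thesis using s0 by (simp add: v_def)
qed

text \<open>Let m be the larger of x^r0 and y^r1. Then x <= m^(1/r0) and y <= m^(1/r1), so the left
  side is at most a power of m with exponent at least 1, hence at most m because m <= 1. An infinite
  exponent contributes 0 to m, and the corresponding bound is just x <= 1 or y <= 1.\<close>

lemma interpolated_summand_le:
  fixes x y r :: real
  assumes r01: "1 \<le> r0" "1 \<le> r1" and th: "0 < \<theta>" "\<theta> < 1"
    and xy: "0 < x" "x \<le> 1" "0 < y" "y \<le> 1" and r: "1 \<le> r"
    and w: "1 \<le> ((1 - \<theta>) * (1 / enn2real r0) + \<theta> * (1 / enn2real r1)) * r"
  shows "(x powr (1 - \<theta>) * y powr \<theta>) powr r \<le>
     (if r0 = \<infinity> then 0 else x powr enn2real r0) + (if r1 = \<infinity> then 0 else y powr enn2real r1)"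
proof -
  let ?k0 = "1 / enn2real r0" and ?k1 = "1 / enn2real r1"
  define X where "X = (if r0 = \<infinity> then 0 else x powr enn2real r0)"
  define Y where "Y = (if r1 = \<infinity> then 0 else y powr enn2real r1)"
  define m where "m = max X Y"
  have r0: "1 \<le> enn2real r0" if "r0 \<noteq> \<infinity>" using enn2real_ge_1[OF r01(1) that] .
  have r1: "1 \<le> enn2real r1" if "r1 \<noteq> \<infinity>" using enn2real_ge_1[OF r01(2) that] .
  have XY: "0 \<le> X" "0 \<le> Y" by (auto simp: X_def Y_def)
  have "\<not> (r0 = \<infinity> \<and> r1 = \<infinity>)" using w by auto
  then have m0: "0 < m" using xy by (auto simp: m_def X_def Y_def less_max_iff_disj)
  have m1: "m \<le> 1" using xy r0 r1 by (auto simp: m_def X_def Y_def intro!: powr_le1)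
  have x: "x \<le> m powr ?k0"
  proof (cases "r0 = \<infinity>")
    case False
    have "x = X powr ?k0" using False xy r0 by (simp add: X_def powr_powr)
    also have "\<dots> \<le> m powr ?k0" using XY by (intro powr_mono2) (auto simp: m_def)
    finally show ?thesis .
  qed (use xy m0 in simp)
  have y: "y \<le> m powr ?k1"
  proof (cases "r1 = \<infinity>")
    case False
    have "y = Y powr ?k1" using False xy r1 by (simp add: Y_def powr_powr)
    also have "\<dots> \<le> m powr ?k1" using XY by (intro powr_mono2) (auto simp: m_def)
    finally show ?thesis .
  qed (use xy m0 in simp)
  have "x powr (1 - \<theta>) * y powr \<theta> \<le> (m powr ?k0) powr (1 - \<theta>) * (m powr ?k1) powr \<theta>"
    using x y xy th by (intro mult_mono powr_mono2) auto
  also have "\<dots> = m powr (?k0 * (1 - \<theta>)) * m powr (?k1 * \<theta>)" by (simp only: powr_powr)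
  also have "\<dots> = m powr (?k0 * (1 - \<theta>) + ?k1 * \<theta>)" by (simp only: powr_add)
  finally have "(x powr (1 - \<theta>) * y powr \<theta>) powr r \<le> (m powr (?k0 * (1 - \<theta>) + ?k1 * \<theta>)) powr r"
    using xy r by (intro powr_mono2) auto
  also have "\<dots> = m powr (((1 - \<theta>) * ?k0 + \<theta> * ?k1) * r)"
    unfolding powr_powr by (simp only: mult.commute)
  also have "\<dots> \<le> m powr 1" using m0 m1 w by (intro powr_mono') auto
  also have "\<dots> \<le> X + Y" using m0 XY by (simp add: m_def)
  finally show ?thesis unfolding X_def Y_def .
qed

text \<open>Solves t s^i0 = X and t s^i1 = Y: the quotient of the two equations determines s, the
  first then t. The weighted geometric mean of the equations is the last identity.\<close>

lemma interpolation_parameters: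
  fixes X Y i0 i1 \<theta> :: real
  assumes XY: "0 < X" "0 < Y" and i: "i0 \<noteq> i1"
    and s: "s = (X / Y) powr (1 / (i0 - i1))" and t: "t = X * s powr (- i0)"
  shows "0 < s" "0 < t" "t * s powr i0 = X" "t * s powr i1 = Y"
    "t * s powr ((1 - \<theta>) * i0 + \<theta> * i1) = X powr (1 - \<theta>) * Y powr \<theta>"
proof -
  show s0: "0 < s" using XY by (simp add: s)
  then show t0: "0 < t" using XY by (simp add: t)
  show tX: "t * s powr i0 = X" using s0 by (simp add: t powr_minus)
  have "s powr (i0 - i1) = X / Y" using XY i by (simp add: s powr_powr)
  then have "s powr i0 * Y = X * s powr i1" using s0 XY by (simp add: powr_diff field_simps)
  moreover have "t * s powr i1 * s powr i0 = X * s powr i1"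
    using tX by (metis mult.assoc mult.commute)
  ultimately have "t * s powr i1 * s powr i0 = Y * s powr i0" by (metis mult.commute)
  then show tY: "t * s powr i1 = Y" using s0 by simp
  have "X powr (1 - \<theta>) * Y powr \<theta> = (t powr (1 - \<theta>) * t powr \<theta>) * (s powr (i0 * (1 - \<theta>)) * s powr (i1 * \<theta>))"
    unfolding tX[symmetric] tY[symmetric] powr_mult powr_powr by (simp only: mult_ac)
  also have "t powr (1 - \<theta>) * t powr \<theta> = t"
    using t0 by (simp add: powr_add[symmetric])
  also have "s powr (i0 * (1 - \<theta>)) * s powr (i1 * \<theta>) = s powr ((1 - \<theta>) * i0 + \<theta> * i1)"
    unfolding powr_add[symmetric] by (simp only: mult.commute)
  finally show "t * s powr ((1 - \<theta>) * i0 + \<theta> * i1) = X powr (1 - \<theta>) * Y powr \<theta>" by simp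
qed

lemma weighted_geometric_decay:
  fixes x :: "int \<Rightarrow> real"
  assumes A: "0 < A" and sv: "\<And>j k. x k \<le> 2 powr (\<epsilon> * \<bar>real_of_int (k - j)\<bar>) * x j"
  shows "A * 2 powr (real_of_int k * c) * x k
    \<le> 2 powr (\<epsilon> * \<bar>real_of_int (k - j)\<bar> + real_of_int (k - j) * c) * (A * 2 powr (real_of_int j * c) * x j)"
proof -
  have "A * 2 powr (real_of_int k * c) * x k
      \<le> A * 2 powr (real_of_int k * c) * (2 powr (\<epsilon> * \<bar>real_of_int (k - j)\<bar>) * x j)"
    using A by (intro mult_left_mono sv) auto
  also have "\<dots> = 2 powr (\<epsilon> * \<bar>real_of_int (k - j)\<bar> + real_of_int (k - j) * c) * (A * 2 powr (real_of_int j * c) * x j)"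
  proof -
    have *: "2 powr (real_of_int k * c) = 2 powr (real_of_int (k - j) * c) * 2 powr (real_of_int j * c)"
      unfolding powr_add[symmetric] by (simp add: algebra_simps)
    show ?thesis unfolding * powr_add by (simp only: mult_ac)
  qed
  finally show ?thesis .
qed

text \<open>The case of two positive semi-norms. The constant is spelled out in terms of \<Lambda>,
  K, p and r so that it visibly does not depend on u.\<close>

lemma besov_lorentz_core:
  fixes \<phi> :: "'a::euclidean_space \<Rightarrow> real" and u :: "('a \<Rightarrow> complex) \<Rightarrow> complex"
  assumes phi: "lp_cutoff \<phi>" and ab: "0 < \<alpha>" "0 < \<beta>"
    and q: "1 \<le> q0" "1 \<le> q1" "q0 \<noteq> q1" and r01: "1 \<le> r0" "1 \<le> r1"
    and th: "\<theta> = \<alpha> / (\<alpha> + \<beta>)"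
    and p: "0 < p" "1 / p = (1 - \<theta>) * (1 / enn2real q0) + \<theta> * (1 / enn2real q1)"
    and r: "1 \<le> r"
    and w: "r \<noteq> \<infinity> \<Longrightarrow> 1 \<le> ((1 - \<theta>) * (1 / enn2real r0) + \<theta> * (1 / enn2real r1)) * enn2real r"
    and eps: "\<epsilon> = min \<alpha> \<beta> / 3"
    and K: "1 \<le> K" "\<And>J. (\<integral>\<^sup>+ j. ennreal (2 powr (- \<epsilon> * \<bar>real_of_int (j - J)\<bar>)) \<partial>count_space UNIV) = ennreal K"
    and L: "\<Lambda> = (2 powr (\<alpha> + \<beta> + 2 * \<epsilon>)) powr (1 / \<bar>1 / enn2real q0 - 1 / enn2real q1\<bar>)"
    and sum: "\<And>f. f \<in> schwartz \<Longrightarrow> ((\<lambda>j. dyadic_block \<phi> j u f) has_sum u f) UNIV"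
    and A: "besov_seminorm \<phi> \<alpha> q0 r0 u = ennreal A" "0 < A"
    and B: "besov_seminorm \<phi> (- \<beta>) q1 r1 u = ennreal B" "0 < B"
  shows "\<exists>g. represents g u \<and> lorentz_norm p r g \<le>
    ennreal ((\<Lambda> * K) powr (1 / p) * K * (if r = \<infinity> then 1 else (\<Lambda> * (2 * K)) powr (1 / enn2real r)) *
      (A powr (1 - \<theta>) * B powr \<theta>))"
proof -
  let ?i0 = "1 / enn2real q0" and ?i1 = "1 / enn2real q1"
  have \<theta>: "0 < \<theta>" "\<theta> < 1" using ab by (auto simp: th)
  \<comment> \<open>This identity is the reason for the choice of \<theta>: the dyadic weights 2^(-J
    \<alpha>) and 2^(J \<beta>) cancel in the interpolated product.\<close>
  have balance: "\<alpha> * (1 - \<theta>) = \<beta> * \<theta>" using ab by (simp add: th field_simps)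
  have e: "0 < \<epsilon>" "3 * \<epsilon> \<le> \<alpha>" "3 * \<epsilon> \<le> \<beta>" using ab by (auto simp: eps)
  have i: "?i0 \<noteq> ?i1" by (rule inverse_exponents_neq[OF q])
  obtain x' k0 where x': "\<And>j. 0 \<le> x' j" "\<And>j. x' j \<le> 1" "0 < x' k0"
    "\<And>j. dist_Lq_norm q0 (dyadic_block \<phi> j u) = ennreal (A * 2 powr (- (real_of_int j * \<alpha>)) * x' j)"
    "r0 \<noteq> \<infinity> \<Longrightarrow> (\<integral>\<^sup>+ j. ennreal (x' j powr enn2real r0) \<partial>count_space UNIV) \<le> 1"
    using besov_seminorm_normalised[OF r01(1) A] by metis
  obtain y' k1 where y': "\<And>j. 0 \<le> y' j" "\<And>j. y' j \<le> 1" "0 < y' k1"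
    "\<And>j. dist_Lq_norm q1 (dyadic_block \<phi> j u) = ennreal (B * 2 powr (- (real_of_int j * - \<beta>)) * y' j)"
    "r1 \<noteq> \<infinity> \<Longrightarrow> (\<integral>\<^sup>+ j. ennreal (y' j powr enn2real r1) \<partial>count_space UNIV) \<le> 1"
    using besov_seminorm_normalised[OF r01(2) B] by metis
  obtain x where x: "\<And>j. x' j \<le> x j" "\<And>j. 0 < x j" "\<And>j. x j \<le> 1"
    "\<And>j k. x k \<le> 2 powr (\<epsilon> * \<bar>real_of_int (k - j)\<bar>) * x j"
    "\<And>r. 1 \<le> r \<Longrightarrow> (\<integral>\<^sup>+ j. ennreal (x j powr r) \<partial>count_space UNIV)
        \<le> ennreal K * (\<integral>\<^sup>+ j. ennreal (x' j powr r) \<partial>count_space UNIV)"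
    using slowly_varying_majorant[where x=x', OF e(1) x'(1,2,3) K(2)] by metis
  obtain y where y: "\<And>j. y' j \<le> y j" "\<And>j. 0 < y j" "\<And>j. y j \<le> 1"
    "\<And>j k. y k \<le> 2 powr (\<epsilon> * \<bar>real_of_int (k - j)\<bar>) * y j"
    "\<And>r. 1 \<le> r \<Longrightarrow> (\<integral>\<^sup>+ j. ennreal (y j powr r) \<partial>count_space UNIV)
        \<le> ennreal K * (\<integral>\<^sup>+ j. ennreal (y' j powr r) \<partial>count_space UNIV)"
    using slowly_varying_majorant[where x=y', OF e(1) y'(1,2,3) K(2)] by metis
  define X where "X j = A * 2 powr (real_of_int j * - \<alpha>) * x j" for j
  define Y where "Y j = B * 2 powr (real_of_int j * \<beta>) * y j" for j
  have X0: "0 < X j" and Y0: "0 < Y j" for j using A B x(2)[of j] y(2)[of j] by (simp_all add: X_def Y_def)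
  have Xk: "X k \<le> 2 powr (\<epsilon> * \<bar>real_of_int (k - j)\<bar> + real_of_int (k - j) * - \<alpha>) * X j" for j k
    unfolding X_def by (rule weighted_geometric_decay[OF A(2) x(4)])
  have Yk: "Y k \<le> 2 powr (\<epsilon> * \<bar>real_of_int (k - j)\<bar> + real_of_int (k - j) * \<beta>) * Y j" for j k
    unfolding Y_def by (rule weighted_geometric_decay[OF B(2) y(4)])
  \<comment> \<open>Without a representing function the infimum would range over the empty set and
    be \<infinity>, but the block norms are finite.\<close>
  have "\<exists>g. represents g (dyadic_block \<phi> j u)" for j
  proof (rule ccontr)
    assume "\<nexists>g. represents g (dyadic_block \<phi> j u)"
    then have "dist_Lq_norm q0 (dyadic_block \<phi> j u) = \<infinity>" by (simp add: dist_Lq_norm_def)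
    then show False using x'(4)[of j] by simp
  qed
  then obtain g where g: "\<And>j. represents (g j) (dyadic_block \<phi> j u)" by metis
  have gm[measurable]: "g j \<in> borel_measurable borel" for j using g[of j] by (simp add: represents_def)
  \<comment> \<open>By uniqueness the infimum is the norm of this very function, for q0 here and for
    q1 next.\<close>
  have g0: "Lq_norm q0 (g j) \<le> ennreal (X j)" for j
    unfolding dist_Lq_norm_eq[OF phi g, symmetric] x'(4) X_def
    using A x(1)[of j] by (intro ennreal_leI) (simp add: mult_left_mono)
  have g1: "Lq_norm q1 (g j) \<le> ennreal (Y j)" for j
    unfolding dist_Lq_norm_eq[OF phi g, symmetric] y'(4) Y_def
    using B y(1)[of j] by (intro ennreal_leI) (simp add: mult_left_mono)
  define \<delta> where "\<delta> J j = 2 powr (- \<epsilon> * \<bar>real_of_int (j - J)\<bar>)" for J j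
  have d: "0 < \<delta> J j" "\<delta> J j \<le> 1" for J j
    using e powr_mono[of "- \<epsilon> * \<bar>real_of_int (j - J)\<bar>" 0 2] by (auto simp: \<delta>_def)
  have d2: "(\<delta> J j)\<^sup>2 = 2 powr (- (2 * \<epsilon>) * \<bar>real_of_int (j - J)\<bar>)" for J j
    unfolding \<delta>_def power2_eq_square powr_add[symmetric] by (simp add: algebra_simps)
  \<comment> \<open>The decay rate \<alpha> >= 3 \<epsilon> pays \<epsilon> for the slow variation
    of x and leaves 2 \<epsilon>, that is \<delta> squared, as \<open>Lq_norm_weak_type\<close>
    expects. For j below J the same is done with \<beta>.\<close>
  have XJ: "X j \<le> (\<delta> J j)\<^sup>2 * X J" if "J \<le> j" for j J
  proof -
    have "\<epsilon> * \<bar>real_of_int (j - J)\<bar> + real_of_int (j - J) * - \<alpha> \<le> - (2 * \<epsilon>) * \<bar>real_of_int (j - J)\<bar>"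
      using that mult_right_mono[OF e(2), of "real_of_int (j - J)"] by (simp add: algebra_simps)
    then have "2 powr (\<epsilon> * \<bar>real_of_int (j - J)\<bar> + real_of_int (j - J) * - \<alpha>) \<le> (\<delta> J j)\<^sup>2"
      unfolding d2 by (rule powr_mono) simp
    then show ?thesis using Xk[of j J] X0[of J] by (meson mult_right_mono less_imp_le order_trans)
  qed
  have YJ: "Y j \<le> (\<delta> J j)\<^sup>2 * Y J" if "j \<le> J" for j J
  proof -
    have "\<epsilon> * \<bar>real_of_int (j - J)\<bar> + real_of_int (j - J) * \<beta> \<le> - (2 * \<epsilon>) * \<bar>real_of_int (j - J)\<bar>"
      using that mult_right_mono[OF e(3), of "real_of_int (J - j)"] by (simp add: algebra_simps)
    then have "2 powr (\<epsilon> * \<bar>real_of_int (j - J)\<bar> + real_of_int (j - J) * \<beta>) \<le> (\<delta> J j)\<^sup>2"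
      unfolding d2 by (rule powr_mono) simp
    then show ?thesis using Yk[of j J] Y0[of J] by (meson mult_right_mono less_imp_le order_trans)
  qed
  define s where "s J = (X J / Y J) powr (1 / (?i0 - ?i1))" for J
  define t where "t J = X J * s J powr (- ?i0)" for J
  note params = interpolation_parameters[OF X0 Y0 i s_def t_def]
  have s0: "0 < s J" and t0: "0 < t J" for J by (rule params(1), rule params(2))
  have weak: "emeasure lborel {z. \<delta> J j * t J < norm (g j z)} \<le> ennreal (\<delta> J j * s J)" for J j
  proof (cases "J \<le> j")
    case True
    have "Lq_norm q0 (g j) \<le> ennreal ((\<delta> J j)\<^sup>2 * (t J * s J powr ?i0))"
      unfolding params(3) by (rule order_trans[OF g0 ennreal_leI[OF XJ[OF True]]])
    then show ?thesis by (rule Lq_norm_weak_type[OF gm q(1) d t0 s0])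
  next
    case False
    then have "j \<le> J" by simp
    have "Lq_norm q1 (g j) \<le> ennreal ((\<delta> J j)\<^sup>2 * (t J * s J powr ?i1))"
      unfolding params(4) by (rule order_trans[OF g1 ennreal_leI[OF YJ[OF \<open>j \<le> J\<close>]]])
    then show ?thesis by (rule Lq_norm_weak_type[OF gm q(2) d t0 s0])
  qed
  define G where "G z = (LINT j|count_space UNIV. g j z)" for z
  have K0: "0 < K" using K by simp
  have re: "rearrangement G v \<le> ennreal (K * t J)" if "K * s J \<le> v" for J v
    unfolding G_def
    by (rule rearrangement_sum_le[where g=g and \<delta>="\<delta> J" and s="s J", OF gm _ K0 less_imp_le[OF d(1)] t0 s0 weak that])
       (unfold \<delta>_def, rule K(2))
  \<comment> \<open>The levels s J are powers of \<rho> J. Slow variation changes each step of the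
    ratio by at most 2^(2 \<epsilon>) against the factor 2^(\<alpha> + \<beta>), so \<rho> decreases
    geometrically but not too fast.\<close>
  define \<rho> where "\<rho> J = X J / Y J" for J
  have \<rho>0: "0 < \<rho> J" for J using X0 Y0 by (simp add: \<rho>_def)
  have \<rho>1: "2 powr (\<alpha> + \<beta> - 2 * \<epsilon>) * \<rho> (J + 1) \<le> \<rho> J" for J
  proof -
    have 1: "X (J + 1) \<le> 2 powr (\<epsilon> - \<alpha>) * X J" using Xk[of "J + 1" J] by simp
    have 2: "Y J \<le> 2 powr (\<epsilon> - \<beta>) * Y (J + 1)" using Yk[of J "J + 1"] by simp
    have "2 powr (\<alpha> + \<beta> - 2 * \<epsilon>) * X (J + 1) * Y J
        \<le> 2 powr (\<alpha> + \<beta> - 2 * \<epsilon>) * (2 powr (\<epsilon> - \<alpha>) * X J) * (2 powr (\<epsilon> - \<beta>) * Y (J + 1))"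
      using 1 2 X0 Y0 by (intro mult_mono mult_left_mono) (auto intro: less_imp_le)
    also have "\<dots> = (2 powr (\<alpha> + \<beta> - 2 * \<epsilon>) * 2 powr (\<epsilon> - \<alpha>) * 2 powr (\<epsilon> - \<beta>)) * (X J * Y (J + 1))"
      by (simp only: mult_ac)
    also have "2 powr (\<alpha> + \<beta> - 2 * \<epsilon>) * 2 powr (\<epsilon> - \<alpha>) * 2 powr (\<epsilon> - \<beta>) = 1"
      unfolding powr_add[symmetric] by simp
    finally show ?thesis using Y0[of J] Y0[of "J + 1"] by (simp add: \<rho>_def divide_simps)
  qed
  have \<rho>2: "\<rho> J \<le> 2 powr (\<alpha> + \<beta> + 2 * \<epsilon>) * \<rho> (J + 1)" for J
  proof -
    have 1: "X J \<le> 2 powr (\<epsilon> + \<alpha>) * X (J + 1)" using Xk[of J "J + 1"] by simp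
    have 2: "Y (J + 1) \<le> 2 powr (\<epsilon> + \<beta>) * Y J" using Yk[of "J + 1" J] by simp
    have "X J * Y (J + 1) \<le> (2 powr (\<epsilon> + \<alpha>) * X (J + 1)) * (2 powr (\<epsilon> + \<beta>) * Y J)"
      using 1 2 X0 Y0 by (intro mult_mono) (auto intro: less_imp_le)
    also have "\<dots> = (2 powr (\<epsilon> + \<alpha>) * 2 powr (\<epsilon> + \<beta>)) * (X (J + 1) * Y J)"
      by (simp only: mult_ac)
    also have "2 powr (\<epsilon> + \<alpha>) * 2 powr (\<epsilon> + \<beta>) = 2 powr (\<alpha> + \<beta> + 2 * \<epsilon>)"
      unfolding powr_add[symmetric] by (simp add: ac_simps)
    finally show ?thesis using Y0[of J] Y0[of "J + 1"] by (simp add: \<rho>_def divide_simps mult_ac)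
  qed
  have c1: "1 < 2 powr (\<alpha> + \<beta> - 2 * \<epsilon>)" using e by simp
  have L1: "1 \<le> \<Lambda>"
    unfolding L using ab e by (intro ge_one_powr_ge_zero) auto
  have cover: "\<exists>J. K * s J \<le> v \<and> v \<le> \<Lambda> * (K * s J)" if v: "0 < v" for v
  proof -
    have "\<exists>J. \<rho> J powr (1 / (?i0 - ?i1)) \<le> v / K \<and>
        v / K \<le> (2 powr (\<alpha> + \<beta> + 2 * \<epsilon>)) powr (1 / \<bar>?i0 - ?i1\<bar>) * \<rho> J powr (1 / (?i0 - ?i1))"
      by (rule quasi_geometric_covering[where \<rho>=\<rho>, OF \<rho>0 c1 \<rho>1 \<rho>2]) (use i v K0 in auto)
    then obtain J where J: "s J \<le> v / K" "v / K \<le> \<Lambda> * s J" unfolding s_def \<rho>_def L by blast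
    have "K * s J \<le> v" using J(1) K0 by (simp add: field_simps)
    moreover have "v \<le> \<Lambda> * (K * s J)" using J(2) K0 by (simp add: pos_divide_le_eq mult_ac)
    ultimately show ?thesis by blast
  qed
  define M where "M = A powr (1 - \<theta>) * B powr \<theta>"
  have M: "0 < M" using A B by (simp add: M_def)
  have c: "t J * s J powr (1 / p) = M * (x J powr (1 - \<theta>) * y J powr \<theta>)" for J
  proof -
    have "t J * s J powr (1 / p) = X J powr (1 - \<theta>) * Y J powr \<theta>"
      unfolding p(2) by (rule params(5))
    also have "\<dots> = M * (x J powr (1 - \<theta>) * y J powr \<theta>) *
        ((2 powr (real_of_int J * - \<alpha>)) powr (1 - \<theta>) * (2 powr (real_of_int J * \<beta>)) powr \<theta>)"
      unfolding X_def Y_def M_def powr_mult by (simp only: mult_ac)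
    also have "(2 powr (real_of_int J * - \<alpha>)) powr (1 - \<theta>) * (2 powr (real_of_int J * \<beta>)) powr \<theta>
        = 2 powr (real_of_int J * (\<beta> * \<theta> - \<alpha> * (1 - \<theta>)))"
      unfolding powr_powr powr_add[symmetric] by (simp add: algebra_simps)
    also have "\<dots> = 1" using balance by simp
    finally show ?thesis by simp
  qed
  \<comment> \<open>The blocks are split at level 0: q0 controls those with j >= 0 and q1 the
    others. In both cases the norm is at most \<delta> 0 j times a constant, which is
    summable.\<close>
  have repG: "represents G u"
    unfolding G_def
  proof (rule represents_has_sum[OF g sum])
    fix f :: "'a \<Rightarrow> complex" assume f: "f \<in> schwartz"
    obtain F where F: "0 \<le> F" "\<And>z. norm (f z) \<le> F" by (rule schwartz_bounded[OF f]) auto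
    define H where "H = F + (LINT z|lborel. norm (f z))"
    have H: "0 \<le> H" using F by (simp add: H_def)
    have dd: "(\<delta> 0 j)\<^sup>2 \<le> \<delta> 0 j" for j
      using d[of 0 j] by (simp add: power2_eq_square mult_left_le_one_le)
    have "(\<integral>\<^sup>+ z. ennreal (norm (g j z * f z)) \<partial>lborel) \<le> ennreal (\<delta> 0 j) * ennreal ((X 0 + Y 0) * H)" for j
    proof -
      define N where "N = \<delta> 0 j * (X 0 + Y 0)"
      have N0: "0 < N" using d[of 0 j] X0[of 0] Y0[of 0] by (simp add: N_def add_pos_pos)
      have NX: "(\<delta> 0 j)\<^sup>2 * X 0 \<le> N" unfolding N_def
        using dd[of j] d[of 0 j] X0[of 0] Y0[of 0] by (intro mult_mono) auto
      have NY: "(\<delta> 0 j)\<^sup>2 * Y 0 \<le> N" unfolding N_def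
        using dd[of j] d[of 0 j] X0[of 0] Y0[of 0] by (intro mult_mono) auto
      have "(\<integral>\<^sup>+ z. ennreal (norm (g j z * f z)) \<partial>lborel) \<le> ennreal (N * (F + (LINT z|lborel. norm (f z))))"
      proof (cases "0 \<le> j")
        case True
        have "Lq_norm q0 (g j) \<le> ennreal N"
          using order_trans[OF XJ[OF True] NX] by (intro order_trans[OF g0] ennreal_leI)
        then show ?thesis by (rule nn_integral_Lq_pairing[OF gm q(1) N0 _ schwartz_integrable[OF f] F])
      next
        case False
        then have "j \<le> 0" by simp
        have "Lq_norm q1 (g j) \<le> ennreal N"
          using order_trans[OF YJ[OF \<open>j \<le> 0\<close>] NY] by (intro order_trans[OF g1] ennreal_leI)
        then show ?thesis by (rule nn_integral_Lq_pairing[OF gm q(2) N0 _ schwartz_integrable[OF f] F])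
      qed
      also have "N * (F + (LINT z|lborel. norm (f z))) = \<delta> 0 j * ((X 0 + Y 0) * H)"
        unfolding N_def H_def by (simp only: mult.assoc)
      also have "ennreal (\<delta> 0 j * ((X 0 + Y 0) * H)) = ennreal (\<delta> 0 j) * ennreal ((X 0 + Y 0) * H)"
        by (rule ennreal_mult'[OF less_imp_le[OF d(1)]])
      finally show ?thesis .
    qed
    then have "(\<integral>\<^sup>+ j. (\<integral>\<^sup>+ z. ennreal (norm (g j z * f z)) \<partial>lborel) \<partial>count_space UNIV)
      \<le> (\<integral>\<^sup>+ j. ennreal (\<delta> 0 j) * ennreal ((X 0 + Y 0) * H) \<partial>count_space UNIV)"
      by (intro nn_integral_mono)
    also have "\<dots> = (\<integral>\<^sup>+ j. ennreal (\<delta> 0 j) \<partial>count_space UNIV) * ennreal ((X 0 + Y 0) * H)"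
      by (rule nn_integral_multc) simp
    also have "\<dots> = ennreal K * ennreal ((X 0 + Y 0) * H)" unfolding \<delta>_def K(2) ..
    also have "\<dots> < \<infinity>" by (simp add: ennreal_mult_less_top)
    finally show "(\<integral>\<^sup>+ j. (\<integral>\<^sup>+ z. ennreal (norm (g j z * f z)) \<partial>lborel) \<partial>count_space UNIV) < \<infinity>" .
  qed
  have "lorentz_norm p r G \<le> ennreal ((\<Lambda> * K) powr (1 / p) * K *
      (if r = \<infinity> then 1 else (\<Lambda> * (2 * K)) powr (1 / enn2real r)) * M)"
  proof (cases "r = \<infinity>")
    case True
    have "t J * s J powr (1 / p) \<le> M" for J
    proof -
      have "x J powr (1 - \<theta>) * y J powr \<theta> \<le> 1"
        using x(2,3)[of J] y(2,3)[of J] \<theta> by (intro mult_le_one powr_le1) auto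
      then show ?thesis unfolding c using M by simp
    qed
    note S = this
    have "lorentz_norm p \<infinity> G \<le> ennreal ((\<Lambda> * K) powr (1 / p) * K * M)"
      by (rule lorentz_norm_le_sup[where s=s and t=t and G=G and S=M and p=p and K=K and \<Lambda>=\<Lambda>])
         (fact K0 L1 s0 t0 p(1) cover re S)+
    then show ?thesis using True by simp
  next
    case False
    define k where "k = enn2real r"
    have k: "1 \<le> k" "r = ennreal k" using enn2real_ge_1[OF r False] False by (auto simp: k_def less_top)
    define U where "U j = (if r0 = \<infinity> then 0 else x j powr enn2real r0)" for j
    define V where "V j = (if r1 = \<infinity> then 0 else y j powr enn2real r1)" for j
    have U: "(\<integral>\<^sup>+ j. ennreal (U j) \<partial>count_space UNIV) \<le> ennreal K"
    proof (cases "r0 = \<infinity>")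
      case False
      have "(\<integral>\<^sup>+ j. ennreal (x j powr enn2real r0) \<partial>count_space UNIV) \<le> ennreal K * 1"
        by (rule order_trans[OF x(5) mult_left_mono[OF x'(5)]]) (use False enn2real_ge_1[OF r01(1)] in auto)
      then show ?thesis using False by (simp add: U_def)
    qed (simp add: U_def)
    have V: "(\<integral>\<^sup>+ j. ennreal (V j) \<partial>count_space UNIV) \<le> ennreal K"
    proof (cases "r1 = \<infinity>")
      case False
      have "(\<integral>\<^sup>+ j. ennreal (y j powr enn2real r1) \<partial>count_space UNIV) \<le> ennreal K * 1"
        by (rule order_trans[OF y(5) mult_left_mono[OF y'(5)]]) (use False enn2real_ge_1[OF r01(2)] in auto)
      then show ?thesis using False by (simp add: V_def)
    qed (simp add: V_def)
    have "(\<integral>\<^sup>+ j. ennreal ((t j * s j powr (1 / p)) powr k) \<partial>count_space UNIV)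
      \<le> (\<integral>\<^sup>+ j. ennreal (M powr k) * (ennreal (U j) + ennreal (V j)) \<partial>count_space UNIV)"
    proof (intro nn_integral_mono)
      fix j
      have "(x j powr (1 - \<theta>) * y j powr \<theta>) powr k \<le> U j + V j"
        unfolding U_def V_def k_def
        by (rule interpolated_summand_le[OF r01 \<theta> x(2,3) y(2,3) _ w[OF False]]) (rule k(1)[unfolded k_def])
      then have "(t j * s j powr (1 / p)) powr k \<le> M powr k * (U j + V j)"
        unfolding c powr_mult[of M] by (rule mult_left_mono) simp
      then have "ennreal ((t j * s j powr (1 / p)) powr k) \<le> ennreal (M powr k * (U j + V j))"
        by (rule ennreal_leI)
      also have "\<dots> = ennreal (M powr k) * (ennreal (U j) + ennreal (V j))"
        by (subst ennreal_mult') (auto simp: U_def V_def)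
      finally show "ennreal ((t j * s j powr (1 / p)) powr k) \<le> ennreal (M powr k) * (ennreal (U j) + ennreal (V j))" .
    qed
    also have "\<dots> = ennreal (M powr k) * ((\<integral>\<^sup>+ j. ennreal (U j) \<partial>count_space UNIV) + (\<integral>\<^sup>+ j. ennreal (V j) \<partial>count_space UNIV))"
      by (simp add: nn_integral_cmult nn_integral_add)
    also have "\<dots> \<le> ennreal (M powr k) * (ennreal K + ennreal K)"
      by (intro mult_left_mono add_mono U V) auto
    also have "\<dots> = ennreal (M powr k * (2 * K))"
      using K0 by (subst ennreal_mult') (auto simp: ennreal_plus[symmetric] simp del: ennreal_plus)
    finally have S: "(\<integral>\<^sup>+ j. ennreal ((t j * s j powr (1 / p)) powr k) \<partial>count_space UNIV) \<le> ennreal (M powr k * (2 * K))" .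
    have "lorentz_norm p (ennreal k) G \<le> ennreal ((\<Lambda> * K) powr (1 / p) * K * (\<Lambda> * (M powr k * (2 * K))) powr (1 / k))"
      by (rule lorentz_norm_le_sum[where s=s and t=t, OF K0 L1 s0 t0 p(1) cover re k(1) _ S]) (assumption, assumption, use K0 in \<open>intro mult_nonneg_nonneg, simp_all\<close>)
    also have "(\<Lambda> * (M powr k * (2 * K))) powr (1 / k) = (\<Lambda> * (2 * K)) powr (1 / k) * M"
    proof -
      have "\<Lambda> * (M powr k * (2 * K)) = (\<Lambda> * (2 * K)) * M powr k" by (simp only: mult_ac)
      moreover have "(M powr k) powr (1 / k) = M" using M k by (simp add: powr_powr)
      ultimately show ?thesis by (simp only: powr_mult[of "\<Lambda> * (2 * K)" "M powr k"])
    qed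
    finally show ?thesis using False k by (simp add: k_def[symmetric] mult.assoc)
  qed
  then show ?thesis using repG unfolding M_def by blast
qed

lemma besov_lorentz_ineq_if_ge:
  fixes \<phi> :: "'a::euclidean_space \<Rightarrow> real"
  assumes phi: "lp_cutoff \<phi>" and ab: "0 < \<alpha>" "0 < \<beta>"
    and q: "1 \<le> q0" "1 \<le> q1" "q0 \<noteq> q1" and r01: "1 \<le> r0" "1 \<le> r1"
    and th: "\<theta> = \<alpha> / (\<alpha> + \<beta>)"
    and p: "1 / ennreal p = ennreal (1 - \<theta>) / q0 + ennreal \<theta> / q1"
    and rs: "1 / rstar = ennreal (1 - \<theta>) / r0 + ennreal \<theta> / r1"
    and r: "1 \<le> r" "rstar \<le> r"
  shows "besov_lorentz_ineq \<phi> \<alpha> q0 r0 \<beta> q1 r1 \<theta> p r"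
proof -
  have \<theta>: "0 < \<theta>" "\<theta> < 1" using ab by (auto simp: th)
  note p' = interpolated_exponent[OF q \<theta> p]
  note w = summation_exponent_ge[OF r01 \<theta> rs r(2)]
  define \<epsilon> where "\<epsilon> = min \<alpha> \<beta> / 3"
  have e: "0 < \<epsilon>" using ab by (simp add: \<epsilon>_def)
  obtain K where K: "1 \<le> K" "\<And>J. (\<integral>\<^sup>+ j. ennreal (2 powr (- \<epsilon> * \<bar>real_of_int (j - J)\<bar>)) \<partial>count_space UNIV) = ennreal K"
    using two_sided_geometric[OF e] by blast
  define \<Lambda> where "\<Lambda> = (2 powr (\<alpha> + \<beta> + 2 * \<epsilon>)) powr (1 / \<bar>1 / enn2real q0 - 1 / enn2real q1\<bar>)"
  define C where "C = (\<Lambda> * K) powr (1 / p) * K * (if r = \<infinity> then 1 else (\<Lambda> * (2 * K)) powr (1 / enn2real r))"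
  have C: "0 \<le> C" using K by (simp add: C_def)
  have "\<exists>g. represents g u \<and> lorentz_norm p r g < \<infinity> \<and>
         lorentz_norm p r g \<le> ennreal C *
           epowr (besov_seminorm \<phi> \<alpha> q0 r0 u) (1 - \<theta>) *
           epowr (besov_seminorm \<phi> (- \<beta>) q1 r1 u) \<theta>"
    if u: "u \<in> besov_inter \<phi> \<alpha> q0 r0 \<beta> q1 r1" for u
  proof -
    have sum: "\<And>f. f \<in> schwartz \<Longrightarrow> ((\<lambda>j. dyadic_block \<phi> j u f) has_sum u f) UNIV"
      and fin: "besov_seminorm \<phi> \<alpha> q0 r0 u < \<infinity>" "besov_seminorm \<phi> (- \<beta>) q1 r1 u < \<infinity>"
      using u by (auto simp: besov_inter_def)
    define A where "A = enn2real (besov_seminorm \<phi> \<alpha> q0 r0 u)"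
    define B where "B = enn2real (besov_seminorm \<phi> (- \<beta>) q1 r1 u)"
    have A: "besov_seminorm \<phi> \<alpha> q0 r0 u = ennreal A" "0 \<le> A" using fin by (auto simp: A_def)
    have B: "besov_seminorm \<phi> (- \<beta>) q1 r1 u = ennreal B" "0 \<le> B" using fin by (auto simp: B_def)
    show ?thesis
    proof (cases "A = 0 \<or> B = 0")
      \<comment> \<open>A vanishing semi-norm forces u to vanish on test functions, and the zero
        function represents it.\<close>
      case True
      have "u f = 0" if f: "f \<in> schwartz" for f
        using True
      proof
        assume "A = 0"
        then show ?thesis using A by (intro besov_seminorm_zero_imp_zero[OF _ r01(1) q(1) sum[OF f] f]) simp
      next
        assume "B = 0"
        then show ?thesis using B by (intro besov_seminorm_zero_imp_zero[OF _ r01(2) q(2) sum[OF f] f]) simp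
      qed
      then have "represents (\<lambda>x. 0) u" by (simp add: represents_def)
      then show ?thesis by (intro exI[of _ "\<lambda>x. 0"]) (simp add: lorentz_norm_zero)
    next
      case False
      then have AB: "0 < A" "0 < B" using A B by auto
      obtain g where g: "represents g u" "lorentz_norm p r g \<le> ennreal (C * (A powr (1 - \<theta>) * B powr \<theta>))"
        using besov_lorentz_core[OF phi ab q r01 th p' r(1) w \<epsilon>_def K \<Lambda>_def sum A(1) AB(1) B(1) AB(2)]
        unfolding C_def by blast
      have "ennreal (C * (A powr (1 - \<theta>) * B powr \<theta>)) =
          ennreal C * epowr (besov_seminorm \<phi> \<alpha> q0 r0 u) (1 - \<theta>) * epowr (besov_seminorm \<phi> (- \<beta>) q1 r1 u) \<theta>"
        unfolding A(1) B(1) epowr_ennreal[OF A(2)] epowr_ennreal[OF B(2)]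
        using C by (simp add: ennreal_mult mult.assoc)
      moreover have "lorentz_norm p r g < \<infinity>"
        using le_less_trans[OF g(2) ennreal_less_top] by simp
      ultimately show ?thesis using g by (intro exI[of _ g]) simp
    qed
  qed
  then show ?thesis unfolding besov_lorentz_ineq_def by blast
qed

section \<open>Fourier integrals\<close>

text \<open>One transform with a free frequency factor: \<sigma> = -1 is the Fourier transform,
  \<sigma> = 1 the inverse without its constant, and other values of \<sigma> absorb
  dilations.\<close>

definition osc :: "real \<Rightarrow> ('a::euclidean_space \<Rightarrow> complex) \<Rightarrow> 'a \<Rightarrow> complex"
  where "osc \<sigma> f \<xi> = (LINT x|lborel. cis (\<sigma> * (x \<bullet> \<xi>)) * f x)"

lemma borel_measurable_cis [measurable]: "cis \<in> borel_measurable borel"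
  by (intro borel_measurable_continuous_onI continuous_intros)

lemma fourier_osc: "fourier f = osc (- 1) f"
  by (simp add: fourier_def osc_def fun_eq_iff)

lemma inv_fourier_osc: "inv_fourier f x = complex_of_real (1 / (2 * pi) ^ DIM('a)) * osc 1 f x"
  for f :: "'a::euclidean_space \<Rightarrow> complex"
  by (simp add: inv_fourier_def osc_def inner_commute)

lemma integrable_cis_mult:
  fixes g :: "'a::euclidean_space \<Rightarrow> real" and f :: "'a \<Rightarrow> complex"
  assumes "integrable lborel f" and [measurable]: "g \<in> borel_measurable borel"
  shows "integrable lborel (\<lambda>x. cis (g x) * f x)"
proof (rule Bochner_Integration.integrable_bound[OF assms(1)])
  have [measurable]: "f \<in> borel_measurable borel" using assms(1) by (auto dest: borel_measurable_integrable)
  show "(\<lambda>x. cis (g x) * f x) \<in> borel_measurable lborel" by measurable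
qed (simp add: norm_mult)

lemma norm_osc_le: "norm (osc \<sigma> f \<xi>) \<le> (LINT x|lborel. norm (f x))"
  unfolding osc_def by (rule order_trans[OF integral_norm_bound]) (simp add: norm_mult)

lemma borel_measurable_osc [measurable]:
  fixes f :: "'a::euclidean_space \<Rightarrow> complex"
  assumes "integrable lborel f"
  shows "osc \<sigma> f \<in> borel_measurable borel"
proof -
  have [measurable]: "f \<in> borel_measurable borel" using assms(1) by (auto dest: borel_measurable_integrable)
  have "(\<lambda>\<xi>. LINT x|lborel. cis (\<sigma> * (x \<bullet> \<xi>)) * f x) \<in> borel_measurable borel"
    by measurable
  then show ?thesis by (simp add: osc_def[abs_def])
qed

text \<open>The multiplication formula, by Fubini: the phase is symmetric in the two
  variables.\<close>

lemma osc_swap: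
  fixes f g :: "'a::euclidean_space \<Rightarrow> complex"
  assumes f: "integrable lborel f" and g: "integrable lborel g"
  shows "(LINT \<xi>|lborel. osc \<sigma> f \<xi> * g \<xi>) = (LINT x|lborel. f x * osc \<sigma> g x)"
proof -
  have [measurable]: "f \<in> borel_measurable borel" "g \<in> borel_measurable borel"
    using f g by (auto dest: borel_measurable_integrable)
  have I: "integrable (lborel \<Otimes>\<^sub>M lborel) (\<lambda>(x, \<xi>). cis (\<sigma> * (x \<bullet> \<xi>)) * f x * g \<xi>)"
  proof (rule Bochner_Integration.integrable_bound)
    show "integrable (lborel \<Otimes>\<^sub>M lborel) (\<lambda>(x, \<xi>). f x * g \<xi>)"
      by (rule pair_sigma_finite.integrable_pair_mult[OF lborel_pair.pair_sigma_finite_axioms f g])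
    show "(\<lambda>(x, \<xi>). cis (\<sigma> * (x \<bullet> \<xi>)) * f x * g \<xi>) \<in> borel_measurable (lborel \<Otimes>\<^sub>M lborel)"
      by measurable
  qed (auto simp: norm_mult)
  have "(LINT \<xi>|lborel. osc \<sigma> f \<xi> * g \<xi>) = (LINT \<xi>|lborel. (LINT x|lborel. cis (\<sigma> * (x \<bullet> \<xi>)) * f x * g \<xi>))"
    by (simp add: osc_def)
  also have "\<dots> = (LINT x|lborel. (LINT \<xi>|lborel. cis (\<sigma> * (x \<bullet> \<xi>)) * f x * g \<xi>))"
    by (rule lborel_pair.Fubini_integral[OF I])
  also have "\<dots> = (LINT x|lborel. f x * osc \<sigma> g x)"
    unfolding osc_def integral_mult_right_zero[symmetric]
    by (intro Bochner_Integration.integral_cong refl) (simp add: inner_commute ac_simps)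
  finally show ?thesis .
qed

section \<open>Gaussians and Fourier inversion\<close>

text \<open>Up to the factor sqrt (2 pi) this is the characteristic function of the standard normal
  distribution.\<close>

lemma gaussian_integral_1:
  "integrable lborel (\<lambda>x::real. cis (t * x) * complex_of_real (exp (- (x\<^sup>2) / 2)))"
  "(LINT x|lborel. cis (t * x) * complex_of_real (exp (- (x\<^sup>2) / 2))) = complex_of_real (sqrt (2 * pi) * exp (- (t\<^sup>2) / 2))"
proof -
  have sq: "sqrt (2 * pi) > 0" by simp
  have eq: "exp (- (x\<^sup>2) / 2) = sqrt (2 * pi) * std_normal_density x" for x :: real
    using sq by (simp add: std_normal_density_def)
  have "integrable lborel (\<lambda>x::real. sqrt (2 * pi) * std_normal_density x)"
    using integrable_normal_moment[of 1 0 0] by simp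
  then have "integrable lborel (\<lambda>x::real. complex_of_real (exp (- (x\<^sup>2) / 2)))"
    unfolding eq by (simp del: of_real_mult)
  then show "integrable lborel (\<lambda>x::real. cis (t * x) * complex_of_real (exp (- (x\<^sup>2) / 2)))"
    by (rule integrable_cis_mult) simp
  have "char std_normal_distribution t = (LINT x|lborel. std_normal_density x *\<^sub>R cis (t * x))"
    unfolding char_def cis_conv_exp[symmetric]
    by (subst integral_density) (auto simp: normal_density_nonneg cis_conv_exp intro!: borel_measurable_continuous_onI continuous_intros)
  then have "(LINT x|lborel. std_normal_density x *\<^sub>R cis (t * x)) = complex_of_real (exp (- (t\<^sup>2) / 2))"
    by (simp add: char_std_normal_distribution)
  moreover have "cis (t * x) * complex_of_real (exp (- (x\<^sup>2) / 2)) = complex_of_real (sqrt (2 * pi)) * (std_normal_density x *\<^sub>R cis (t * x))" for x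
    unfolding eq by (simp add: scaleR_conv_of_real mult_ac)
  ultimately show "(LINT x|lborel. cis (t * x) * complex_of_real (exp (- (x\<^sup>2) / 2))) = complex_of_real (sqrt (2 * pi) * exp (- (t\<^sup>2) / 2))"
    by (simp only: integral_mult_right_zero of_real_mult)
qed

lemma cis_sum: "finite A \<Longrightarrow> cis (\<Sum>a\<in>A. f a) = (\<Prod>a\<in>A. cis (f a))"
  by (induction A rule: finite_induct) (simp_all add: cis_mult[symmetric])

lemma norm_square_Basis: "(norm x)\<^sup>2 = (\<Sum>b\<in>Basis. (x \<bullet> b)\<^sup>2)" for x :: "'a::euclidean_space"
  unfolding power2_norm_eq_inner by (subst euclidean_inner) (simp add: power2_eq_square)

lemma gaussian_integral:
  fixes \<xi> :: "'a::euclidean_space"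
  shows "integrable lborel (\<lambda>x::'a. complex_of_real (exp (- ((norm x)\<^sup>2) / 2)))"
    and "osc 1 (\<lambda>x::'a. complex_of_real (exp (- ((norm x)\<^sup>2) / 2))) \<xi> =
      complex_of_real (sqrt (2 * pi) ^ DIM('a) * exp (- ((norm \<xi>)\<^sup>2) / 2))"
proof -
  have e: "exp (- ((norm x)\<^sup>2) / 2) = (\<Prod>b\<in>Basis. exp (- ((x \<bullet> b)\<^sup>2) / 2))" for x :: 'a
    unfolding norm_square_Basis by (simp add: exp_sum[symmetric] sum_negf sum_divide_distrib)
  have p: "cis (1 * (x \<bullet> \<xi>)) * complex_of_real (exp (- ((norm x)\<^sup>2) / 2)) =
      (\<Prod>b\<in>Basis. cis ((\<xi> \<bullet> b) * (x \<bullet> b)) * complex_of_real (exp (- ((x \<bullet> b)\<^sup>2) / 2)))" for x \<xi> :: 'a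
  proof -
    have "x \<bullet> \<xi> = (\<Sum>b\<in>Basis. (\<xi> \<bullet> b) * (x \<bullet> b))"
      by (subst euclidean_inner) (simp add: mult.commute)
    then have "cis (1 * (x \<bullet> \<xi>)) = (\<Prod>b\<in>Basis. cis ((\<xi> \<bullet> b) * (x \<bullet> b)))"
      by (simp add: cis_sum)
    then show ?thesis unfolding e of_real_prod by (simp only: prod.distrib)
  qed
  have "integrable lborel (\<lambda>x::'a. cis (1 * (x \<bullet> 0)) * complex_of_real (exp (- ((norm x)\<^sup>2) / 2)))"
    unfolding p by (rule integrable_prod_Basis[of "\<lambda>b t. cis ((0 \<bullet> b) * t) * complex_of_real (exp (- (t\<^sup>2) / 2))"])
      (rule gaussian_integral_1)
  then show "integrable lborel (\<lambda>x::'a. complex_of_real (exp (- ((norm x)\<^sup>2) / 2)))" by simp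
  have "osc 1 (\<lambda>x::'a. complex_of_real (exp (- ((norm x)\<^sup>2) / 2))) \<xi> =
     (\<Prod>b\<in>Basis. complex_of_real (sqrt (2 * pi) * exp (- ((\<xi> \<bullet> b)\<^sup>2) / 2)))"
    unfolding osc_def p gaussian_integral_1(2)[symmetric]
    by (rule integral_prod_Basis[of "\<lambda>b t. cis ((\<xi> \<bullet> b) * t) * complex_of_real (exp (- (t\<^sup>2) / 2))"])
      (rule gaussian_integral_1)
  also have "\<dots> = complex_of_real (sqrt (2 * pi) ^ DIM('a) * exp (- ((norm \<xi>)\<^sup>2) / 2))"
    unfolding e by (simp only: of_real_prod[symmetric] prod.distrib prod_constant)
  finally show "osc 1 (\<lambda>x::'a. complex_of_real (exp (- ((norm x)\<^sup>2) / 2))) \<xi> =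
      complex_of_real (sqrt (2 * pi) ^ DIM('a) * exp (- ((norm \<xi>)\<^sup>2) / 2))" .
qed

text \<open>The outer integral is damped by a Gaussian of width 1 / \<epsilon>; the multiplication
  formula turns it into a Gaussian mean of g around \<xi> at scale \<epsilon>. Both sides converge
  by dominated convergence, using integrability of the transform on one side and boundedness of g on
  the other.\<close>

lemma fourier_inversion:
  fixes g :: "'a::euclidean_space \<Rightarrow> complex"
  assumes g: "integrable lborel g" and gc: "continuous_on UNIV g" and gb: "\<And>x. norm (g x) \<le> B"
    and h: "integrable lborel (osc 1 g)"
  shows "osc (- 1) (osc 1 g) \<xi> = complex_of_real ((2 * pi) ^ DIM('a)) * g \<xi>"
proof -
  let ?\<gamma> = "\<lambda>x::'a. complex_of_real (exp (- ((norm x)\<^sup>2) / 2))"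
  define \<epsilon> where "\<epsilon> m = inverse (real (Suc m))" for m
  have e: "0 < \<epsilon> m" for m by (simp add: \<epsilon>_def)
  have elim: "\<epsilon> \<longlonglongrightarrow> 0" unfolding \<epsilon>_def by (rule LIMSEQ_inverse_real_of_nat)
  have [measurable]: "g \<in> borel_measurable borel" "osc 1 g \<in> borel_measurable borel"
    using g h by (auto dest: borel_measurable_integrable)
  have \<gamma>m[measurable]: "?\<gamma> \<in> borel_measurable borel" by measurable
  define v where "v m x = cis (- 1 * (x \<bullet> \<xi>)) * ?\<gamma> (0 + \<epsilon> m *\<^sub>R x)" for m and x :: 'a
  have vi: "integrable lborel (v m)" for m
    unfolding v_def
    by (intro integrable_cis_mult integrable_lborel_affine[where f="?\<gamma>"] gaussian_integral e) measurable
  have key: "(LINT x|lborel. osc 1 g x * v m x) =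
     complex_of_real (sqrt (2 * pi) ^ DIM('a)) * (LINT z|lborel. g (\<xi> + \<epsilon> m *\<^sub>R z) * ?\<gamma> z)" for m
  proof -
    \<comment> \<open>At the shifted point the phase of \<open>v m\<close> cancels the part of the
      kernel belonging to \<xi>, leaving the Gaussian's own transform at z.\<close>
    have ov: "\<epsilon> m ^ DIM('a) *\<^sub>R osc 1 (v m) (\<xi> + \<epsilon> m *\<^sub>R z) = complex_of_real (sqrt (2 * pi) ^ DIM('a)) * ?\<gamma> z" for z
    proof -
      have "osc 1 (v m) (\<xi> + \<epsilon> m *\<^sub>R z) = (LINT x|lborel. cis (1 * ((0 + \<epsilon> m *\<^sub>R x) \<bullet> z)) * ?\<gamma> (0 + \<epsilon> m *\<^sub>R x))"
        unfolding osc_def v_def mult.assoc[symmetric] cis_mult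
        by (intro Bochner_Integration.integral_cong refl) (simp add: inner_add_right algebra_simps)
      then have "\<epsilon> m ^ DIM('a) *\<^sub>R osc 1 (v m) (\<xi> + \<epsilon> m *\<^sub>R z) = osc 1 ?\<gamma> z"
        unfolding osc_def by (subst (2) integral_lborel_affine[where t=0, OF _ e[of m]]) simp_all
      then show ?thesis unfolding gaussian_integral(2) by simp
    qed
    have "(LINT x|lborel. osc 1 g x * v m x) = (LINT \<eta>|lborel. g \<eta> * osc 1 (v m) \<eta>)"
      by (rule osc_swap[OF g vi])
    also have "\<dots> = \<epsilon> m ^ DIM('a) *\<^sub>R (LINT z|lborel. g (\<xi> + \<epsilon> m *\<^sub>R z) * osc 1 (v m) (\<xi> + \<epsilon> m *\<^sub>R z))"
      by (rule integral_lborel_affine[OF _ e]) (use borel_measurable_osc[OF vi] in measurable)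
    also have "\<dots> = (LINT z|lborel. g (\<xi> + \<epsilon> m *\<^sub>R z) * (\<epsilon> m ^ DIM('a) *\<^sub>R osc 1 (v m) (\<xi> + \<epsilon> m *\<^sub>R z)))"
      by (simp add: integral_scaleR_right[symmetric] del: integral_scaleR_right)
    also have "\<dots> = complex_of_real (sqrt (2 * pi) ^ DIM('a)) * (LINT z|lborel. g (\<xi> + \<epsilon> m *\<^sub>R z) * ?\<gamma> z)"
      unfolding ov integral_mult_right_zero[symmetric]
      by (intro Bochner_Integration.integral_cong refl) (simp only: mult_ac)
    finally show ?thesis .
  qed
  have lim1: "(\<lambda>m. LINT x|lborel. osc 1 g x * v m x) \<longlonglongrightarrow> (LINT x|lborel. osc 1 g x * cis (- 1 * (x \<bullet> \<xi>)))"
  proof (rule integral_dominated_convergence[where w="\<lambda>x. norm (osc 1 g x)"])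
    show "(\<lambda>x. osc 1 g x * v m x) \<in> borel_measurable lborel" for m
      using vi[of m] by (auto dest!: borel_measurable_integrable)
    have "(\<lambda>m. v m x) \<longlonglongrightarrow> cis (- 1 * (x \<bullet> \<xi>)) * ?\<gamma> (0 + 0 *\<^sub>R x)" for x
      unfolding v_def by (intro tendsto_intros elim) simp
    then have "(\<lambda>m. v m x) \<longlonglongrightarrow> cis (- 1 * (x \<bullet> \<xi>))" for x by simp
    then show "AE x in lborel. (\<lambda>m. osc 1 g x * v m x) \<longlonglongrightarrow> osc 1 g x * cis (- 1 * (x \<bullet> \<xi>))"
      by (intro AE_I2 tendsto_mult tendsto_const)
    show "AE x in lborel. norm (osc 1 g x * v m x) \<le> norm (osc 1 g x)" for m
      by (intro AE_I2) (simp add: v_def norm_mult mult_left_le)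
  qed (use h in auto)
  have lim2: "(\<lambda>m. LINT z|lborel. g (\<xi> + \<epsilon> m *\<^sub>R z) * ?\<gamma> z) \<longlonglongrightarrow> (LINT z|lborel. g \<xi> * ?\<gamma> z)"
  proof (rule integral_dominated_convergence[where w="\<lambda>z. B * norm (?\<gamma> z)"])
    show "integrable lborel (\<lambda>z. B * norm (?\<gamma> z))"
      by (intro integrable_mult_right integrable_norm gaussian_integral)
    have "(\<lambda>m. g (\<xi> + \<epsilon> m *\<^sub>R z)) \<longlonglongrightarrow> g \<xi>" for z
    proof (rule continuous_on_tendsto_compose[OF gc])
      have "(\<lambda>m. \<xi> + \<epsilon> m *\<^sub>R z) \<longlonglongrightarrow> \<xi> + 0 *\<^sub>R z" by (intro tendsto_intros elim)
      then show "(\<lambda>m. \<xi> + \<epsilon> m *\<^sub>R z) \<longlonglongrightarrow> \<xi>" by simp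
    qed auto
    then show "AE z in lborel. (\<lambda>m. g (\<xi> + \<epsilon> m *\<^sub>R z) * ?\<gamma> z) \<longlonglongrightarrow> g \<xi> * ?\<gamma> z"
      by (intro AE_I2 tendsto_mult tendsto_const)
    show "AE z in lborel. norm (g (\<xi> + \<epsilon> m *\<^sub>R z) * ?\<gamma> z) \<le> B * norm (?\<gamma> z)" for m
      unfolding norm_mult by (intro AE_I2 mult_right_mono gb) simp
  qed measurable
  have "osc 1 ?\<gamma> 0 = (LINT z|lborel. ?\<gamma> z)" by (simp add: osc_def)
  then have \<gamma>1: "(LINT z|lborel. ?\<gamma> z) = complex_of_real (sqrt (2 * pi) ^ DIM('a))"
    unfolding gaussian_integral(2) by simp
  have sq: "sqrt (2 * pi) ^ DIM('a) * sqrt (2 * pi) ^ DIM('a) = (2 * pi) ^ DIM('a)"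
    unfolding power_mult_distrib[symmetric] by simp
  have "(\<lambda>m. LINT x|lborel. osc 1 g x * v m x) \<longlonglongrightarrow> complex_of_real (sqrt (2 * pi) ^ DIM('a)) * (LINT z|lborel. g \<xi> * ?\<gamma> z)"
    unfolding key by (intro tendsto_mult tendsto_const lim2)
  then have "(LINT x|lborel. osc 1 g x * cis (- 1 * (x \<bullet> \<xi>))) = complex_of_real (sqrt (2 * pi) ^ DIM('a)) * (LINT z|lborel. g \<xi> * ?\<gamma> z)"
    by (rule LIMSEQ_unique[OF lim1])
  also have "\<dots> = complex_of_real ((2 * pi) ^ DIM('a)) * g \<xi>"
    unfolding integral_mult_right_zero \<gamma>1 sq[symmetric] of_real_mult by (simp only: mult_ac)
  finally show ?thesis unfolding osc_def[of "- 1"] by (simp only: mult.commute)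
qed

section \<open>Decay of transforms of smooth compactly supported functions\<close>

lemma directional_difference_quotient:
  fixes F :: "'a::euclidean_space \<Rightarrow> complex"
  assumes dF: "\<And>x. (F has_derivative F' x) (at x)" and B: "\<And>x. norm (F' x b) \<le> B"
  shows "norm (F (x + t *\<^sub>R b) - F x) \<le> B * \<bar>t\<bar>"
    and "((\<lambda>t. (F (x + t *\<^sub>R b) - F x) /\<^sub>R t) \<longlongrightarrow> F' x b) (at 0)"
proof -
  have g: "((\<lambda>s. F (x + s *\<^sub>R b)) has_derivative (\<lambda>h. h *\<^sub>R F' (x + s *\<^sub>R b) b)) (at s)" for s
  proof -
    have "((\<lambda>s. x + s *\<^sub>R b) has_derivative (\<lambda>h. h *\<^sub>R b)) (at s)"
      by (auto intro!: derivative_eq_intros)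
    from has_derivative_compose[where g=F and f="\<lambda>s. x + s *\<^sub>R b", OF this dF]
    have "((\<lambda>s. F (x + s *\<^sub>R b)) has_derivative (\<lambda>h. F' (x + s *\<^sub>R b) (h *\<^sub>R b))) (at s)" .
    then show ?thesis by (simp only: linear_scale[OF has_derivative_linear[OF dF]])
  qed
  have "norm (F (x + t *\<^sub>R b) - F (x + 0 *\<^sub>R b)) \<le> B * norm (t - 0)"
  proof (rule differentiable_bound[of UNIV "\<lambda>s. F (x + s *\<^sub>R b)" "\<lambda>s h. h *\<^sub>R F' (x + s *\<^sub>R b) b"])
    fix s
    have "norm (h *\<^sub>R F' (x + s *\<^sub>R b) b) \<le> B * norm h" for h
      unfolding norm_scaleR using mult_left_mono[OF B[of "x + s *\<^sub>R b"], of "\<bar>h\<bar>"]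
      by (simp only: real_norm_def abs_ge_zero mult.commute)
    then show "onorm (\<lambda>h. h *\<^sub>R F' (x + s *\<^sub>R b) b) \<le> B" by (rule onorm_le)
  qed (auto intro: g)
  then show "norm (F (x + t *\<^sub>R b) - F x) \<le> B * \<bar>t\<bar>" by simp
  have "(\<lambda>h. norm (F (x + (0 + h) *\<^sub>R b) - F (x + 0 *\<^sub>R b) - h *\<^sub>R F' (x + 0 *\<^sub>R b) b) / norm h) \<midarrow>0\<rightarrow> 0"
    using g[of 0] unfolding has_derivative_at by blast
  then have "(\<lambda>h. norm (F (x + h *\<^sub>R b) - F x - h *\<^sub>R F' x b) / \<bar>h\<bar>) \<midarrow>0\<rightarrow> 0" by simp
  moreover have "eventually (\<lambda>h. norm (F (x + h *\<^sub>R b) - F x - h *\<^sub>R F' x b) / \<bar>h\<bar> =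
      norm ((F (x + h *\<^sub>R b) - F x) /\<^sub>R h - F' x b)) (at 0)"
  proof (rule eventually_at_topological[THEN iffD2, OF exI[of _ UNIV]], safe)
    fix h :: real assume "h \<noteq> 0"
    then have "(F (x + h *\<^sub>R b) - F x) /\<^sub>R h - F' x b = (F (x + h *\<^sub>R b) - F x - h *\<^sub>R F' x b) /\<^sub>R h"
      by (simp add: scaleR_diff_right)
    then show "norm (F (x + h *\<^sub>R b) - F x - h *\<^sub>R F' x b) / \<bar>h\<bar> = norm ((F (x + h *\<^sub>R b) - F x) /\<^sub>R h - F' x b)"
      by (simp only: norm_scaleR abs_inverse divide_inverse mult.commute)
  qed auto
  ultimately have "(\<lambda>h. norm ((F (x + h *\<^sub>R b) - F x) /\<^sub>R h - F' x b)) \<midarrow>0\<rightarrow> 0"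
    by (rule Lim_transform_eventually)
  then show "((\<lambda>t. (F (x + t *\<^sub>R b) - F x) /\<^sub>R t) \<longlongrightarrow> F' x b) (at 0)"
    by (rule LIM_zero_cancel[OF tendsto_norm_zero_cancel])
qed

text \<open>Every difference quotient has integral 0 by translation invariance. They are bounded
  uniformly and, for steps of length at most 1, supported in one fixed ball, so the limit may be
  taken under the integral.\<close>

lemma integral_directional_derivative_zero:
  fixes F :: "'a::euclidean_space \<Rightarrow> complex"
  assumes dF: "\<And>x. (F has_derivative F' x) (at x)" and b: "b \<in> Basis"
    and c: "continuous_on UNIV (\<lambda>x. F' x b)"
    and z: "\<And>x. r < norm x \<Longrightarrow> F x = 0" "\<And>x. r < norm x \<Longrightarrow> F' x b = 0"
  shows "(LINT x|lborel. F' x b) = 0"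
proof -
  have Fc: "continuous_on UNIV F"
    by (intro continuous_at_imp_continuous_on ballI has_derivative_continuous[OF dF])
  have Fi: "integrable lborel F"
    by (rule continuous_compact_support_integrable[OF Fc, of "r + 1"]) (use z in auto)
  have [measurable]: "F \<in> borel_measurable borel" "(\<lambda>x. F' x b) \<in> borel_measurable borel"
    by (auto intro: borel_measurable_continuous_onI Fc c)
  obtain B where B: "0 \<le> B" "\<And>x. norm (F' x b) \<le> B"
    by (rule continuous_compact_support_bounded[OF c, of "r + 1"]) (use z in auto)
  define t where "t m = inverse (real (Suc m))" for m
  have t: "0 < t m" "t m \<le> 1" for m by (auto simp: t_def field_simps)
  have tlim: "filterlim t (at 0) sequentially"
    unfolding filterlim_at using t LIMSEQ_inverse_real_of_nat by (auto simp: t_def[abs_def])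
  have "(\<lambda>m. LINT x|lborel. (F (x + t m *\<^sub>R b) - F x) /\<^sub>R t m) \<longlonglongrightarrow> (LINT x|lborel. F' x b)"
  proof (rule integral_dominated_convergence[where w="\<lambda>x. B * indicator (cball 0 (r + 1)) x"])
    show "integrable lborel (\<lambda>x::'a. B * indicator (cball 0 (r + 1)) x)"
      by (intro integrable_mult_right integrable_real_indicator emeasure_lborel_cball_finite) auto
    show "AE x in lborel. (\<lambda>m. (F (x + t m *\<^sub>R b) - F x) /\<^sub>R t m) \<longlonglongrightarrow> F' x b"
      by (intro AE_I2 filterlim_compose[OF directional_difference_quotient(2)[OF dF B(2)] tlim])
    fix m
    show "AE x in lborel. norm ((F (x + t m *\<^sub>R b) - F x) /\<^sub>R t m) \<le> B * indicator (cball 0 (r + 1)) x"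
    proof (intro AE_I2)
      fix x
      show "norm ((F (x + t m *\<^sub>R b) - F x) /\<^sub>R t m) \<le> B * indicator (cball 0 (r + 1)) x"
      proof (cases "norm x \<le> r + 1")
        case True
        have "norm (F (x + t m *\<^sub>R b) - F x) \<le> B * \<bar>t m\<bar>"
          by (rule directional_difference_quotient(1)[OF dF B(2)])
        then have "inverse (t m) * norm (F (x + t m *\<^sub>R b) - F x) \<le> B"
          using t(1)[of m] by (simp add: field_simps)
        then show ?thesis using True t(1)[of m] by (simp only: norm_scaleR) simp
      next
        case False
        have "norm x - norm (t m *\<^sub>R b) \<le> norm (x + t m *\<^sub>R b)" by (rule norm_diff_ineq)
        then have "r < norm (x + t m *\<^sub>R b)" using False b t[of m] by simp
        then show ?thesis using False z(1) by simp
      qed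
    qed
  qed measurable
  moreover have "(LINT x|lborel. (F (x + t m *\<^sub>R b) - F x) /\<^sub>R t m) = 0" for m
  proof -
    have i: "integrable lborel (\<lambda>x. F (x + t m *\<^sub>R b))"
      using integrable_lborel_affine[OF Fi, of 1 "t m *\<^sub>R b"] by (simp add: add.commute)
    have e: "(LINT x|lborel. F x) = (LINT x|lborel. F (x + t m *\<^sub>R b))"
      using integral_lborel_affine[of F 1 "t m *\<^sub>R b"] by (simp add: add.commute)
    show ?thesis using i Fi e by simp
  qed
  ultimately have "(\<lambda>m::nat. 0) \<longlonglongrightarrow> (LINT x|lborel. F' x b)" by (simp only:)
  then show ?thesis by (simp add: LIMSEQ_const_iff)
qed

lemma has_derivative_cis_inner:
  "((\<lambda>x. cis (\<sigma> * (x \<bullet> \<xi>))) has_derivative (\<lambda>v. cis (\<sigma> * (x \<bullet> \<xi>)) * (\<i> * of_real (\<sigma> * (v \<bullet> \<xi>))))) (at x)"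
proof -
  have "((\<lambda>x. \<i> * of_real (\<sigma> * (x \<bullet> \<xi>))) has_derivative (\<lambda>v. \<i> * of_real (\<sigma> * (v \<bullet> \<xi>)))) (at x)"
    by (auto intro!: derivative_eq_intros)
  from has_derivative_compose[OF this DERIV_exp[unfolded has_field_derivative_def]]
  show ?thesis by (simp add: cis_conv_exp)
qed

text \<open>Integration by parts: the derivative of the compactly supported product of phase and f
  has integral 0.\<close>

lemma osc_derivative:
  fixes f :: "'a::euclidean_space \<Rightarrow> real"
  assumes df: "\<And>x. (f has_derivative f' x) (at x)" and b: "b \<in> Basis"
    and c: "continuous_on UNIV (\<lambda>x. f' x b)"
    and z: "\<And>x. r < norm x \<Longrightarrow> f x = 0" "\<And>x. r < norm x \<Longrightarrow> f' x b = 0"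
  shows "osc \<sigma> (\<lambda>x. complex_of_real (f' x b)) \<xi> =
    - (\<i> * of_real (\<sigma> * (b \<bullet> \<xi>))) * osc \<sigma> (\<lambda>x. complex_of_real (f x)) \<xi>"
proof -
  have fc: "continuous_on UNIV f"
    by (intro continuous_at_imp_continuous_on ballI has_derivative_continuous[OF df])
  let ?c = "\<lambda>x. cis (\<sigma> * (x \<bullet> \<xi>))"
  define F' where "F' x v = ?c x * complex_of_real (f' x v) + ?c x * (\<i> * of_real (\<sigma> * (v \<bullet> \<xi>))) * complex_of_real (f x)" for x v
  have dF: "((\<lambda>x. ?c x * complex_of_real (f x)) has_derivative F' x) (at x)" for x
    unfolding F'_def
    by (rule has_derivative_mult[OF has_derivative_cis_inner has_derivative_of_real[OF df]])
  have "(LINT x|lborel. F' x b) = 0"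
  proof (rule integral_directional_derivative_zero[OF dF b])
    show "continuous_on UNIV (\<lambda>x. F' x b)"
      unfolding F'_def by (intro continuous_intros c fc)
  qed (use z in \<open>auto simp: F'_def\<close>)
  moreover have i1: "integrable lborel (\<lambda>x. ?c x * complex_of_real (f' x b))"
    by (rule continuous_compact_support_integrable[where r="r + 1"]) (use z in \<open>auto intro!: continuous_intros c\<close>)
  moreover have i2: "integrable lborel (\<lambda>x. ?c x * complex_of_real (f x))"
    by (rule continuous_compact_support_integrable[where r="r + 1"]) (use z in \<open>auto intro!: continuous_intros fc\<close>)
  have e: "F' x b = ?c x * complex_of_real (f' x b) + (\<i> * of_real (\<sigma> * (b \<bullet> \<xi>))) * (?c x * complex_of_real (f x))" for x
    unfolding F'_def by (simp only: mult_ac)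
  have "(LINT x|lborel. F' x b) = osc \<sigma> (\<lambda>x. complex_of_real (f' x b)) \<xi> + (\<i> * of_real (\<sigma> * (b \<bullet> \<xi>))) * osc \<sigma> (\<lambda>x. complex_of_real (f x)) \<xi>"
    unfolding e osc_def
    by (subst Bochner_Integration.integral_add[OF i1 integrable_mult_right[OF i2]]) (simp only: integral_mult_right_zero)
  ultimately show ?thesis by (simp add: eq_neg_iff_add_eq_0)
qed

lemma norm_osc_iter_deriv:
  fixes f :: "'a::euclidean_space \<Rightarrow> real"
  assumes f: "smooth f" and b: "b \<in> Basis" and z: "\<And>x. r < norm x \<Longrightarrow> f x = 0"
  shows "norm (osc \<sigma> (\<lambda>x. complex_of_real (iter_deriv (replicate k b) f x)) \<xi>) =
    \<bar>\<sigma> * (\<xi> \<bullet> b)\<bar> ^ k * norm (osc \<sigma> (\<lambda>x. complex_of_real (f x)) \<xi>)"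
proof (induction k)
  case 0
  then show ?case by (simp add: iter_deriv_Nil)
next
  case (Suc k)
  have l: "replicate k b \<in> lists Basis" "replicate (Suc k) b \<in> lists Basis" using b by auto
  have e: "iter_deriv (replicate (Suc k) b) f x = frechet_derivative (iter_deriv (replicate k b) f) (at x) b" for x
    by (simp add: iter_deriv_Cons)
  have "osc \<sigma> (\<lambda>x. complex_of_real (iter_deriv (replicate (Suc k) b) f x)) \<xi> =
    - (\<i> * of_real (\<sigma> * (b \<bullet> \<xi>))) * osc \<sigma> (\<lambda>x. complex_of_real (iter_deriv (replicate k b) f x)) \<xi>"
    unfolding e
  proof (rule osc_derivative[OF smooth_has_derivative[OF f l(1)] b])
    show "continuous_on UNIV (\<lambda>x. frechet_derivative (iter_deriv (replicate k b) f) (at x) b)"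
      using smooth_iter_deriv_continuous[OF f l(2)] unfolding e .
    show "r < norm x \<Longrightarrow> iter_deriv (replicate k b) f x = 0" for x
      by (rule iter_deriv_support[OF z])
    show "r < norm x \<Longrightarrow> frechet_derivative (iter_deriv (replicate k b) f) (at x) b = 0" for x
      unfolding e[symmetric] by (rule iter_deriv_support[OF z])
  qed
  then show ?case using Suc.IH by (simp add: norm_mult inner_commute abs_mult)
qed

text \<open>Some coordinate satisfies |\<xi>| <= n |\<xi> . b|. Depending on \<xi>, only k
  derivatives in that one direction are needed, so mixed derivatives never enter.\<close>

lemma osc_decay:
  fixes f :: "'a::euclidean_space \<Rightarrow> real"
  assumes f: "smooth f" and z: "\<And>x. r < norm x \<Longrightarrow> f x = 0" and s: "\<bar>\<sigma>\<bar> = 1"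
  obtains C where "0 \<le> C" "\<And>\<xi>. norm (osc \<sigma> (\<lambda>x. complex_of_real (f x)) \<xi>) \<le> C / (1 + norm \<xi>) ^ k"
proof -
  let ?O = "\<lambda>\<xi>. norm (osc \<sigma> (\<lambda>x. complex_of_real (f x)) \<xi>)"
  define I where "I b = (LINT x|lborel. norm (complex_of_real (iter_deriv (replicate k b) f x)))" for b
  have I: "\<bar>\<xi> \<bullet> b\<bar> ^ k * ?O \<xi> \<le> I b" if "b \<in> Basis" for b \<xi>
  proof -
    have "norm (osc \<sigma> (\<lambda>x. complex_of_real (iter_deriv (replicate k b) f x)) \<xi>) = \<bar>\<sigma> * (\<xi> \<bullet> b)\<bar> ^ k * ?O \<xi>"
      by (rule norm_osc_iter_deriv[OF f that]) (rule z)
    moreover have "norm (osc \<sigma> (\<lambda>x. complex_of_real (iter_deriv (replicate k b) f x)) \<xi>) \<le> I b"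
      unfolding I_def by (rule norm_osc_le)
    ultimately show ?thesis by (simp add: abs_mult s)
  qed
  have I0: "0 \<le> I b" for b by (simp add: I_def)
  define J where "J = (LINT x|lborel. norm (complex_of_real (f x)))"
  have J: "?O \<xi> \<le> J" for \<xi> unfolding J_def by (rule norm_osc_le)
  have J0: "0 \<le> J" by (simp add: J_def)
  let ?n = "real DIM('a)"
  define C where "C = 2 ^ k * (J + ?n ^ k * (\<Sum>b\<in>Basis. I b))"
  have C: "0 \<le> C" unfolding C_def using I0 J0 by (intro mult_nonneg_nonneg add_nonneg_nonneg sum_nonneg) auto
  have "?O \<xi> \<le> C / (1 + norm \<xi>) ^ k" for \<xi>
  proof -
    have "\<exists>b\<in>Basis. norm \<xi> \<le> ?n * \<bar>\<xi> \<bullet> b\<bar>"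
    proof (rule ccontr)
      assume "\<not> ?thesis"
      then have "(\<Sum>b\<in>(Basis::'a set). ?n * \<bar>\<xi> \<bullet> b\<bar>) < (\<Sum>b\<in>(Basis::'a set). norm \<xi>)"
        by (intro sum_strict_mono) auto
      then have "?n * (\<Sum>b\<in>Basis. \<bar>\<xi> \<bullet> b\<bar>) < ?n * norm \<xi>" by (simp add: sum_distrib_left)
      then show False using norm_le_l1[of \<xi>] by simp
    qed
    then obtain b where b: "b \<in> Basis" "norm \<xi> \<le> ?n * \<bar>\<xi> \<bullet> b\<bar>" by blast
    have "norm \<xi> ^ k * ?O \<xi> \<le> (?n * \<bar>\<xi> \<bullet> b\<bar>) ^ k * ?O \<xi>"
      using b by (intro mult_right_mono power_mono) auto
    also have "\<dots> = ?n ^ k * (\<bar>\<xi> \<bullet> b\<bar> ^ k * ?O \<xi>)" by (simp add: power_mult_distrib)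
    also have "\<dots> \<le> ?n ^ k * (\<Sum>b\<in>Basis. I b)"
      using order_trans[OF I[OF b(1), of \<xi>] member_le_sum[OF b(1), of I]] I0 by (intro mult_left_mono) auto
    finally have 1: "norm \<xi> ^ k * ?O \<xi> \<le> ?n ^ k * (\<Sum>b\<in>Basis. I b)" .
    have "(1 + norm \<xi>) ^ k \<le> (2 * max 1 (norm \<xi>)) ^ k" by (intro power_mono) auto
    also have "\<dots> = 2 ^ k * max 1 (norm \<xi>) ^ k" by (rule power_mult_distrib)
    also have "max 1 (norm \<xi>) ^ k \<le> 1 + norm \<xi> ^ k" by (auto simp: max_def)
    finally have "(1 + norm \<xi>) ^ k * ?O \<xi> \<le> 2 ^ k * (1 + norm \<xi> ^ k) * ?O \<xi>"
      by (intro mult_right_mono) auto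
    also have "\<dots> = 2 ^ k * (?O \<xi> + norm \<xi> ^ k * ?O \<xi>)" by (simp add: algebra_simps)
    also have "\<dots> \<le> C" unfolding C_def using J[of \<xi>] 1 by (intro mult_left_mono add_mono) auto
    finally have "(1 + norm \<xi>) ^ k * ?O \<xi> \<le> C" .
    moreover have "0 < (1 + norm \<xi>) ^ k" by (simp add: add_pos_nonneg)
    ultimately show ?thesis by (simp add: pos_le_divide_eq mult.commute)
  qed
  then show ?thesis using that C by blast
qed

section \<open>Wave packets\<close>

lemma lp_psi_support:
  assumes "lp_cutoff \<phi>" and "norm \<xi> \<le> 1/2 \<or> 2 \<le> norm \<xi>"
  shows "lp_psi \<phi> \<xi> = 0"
proof -
  have "norm (\<xi> /\<^sub>R 2) = norm \<xi> / 2" by simp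
  then show ?thesis using assms by (auto simp: lp_psi_def lp_cutoff_def)
qed

lemma lp_cutoff_continuous_compose:
  "lp_cutoff \<phi> \<Longrightarrow> continuous_on UNIV f \<Longrightarrow> continuous_on UNIV (\<lambda>x. \<phi> (f x))"
  by (rule continuous_on_compose2[OF lp_cutoff_continuous]) auto

lemma lp_psi_continuous:
  assumes "lp_cutoff \<phi>" shows "continuous_on UNIV (lp_psi \<phi>)"
  unfolding lp_psi_def[abs_def]
  by (intro continuous_on_diff lp_cutoff_continuous_compose[OF assms] continuous_intros)

text \<open>With z = 2^(-j) \<xi> the three terms telescope to \<phi>(z / 4) - \<phi>(2 z). This is
  1 - 0, as |z| lies between 3/4 and 5/4.\<close>

lemma lp_psi_sum:
  assumes phi: "lp_cutoff \<phi>"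
    and xi: "3 / 4 * 2 powr real_of_int j \<le> norm \<xi>" "norm \<xi> \<le> 5 / 4 * 2 powr real_of_int j"
  shows "lp_psi \<phi> (2 powr (- real_of_int (j - 1)) *\<^sub>R \<xi>) + lp_psi \<phi> (2 powr (- real_of_int j) *\<^sub>R \<xi>) +
    lp_psi \<phi> (2 powr (- real_of_int (j + 1)) *\<^sub>R \<xi>) = 1"
proof -
  define z where "z = 2 powr (- real_of_int j) *\<^sub>R \<xi>"
  have pj: "2 powr real_of_int j * 2 powr (- real_of_int j) = (1::real)"
    unfolding powr_add[symmetric] by simp
  have z: "3 / 4 \<le> norm z" "norm z \<le> 5 / 4"
  proof -
    have nz: "norm z = norm \<xi> * 2 powr (- real_of_int j)" by (simp add: z_def)
    show "3 / 4 \<le> norm z" "norm z \<le> 5 / 4"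
      using mult_right_mono[OF xi(1), of "2 powr (- real_of_int j)"] mult_right_mono[OF xi(2), of "2 powr (- real_of_int j)"]
      unfolding mult.assoc pj nz by simp_all
  qed
  have 1: "2 powr (- real_of_int (j - 1)) *\<^sub>R \<xi> = 2 *\<^sub>R z"
    using powr_add[of 2 1 "- real_of_int j"] by (simp add: z_def)
  have 2: "2 powr (- real_of_int (j + 1)) *\<^sub>R \<xi> = z /\<^sub>R 2"
    unfolding z_def by (simp add: powr_diff powr_minus inverse_eq_divide)
  have "\<phi> (2 *\<^sub>R z) = 0" "\<phi> ((z /\<^sub>R 2) /\<^sub>R 2) = 1"
    using phi z by (auto simp: lp_cutoff_def)
  then show ?thesis unfolding 1 2 z_def[symmetric] by (simp add: lp_psi_def)
qed

text \<open>On the Fourier side; up to a constant, \<open>packet \<phi> h R a w\<close> is the transform of a function of height \<open>h\<close>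
  at scale \<open>R\<close> around \<open>a\<close>, oscillating with frequency \<open>w\<close>.\<close>

definition packet :: "('a::euclidean_space \<Rightarrow> real) \<Rightarrow> real \<Rightarrow> real \<Rightarrow> 'a \<Rightarrow> 'a \<Rightarrow> 'a \<Rightarrow> complex"
  where "packet \<phi> h R a w \<xi> =
    complex_of_real (h * R ^ DIM('a) * \<phi> (R *\<^sub>R (\<xi> - w))) * cis (- (a \<bullet> (\<xi> - w)))"

lemma packet_zero:
  assumes "lp_cutoff \<phi>" "0 < R" "1 / R \<le> norm (\<xi> - w)"
  shows "packet \<phi> h R a w \<xi> = 0"
proof -
  have "norm (R *\<^sub>R (\<xi> - w)) = R * norm (\<xi> - w)" using assms(2) by (simp only: norm_scaleR abs_of_pos)
  then have "1 \<le> norm (R *\<^sub>R (\<xi> - w))" using assms by (simp add: divide_le_eq mult.commute)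
  then show ?thesis using assms(1) by (simp add: packet_def lp_cutoff_def)
qed

lemma packet_continuous:
  assumes "lp_cutoff \<phi>" shows "continuous_on UNIV (packet \<phi> h R a w)"
proof -
  have "continuous_on UNIV (\<lambda>\<xi>. \<phi> (R *\<^sub>R (\<xi> - w)))"
    by (rule lp_cutoff_continuous_compose[OF assms]) (intro continuous_intros)
  then show ?thesis unfolding packet_def[abs_def] by (intro continuous_intros)
qed

lemma packet_compact_support:
  assumes "lp_cutoff \<phi>" "0 < R" "norm w + 1 / R \<le> norm \<xi>"
  shows "packet \<phi> h R a w \<xi> = 0"
  using norm_triangle_ineq2[of \<xi> w] assms by (intro packet_zero) auto

text \<open>Substituting \<xi> = w + \<zeta> / R: the factor R^n in \<open>packet\<close> cancels
  the Jacobian, so that h really is the height and R the width in physical space.\<close>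

lemma osc_packet:
  fixes \<phi> :: "'a::euclidean_space \<Rightarrow> real"
  assumes phi: "lp_cutoff \<phi>" and R: "0 < R"
  shows "osc 1 (packet \<phi> h R a w) x =
    complex_of_real h * cis (w \<bullet> x) * osc 1 (\<lambda>\<zeta>. complex_of_real (\<phi> \<zeta>)) ((x - a) /\<^sub>R R)"
proof -
  let ?n = "DIM('a)"
  have [measurable]: "packet \<phi> h R a w \<in> borel_measurable borel"
    by (intro borel_measurable_continuous_onI packet_continuous phi)
  have R1: "0 < 1 / R" using R by simp
  have Rn: "(1 / R) ^ ?n * R ^ ?n = 1" using R by (simp add: power_one_over)
  have "osc 1 (packet \<phi> h R a w) x = (1 / R) ^ ?n *\<^sub>R (LINT \<zeta>|lborel. cis (1 * ((w + (1 / R) *\<^sub>R \<zeta>) \<bullet> x)) * packet \<phi> h R a w (w + (1 / R) *\<^sub>R \<zeta>))"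
    unfolding osc_def by (rule integral_lborel_affine[OF _ R1]) measurable
  also have "(\<lambda>\<zeta>. cis (1 * ((w + (1 / R) *\<^sub>R \<zeta>) \<bullet> x)) * packet \<phi> h R a w (w + (1 / R) *\<^sub>R \<zeta>)) =
      (\<lambda>\<zeta>. complex_of_real (h * R ^ ?n) * cis (w \<bullet> x) * (cis (1 * (\<zeta> \<bullet> ((x - a) /\<^sub>R R))) * complex_of_real (\<phi> \<zeta>)))"
  proof
    fix \<zeta>
    have e1: "cis (1 * ((w + (1 / R) *\<^sub>R \<zeta>) \<bullet> x)) * cis (- (a \<bullet> ((1 / R) *\<^sub>R \<zeta>))) =
        cis (w \<bullet> x) * cis (1 * (\<zeta> \<bullet> ((x - a) /\<^sub>R R)))"
      unfolding cis_mult
      by (simp add: inner_add_left inner_diff_right inverse_eq_divide diff_divide_distrib inner_commute[of a] add_diff_eq)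
    have e2: "packet \<phi> h R a w (w + (1 / R) *\<^sub>R \<zeta>) = complex_of_real (h * R ^ ?n * \<phi> \<zeta>) * cis (- (a \<bullet> ((1 / R) *\<^sub>R \<zeta>)))"
      using R by (simp add: packet_def)
    show "cis (1 * ((w + (1 / R) *\<^sub>R \<zeta>) \<bullet> x)) * packet \<phi> h R a w (w + (1 / R) *\<^sub>R \<zeta>) =
      complex_of_real (h * R ^ ?n) * cis (w \<bullet> x) * (cis (1 * (\<zeta> \<bullet> ((x - a) /\<^sub>R R))) * complex_of_real (\<phi> \<zeta>))"
      unfolding e2 mult.left_commute[of "cis (1 * ((w + (1 / R) *\<^sub>R \<zeta>) \<bullet> x))"] e1 of_real_mult
      by (simp only: mult_ac)
  qed
  also have "(1 / R) ^ ?n *\<^sub>R (LINT \<zeta>|lborel. complex_of_real (h * R ^ ?n) * cis (w \<bullet> x) * (cis (1 * (\<zeta> \<bullet> ((x - a) /\<^sub>R R))) * complex_of_real (\<phi> \<zeta>)))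
     = (1 / R) ^ ?n *\<^sub>R (complex_of_real (h * R ^ ?n) * cis (w \<bullet> x) * osc 1 (\<lambda>\<zeta>. complex_of_real (\<phi> \<zeta>)) ((x - a) /\<^sub>R R))"
    unfolding osc_def by (simp only: integral_mult_right_zero)
  also have "\<dots> = complex_of_real ((1 / R) ^ ?n * R ^ ?n * h) * cis (w \<bullet> x) * osc 1 (\<lambda>\<zeta>. complex_of_real (\<phi> \<zeta>)) ((x - a) /\<^sub>R R)"
    unfolding scaleR_conv_of_real of_real_mult by (simp only: mult_ac)
  finally show ?thesis unfolding Rn by simp
qed

lemma lp_cutoff_osc_decay:
  assumes "lp_cutoff \<phi>"
  obtains C where "0 \<le> C" "\<And>\<xi>. norm (osc 1 (\<lambda>x. complex_of_real (\<phi> x)) \<xi>) \<le> C / (1 + norm \<xi>) ^ k"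
proof -
  have *: "smooth \<phi>" "1 < norm x \<Longrightarrow> \<phi> x = 0" for x using assms by (auto simp: lp_cutoff_def)
  show ?thesis by (rule osc_decay[of \<phi> 1 1 k]) (use * that in auto)
qed

text \<open>Expressing the transform of \<psi> through that of \<phi> lets \<psi> inherit the decay,
  without differentiating \<psi>.\<close>

lemma osc_lp_psi:
  fixes \<phi> :: "'a::euclidean_space \<Rightarrow> real"
  assumes phi: "lp_cutoff \<phi>"
  shows "osc 1 (\<lambda>x. complex_of_real (lp_psi \<phi> x)) \<xi> =
    2 ^ DIM('a) * osc 1 (\<lambda>x. complex_of_real (\<phi> x)) (2 *\<^sub>R \<xi>) - osc 1 (\<lambda>x. complex_of_real (\<phi> x)) \<xi>"
proof -
  have [measurable]: "\<phi> \<in> borel_measurable borel"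
    by (intro borel_measurable_continuous_onI lp_cutoff_continuous phi)
  have i: "integrable lborel (\<lambda>x. complex_of_real (\<phi> x))"
    using lp_cutoff_integrable[OF phi] by simp
  have i2: "integrable lborel (\<lambda>x. complex_of_real (\<phi> (x /\<^sub>R 2)))"
    using integrable_lborel_affine[OF i, of "1/2" 0] by (simp add: inverse_eq_divide)
  have s: "osc 1 (\<lambda>x. complex_of_real (\<phi> (x /\<^sub>R 2))) \<xi> = 2 ^ DIM('a) * osc 1 (\<lambda>x. complex_of_real (\<phi> x)) (2 *\<^sub>R \<xi>)"
    unfolding osc_def
    by (subst integral_lborel_affine[where c=2 and t=0]) (simp_all add: scaleR_conv_of_real)
  have ci: "integrable lborel (\<lambda>x. cis (1 * (x \<bullet> \<xi>)) * complex_of_real (\<phi> (x /\<^sub>R 2)))"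
    by (rule integrable_cis_mult[OF i2]) measurable
  have ci2: "integrable lborel (\<lambda>x. cis (1 * (x \<bullet> \<xi>)) * complex_of_real (\<phi> x))"
    by (rule integrable_cis_mult[OF i]) measurable
  have "osc 1 (\<lambda>x. complex_of_real (lp_psi \<phi> x)) \<xi> =
      osc 1 (\<lambda>x. complex_of_real (\<phi> (x /\<^sub>R 2))) \<xi> - osc 1 (\<lambda>x. complex_of_real (\<phi> x)) \<xi>"
    unfolding osc_def lp_psi_def of_real_diff right_diff_distrib
    by (rule Bochner_Integration.integral_diff[OF ci ci2])
  then show ?thesis unfolding s .
qed

lemma osc_lp_psi_decay:
  fixes \<phi> :: "'a::euclidean_space \<Rightarrow> real"
  assumes phi: "lp_cutoff \<phi>"
  obtains C where "0 \<le> C" "\<And>\<xi>. norm (osc 1 (\<lambda>x. complex_of_real (lp_psi \<phi> x)) \<xi>) \<le> C / (1 + norm \<xi>) ^ k"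
proof -
  obtain C where C: "0 \<le> C" "\<And>\<xi>. norm (osc 1 (\<lambda>x. complex_of_real (\<phi> x)) \<xi>) \<le> C / (1 + norm \<xi>) ^ k"
    by (rule lp_cutoff_osc_decay[OF phi]) auto
  have "norm (osc 1 (\<lambda>x. complex_of_real (lp_psi \<phi> x)) \<xi>) \<le> (2 ^ DIM('a) * C + C) / (1 + norm \<xi>) ^ k" for \<xi>
  proof -
    have "norm (osc 1 (\<lambda>x. complex_of_real (\<phi> x)) (2 *\<^sub>R \<xi>)) \<le> C / (1 + norm (2 *\<^sub>R \<xi>)) ^ k" by (rule C)
    also have "\<dots> \<le> C / (1 + norm \<xi>) ^ k"
      using C(1) by (intro divide_left_mono power_mono mult_pos_pos zero_less_power) (auto simp: add_pos_nonneg)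
    finally have "2 ^ DIM('a) * norm (osc 1 (\<lambda>x. complex_of_real (\<phi> x)) (2 *\<^sub>R \<xi>)) \<le> 2 ^ DIM('a) * (C / (1 + norm \<xi>) ^ k)"
      by (rule mult_left_mono) simp
    then have "norm (2 ^ DIM('a) * osc 1 (\<lambda>x. complex_of_real (\<phi> x)) (2 *\<^sub>R \<xi>)) \<le> 2 ^ DIM('a) * (C / (1 + norm \<xi>) ^ k)"
      by (simp add: norm_mult norm_power)
    from add_mono[OF this C(2)[of \<xi>]] show ?thesis
      unfolding osc_lp_psi[OF phi] add_divide_distrib
      by (intro order_trans[OF norm_triangle_ineq4]) simp
  qed
  then show ?thesis using that[of "2 ^ DIM('a) * C + C"] C(1) by auto
qed

section \<open>Multipliers acting on a packet\<close>

text \<open>The convolution theorem for a multiplier that is itself a transform, obtained from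
  \<open>osc_swap\<close> by putting the phase at x into P.\<close>

lemma osc_dilated_multiplier:
  fixes K P :: "'a::euclidean_space \<Rightarrow> complex"
  assumes K: "integrable lborel K" and P: "integrable lborel P"
  shows "osc 1 (\<lambda>\<xi>. osc (- 1) K (\<epsilon> *\<^sub>R \<xi>) * P \<xi>) x = (LINT z|lborel. K z * osc 1 P (x - \<epsilon> *\<^sub>R z))"
proof -
  define g where "g \<xi> = cis (1 * (\<xi> \<bullet> x)) * P \<xi>" for \<xi>
  have g: "integrable lborel g" unfolding g_def by (rule integrable_cis_mult[OF P]) measurable
  have e: "osc (- 1) K (\<epsilon> *\<^sub>R \<xi>) = osc (- \<epsilon>) K \<xi>" for \<xi> by (simp add: osc_def)
  have o: "osc (- \<epsilon>) g z = osc 1 P (x - \<epsilon> *\<^sub>R z)" for z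
    unfolding osc_def g_def mult.assoc[symmetric] cis_mult
    by (intro Bochner_Integration.integral_cong refl) (simp add: inner_diff_right)
  have "osc 1 (\<lambda>\<xi>. osc (- 1) K (\<epsilon> *\<^sub>R \<xi>) * P \<xi>) x = (LINT \<xi>|lborel. osc (- \<epsilon>) K \<xi> * g \<xi>)"
    unfolding osc_def[of 1] e g_def by (intro Bochner_Integration.integral_cong refl) (simp only: mult.left_commute)
  also have "\<dots> = (LINT z|lborel. K z * osc (- \<epsilon>) g z)" by (rule osc_swap[OF K g])
  finally show ?thesis unfolding o .
qed

text \<open>A Peetre-type inequality: 1 + |y| / R is at most (1 + |y - \<epsilon> z| / R) (1 + |z|).
  It is here that the kernel must not be wider than the packet, \<epsilon> <= R.\<close>

lemma envelope_shift:
  fixes y z :: "'a::euclidean_space"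
  assumes R: "0 < R" and e: "0 \<le> \<epsilon>" "\<epsilon> \<le> R"
  shows "1 / (1 + norm (y - \<epsilon> *\<^sub>R z) / R) ^ k \<le> (1 + norm z) ^ k / (1 + norm y / R) ^ k"
proof -
  have "norm y \<le> norm (y - \<epsilon> *\<^sub>R z) + \<epsilon> * norm z"
    using norm_triangle_sub[of y "\<epsilon> *\<^sub>R z"] e by (simp add: add.commute)
  also have "\<dots> \<le> norm (y - \<epsilon> *\<^sub>R z) + R * norm z" using e by (intro add_left_mono mult_right_mono) auto
  finally have "norm y / R \<le> norm (y - \<epsilon> *\<^sub>R z) / R + norm z" using R by (simp add: field_simps)
  moreover have "0 \<le> norm (y - \<epsilon> *\<^sub>R z) / R * norm z" using R by simp
  ultimately have "1 + norm y / R \<le> (1 + norm (y - \<epsilon> *\<^sub>R z) / R) * (1 + norm z)"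
    unfolding distrib_left distrib_right by linarith
  then have "(1 + norm y / R) ^ k \<le> ((1 + norm (y - \<epsilon> *\<^sub>R z) / R) * (1 + norm z)) ^ k"
    using R by (intro power_mono) auto
  then have *: "(1 + norm y / R) ^ k \<le> (1 + norm (y - \<epsilon> *\<^sub>R z) / R) ^ k * (1 + norm z) ^ k"
    by (simp only: power_mult_distrib)
  have "0 < 1 + norm y / R" "0 < 1 + norm (y - \<epsilon> *\<^sub>R z) / R" using R by (auto intro!: add_pos_nonneg)
  then have p: "0 < (1 + norm y / R) ^ k" "0 < (1 + norm (y - \<epsilon> *\<^sub>R z) / R) ^ k" by auto
  show ?thesis using * p by (simp add: pos_divide_le_eq pos_le_divide_eq mult.commute)
qed

lemma packet_integrable:
  assumes "lp_cutoff \<phi>" "0 < R"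
  shows "integrable lborel (packet \<phi> h R a w)"
  by (rule continuous_compact_support_integrable[OF packet_continuous packet_compact_support])
     (use assms in auto)

text \<open>A dyadic block of a packet keeps the envelope of the packet, with a constant uniform in
  all parameters. Inversion writes \<psi> as a transform of its kernel K, and the resulting
  convolution averages the envelope over shifts by \<epsilon> z.\<close>

lemma multiplier_packet_bound:
  fixes \<phi> :: "'a::euclidean_space \<Rightarrow> real"
  assumes phi: "lp_cutoff \<phi>"
  obtains C where "0 \<le> C" "\<And>h R \<epsilon> a w x. 0 \<le> h \<Longrightarrow> 0 < R \<Longrightarrow> 0 \<le> \<epsilon> \<Longrightarrow> \<epsilon> \<le> R \<Longrightarrow>
    norm (osc 1 (\<lambda>\<xi>. complex_of_real (lp_psi \<phi> (\<epsilon> *\<^sub>R \<xi>)) * packet \<phi> h R a w \<xi>) x)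
      \<le> h * C / (1 + norm (x - a) / R) ^ (2 * DIM('a))"
proof -
  let ?n = "DIM('a)"
  define \<psi> where "\<psi> x = complex_of_real (lp_psi \<phi> x)" for x
  define K where "K = osc 1 \<psi>"
  obtain C1 where C1: "0 \<le> C1" "\<And>\<xi>. norm (osc 1 (\<lambda>x. complex_of_real (\<phi> x)) \<xi>) \<le> C1 / (1 + norm \<xi>) ^ (2 * ?n)"
    by (rule lp_cutoff_osc_decay[OF phi]) auto
  \<comment> \<open>The exponent is 4 n: one half pays for the weight lost in
    \<open>envelope_shift\<close>, the other half keeps the kernel integrable.\<close>
  obtain C2 where C2: "0 \<le> C2" "\<And>\<xi>. norm (K \<xi>) \<le> C2 / (1 + norm \<xi>) ^ (2 * ?n + 2 * ?n)"
    unfolding K_def \<psi>_def[abs_def] by (rule osc_lp_psi_decay[OF phi]) auto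
  have \<psi>c: "continuous_on UNIV \<psi>" unfolding \<psi>_def by (intro continuous_intros lp_psi_continuous phi)
  have \<psi>z: "2 \<le> norm x \<Longrightarrow> \<psi> x = 0" for x using lp_psi_support[OF phi] by (simp add: \<psi>_def)
  have \<psi>i: "integrable lborel \<psi>" by (rule continuous_compact_support_integrable[OF \<psi>c \<psi>z])
  obtain B where B: "0 \<le> B" "\<And>x. norm (\<psi> x) \<le> B"
    by (rule continuous_compact_support_bounded[OF \<psi>c \<psi>z]) auto
  have Km[measurable]: "K \<in> borel_measurable borel" unfolding K_def by (rule borel_measurable_osc[OF \<psi>i])
  have pos: "0 < (1 + norm z) ^ m" for z :: 'a and m by (simp add: add_pos_nonneg)
  have wi: "integrable lborel (\<lambda>z::'a. C2 * (1 / (1 + norm z) ^ (2 * ?n)))"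
    by (intro integrable_mult_right integrable_inverse_power_norm) simp
  have KW: "norm (K z) * (1 + norm z) ^ (2 * ?n) \<le> C2 * (1 / (1 + norm z) ^ (2 * ?n))" for z
  proof -
    have "norm (K z) * (1 + norm z) ^ (2 * ?n) \<le> C2 / (1 + norm z) ^ (2 * ?n + 2 * ?n) * (1 + norm z) ^ (2 * ?n)"
      using pos[of z "2 * ?n"] by (intro mult_right_mono C2) simp
    also have "\<dots> = C2 * (1 / (1 + norm z) ^ (2 * ?n))"
      unfolding power_add using pos[of z "2 * ?n"] by simp
    finally show ?thesis .
  qed
  have KWi: "integrable lborel (\<lambda>z. norm (K z) * (1 + norm z) ^ (2 * ?n))"
    by (rule Bochner_Integration.integrable_bound[OF wi]) (use KW pos in \<open>auto simp: C2(1) abs_mult\<close>)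
  have Ki: "integrable lborel K"
  proof (rule Bochner_Integration.integrable_bound[OF KWi])
    show "AE z in lborel. norm (K z) \<le> norm (norm (K z) * (1 + norm z) ^ (2 * ?n))"
      by (intro AE_I2) (simp add: mult_le_cancel_left1 one_le_power)
  qed measurable
  have inv: "osc (- 1) K \<xi> = complex_of_real ((2 * pi) ^ ?n) * \<psi> \<xi>" for \<xi>
    unfolding K_def by (rule fourier_inversion[OF \<psi>i \<psi>c B(2) Ki[unfolded K_def]])
  define c where "c = 1 / (2 * pi) ^ ?n"
  have c: "0 < c" "c * (2 * pi) ^ ?n = 1" by (simp_all add: c_def)
  define C where "C = c * (C1 * (LINT z|lborel. norm (K z) * (1 + norm z) ^ (2 * ?n)))"
  have C: "0 \<le> C" using c(1) C1(1) by (auto simp: C_def intro!: mult_nonneg_nonneg Bochner_Integration.integral_nonneg)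
  have "norm (osc 1 (\<lambda>\<xi>. complex_of_real (lp_psi \<phi> (\<epsilon> *\<^sub>R \<xi>)) * packet \<phi> h R a w \<xi>) x)
      \<le> h * C / (1 + norm (x - a) / R) ^ (2 * ?n)"
    if h: "0 \<le> h" and R: "0 < R" and e: "0 \<le> \<epsilon>" "\<epsilon> \<le> R" for h R \<epsilon> a w x
  proof -
    let ?P = "packet \<phi> h R a w" and ?w = "1 / (1 + norm (x - a) / R) ^ (2 * ?n)"
    have Pi: "integrable lborel ?P" by (rule packet_integrable[OF phi R])
    have [measurable]: "osc 1 ?P \<in> borel_measurable borel" by (rule borel_measurable_osc[OF Pi])
    have eq: "complex_of_real (lp_psi \<phi> (\<epsilon> *\<^sub>R \<xi>)) * ?P \<xi> = complex_of_real c * (osc (- 1) K (\<epsilon> *\<^sub>R \<xi>) * ?P \<xi>)" for \<xi>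
    proof -
      have "complex_of_real c * complex_of_real ((2 * pi) ^ ?n) = 1"
        unfolding of_real_mult[symmetric] c(2) by simp
      then show ?thesis unfolding inv \<psi>_def mult.assoc[symmetric] by simp
    qed
    have "osc 1 (\<lambda>\<xi>. complex_of_real (lp_psi \<phi> (\<epsilon> *\<^sub>R \<xi>)) * ?P \<xi>) x =
        complex_of_real c * osc 1 (\<lambda>\<xi>. osc (- 1) K (\<epsilon> *\<^sub>R \<xi>) * ?P \<xi>) x"
      unfolding eq osc_def[of 1] integral_mult_right_zero[symmetric]
      by (intro Bochner_Integration.integral_cong refl) (simp only: mult_ac)
    also have "\<dots> = complex_of_real c * (LINT z|lborel. K z * osc 1 ?P (x - \<epsilon> *\<^sub>R z))"
      by (subst osc_dilated_multiplier[OF Ki Pi]) simp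
    finally have n1: "norm (osc 1 (\<lambda>\<xi>. complex_of_real (lp_psi \<phi> (\<epsilon> *\<^sub>R \<xi>)) * ?P \<xi>) x) =
        c * norm (LINT z|lborel. K z * osc 1 ?P (x - \<epsilon> *\<^sub>R z))"
      using c(1) by (simp add: norm_mult)
    have pw: "norm (K z * osc 1 ?P (x - \<epsilon> *\<^sub>R z)) \<le> h * C1 * ?w * (norm (K z) * (1 + norm z) ^ (2 * ?n))" for z
    proof -
      have "norm (osc 1 ?P (x - \<epsilon> *\<^sub>R z)) = h * norm (osc 1 (\<lambda>\<zeta>. complex_of_real (\<phi> \<zeta>)) ((x - \<epsilon> *\<^sub>R z - a) /\<^sub>R R))"
        unfolding osc_packet[OF phi R] norm_mult using h by simp
      also have "\<dots> \<le> h * (C1 / (1 + norm ((x - \<epsilon> *\<^sub>R z - a) /\<^sub>R R)) ^ (2 * ?n))"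
        using h by (intro mult_left_mono C1)
      also have "norm ((x - \<epsilon> *\<^sub>R z - a) /\<^sub>R R) = norm ((x - a) - \<epsilon> *\<^sub>R z) / R"
        using R by (simp add: divide_inverse mult.commute diff_diff_eq add.commute)
      also have "h * (C1 / (1 + norm ((x - a) - \<epsilon> *\<^sub>R z) / R) ^ (2 * ?n)) \<le> h * (C1 * ((1 + norm z) ^ (2 * ?n) * ?w))"
        using mult_left_mono[OF envelope_shift[OF R e, of "x - a" z "2 * ?n"] C1(1)] h
        by (intro mult_left_mono) simp_all
      finally have "norm (K z) * norm (osc 1 ?P (x - \<epsilon> *\<^sub>R z)) \<le> norm (K z) * (h * (C1 * ((1 + norm z) ^ (2 * ?n) * ?w)))"
        by (rule mult_left_mono) simp
      then show ?thesis unfolding norm_mult by (simp only: mult_ac)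
    qed
    have "norm (LINT z|lborel. K z * osc 1 ?P (x - \<epsilon> *\<^sub>R z)) \<le> (LINT z|lborel. h * C1 * ?w * (norm (K z) * (1 + norm z) ^ (2 * ?n)))"
    proof (rule Bochner_Integration.integral_norm_bound_integral)
      show i: "integrable lborel (\<lambda>z. h * C1 * ?w * (norm (K z) * (1 + norm z) ^ (2 * ?n)))"
        by (rule integrable_mult_right[OF KWi])
      show "integrable lborel (\<lambda>z. K z * osc 1 ?P (x - \<epsilon> *\<^sub>R z))"
      proof (rule Bochner_Integration.integrable_bound[OF i])
        show "AE z in lborel. norm (K z * osc 1 ?P (x - \<epsilon> *\<^sub>R z)) \<le> norm (h * C1 * ?w * (norm (K z) * (1 + norm z) ^ (2 * ?n)))"
          by (intro AE_I2 order_trans[OF pw]) (simp only: real_norm_def abs_ge_self)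
      qed measurable
    qed (rule pw)
    then have "c * norm (LINT z|lborel. K z * osc 1 ?P (x - \<epsilon> *\<^sub>R z)) \<le> c * (h * C1 * ?w * (LINT z|lborel. norm (K z) * (1 + norm z) ^ (2 * ?n)))"
      unfolding integral_mult_right_zero using c(1) by (intro mult_left_mono) auto
    then show ?thesis unfolding n1 C_def by (simp add: mult_ac)
  qed
  then show ?thesis using that C by blast
qed

text \<open>The profile w is at most 1 and W is at least 1, so w^k <= w and W <= W^k. Hence the same
  constant W works for every q, and only the width R^n carries the exponent 1 / q.\<close>

lemma Lq_norm_envelope:
  fixes g :: "'a::euclidean_space \<Rightarrow> complex"
  assumes [measurable]: "g \<in> borel_measurable borel" and q: "1 \<le> q" and R: "0 < R" and H: "0 \<le> H"
    and g: "\<And>x. norm (g x) \<le> H / (1 + norm (x - a) / R) ^ (2 * DIM('a))"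
    and W: "1 \<le> W" "(LINT x::'a|lborel. 1 / (1 + norm x) ^ (2 * DIM('a))) \<le> W"
  shows "Lq_norm q g \<le> ennreal (H * W * (R ^ DIM('a)) powr (1 / enn2real q))"
proof -
  let ?n = "DIM('a)"
  define w where "w x = 1 / (1 + norm x) ^ (2 * ?n)" for x :: 'a
  have w: "0 < w x" "w x \<le> 1" for x by (simp_all add: w_def add_pos_nonneg divide_le_eq_1 one_le_power)
  have wn: "1 / (1 + norm (x - a) / R) ^ (2 * ?n) = w ((x - a) /\<^sub>R R)" for x
    using R by (simp add: w_def divide_inverse mult.commute)
  have gw: "norm (g x) \<le> H * w ((x - a) /\<^sub>R R)" for x using g[of x] unfolding wn[symmetric] by simp
  have wi: "integrable lborel w" unfolding w_def by (rule integrable_inverse_power_norm) simp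
  have [measurable]: "w \<in> borel_measurable borel" using wi by (auto dest: borel_measurable_integrable)
  show ?thesis
  proof (cases "q = \<infinity>")
    case True
    have "norm (g x) \<le> H * W" for x
      using gw[of x] w(2)[of "(x - a) /\<^sub>R R"] W(1) H
      by (meson mult_left_mono order_trans)
    then have "Lq_norm \<infinity> g \<le> ennreal (H * W)"
      using H W by (subst Lq_norm_infty_le_iff) auto
    then show ?thesis using True R by simp
  next
    case False
    define k where "k = enn2real q"
    have k: "1 \<le> k" using enn2real_ge_1[OF q False] by (simp add: k_def)
    have Rn: "0 < R ^ ?n" using R by simp
    have "(\<integral>\<^sup>+ x. ennreal (norm (g x) powr k) \<partial>lborel) \<le> (\<integral>\<^sup>+ x. ennreal (H powr k) * ennreal (w ((x - a) /\<^sub>R R)) \<partial>lborel)"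
    proof (intro nn_integral_mono)
      fix x
      let ?v = "w ((x - a) /\<^sub>R R)"
      have "norm (g x) powr k \<le> (H * ?v) powr k" using gw[of x] k by (intro powr_mono2) auto
      also have "\<dots> = H powr k * ?v powr k" by (rule powr_mult)
      also have "\<dots> \<le> H powr k * ?v"
        using w[of "(x - a) /\<^sub>R R"] k powr_mono'[of 1 k ?v] by (intro mult_left_mono) auto
      finally show "ennreal (norm (g x) powr k) \<le> ennreal (H powr k) * ennreal ?v"
        using w(1)[of "(x - a) /\<^sub>R R"] by (subst ennreal_mult[symmetric]) (auto intro: ennreal_leI)
    qed
    also have "\<dots> = ennreal (H powr k) * (\<integral>\<^sup>+ x. ennreal (w ((x - a) /\<^sub>R R)) \<partial>lborel)"
      by (rule nn_integral_cmult) measurable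
    also have "(\<integral>\<^sup>+ x. ennreal (w ((x - a) /\<^sub>R R)) \<partial>lborel) = ennreal (R ^ ?n) * (\<integral>\<^sup>+ x. ennreal (w x) \<partial>lborel)"
      using R by (subst nn_integral_lborel_affine[of _ R a]) simp_all
    also have "(\<integral>\<^sup>+ x. ennreal (w x) \<partial>lborel) = ennreal (LINT x|lborel. w x)"
      by (rule nn_integral_eq_integral[OF wi]) (use w in \<open>auto intro: less_imp_le\<close>)
    also have "ennreal (H powr k) * (ennreal (R ^ ?n) * ennreal (LINT x|lborel. w x)) \<le> ennreal (H powr k) * (ennreal (R ^ ?n) * ennreal (W powr k))"
    proof (intro mult_left_mono ennreal_leI)
      show "(LINT x|lborel. w x) \<le> W powr k"
        using W k powr_mono[of 1 k W] by (simp add: w_def)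
    qed auto
    also have "\<dots> = ennreal (H powr k * (R ^ ?n * W powr k))"
      using Rn by (simp add: ennreal_mult)
    also have "H powr k * (R ^ ?n * W powr k) = (H * W * (R ^ ?n) powr (1 / k)) powr k"
    proof -
      have "((R ^ ?n) powr (1 / k)) powr k = R ^ ?n" using Rn k by (simp add: powr_powr)
      then show ?thesis unfolding powr_mult by (simp only: mult_ac)
    qed
    finally have "(\<integral>\<^sup>+ x. ennreal (norm (g x) powr k) \<partial>lborel) \<le> ennreal ((H * W * (R ^ ?n) powr (1 / k)) powr k)" .
    then show ?thesis
      unfolding k_def using H W by (subst Lq_norm_le_iff[OF q False]) auto
  qed
qed

section \<open>Sharpness\<close>

text \<open>On the support of \<phi> the phase stays within one radian, so the real part of the
  integrand is at least cos 1 times \<phi>.\<close>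

lemma osc_norm_le_one_lower_bound:
  fixes \<phi> :: "'a::euclidean_space \<Rightarrow> real"
  assumes phi: "lp_cutoff \<phi>" and y: "norm y \<le> 1"
  shows "cos 1 * (LINT x|lborel. \<phi> x) \<le> norm (osc 1 (\<lambda>x. complex_of_real (\<phi> x)) y)"
proof -
  have i: "integrable lborel (\<lambda>x. complex_of_real (\<phi> x))"
    using lp_cutoff_integrable[OF phi] by simp
  have ci: "integrable lborel (\<lambda>x. cis (1 * (x \<bullet> y)) * complex_of_real (\<phi> x))"
    by (rule integrable_cis_mult[OF i]) measurable
  have re: "Re (cis (1 * (x \<bullet> y)) * complex_of_real (\<phi> x)) = cos (x \<bullet> y) * \<phi> x" for x by simp
  have ri: "integrable lborel (\<lambda>x. cos (x \<bullet> y) * \<phi> x)"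
    using integrable_Re[OF ci] unfolding re .
  have "cos 1 * (LINT x|lborel. \<phi> x) = (LINT x|lborel. cos 1 * \<phi> x)" by simp
  also have "\<dots> \<le> (LINT x|lborel. cos (x \<bullet> y) * \<phi> x)"
  proof (rule integral_mono[OF _ ri])
    show "integrable lborel (\<lambda>x. cos 1 * \<phi> x)" by (intro integrable_mult_right lp_cutoff_integrable phi)
    fix x
    show "cos 1 * \<phi> x \<le> cos (x \<bullet> y) * \<phi> x"
    proof (cases "1 \<le> norm x")
      case True
      then show ?thesis using phi by (simp add: lp_cutoff_def)
    next
      case False
      have "\<bar>x \<bullet> y\<bar> \<le> norm x * norm y" by (rule Cauchy_Schwarz_ineq2)
      also have "\<dots> \<le> 1" using False y by (intro mult_le_one) auto
      finally have "cos 1 \<le> cos \<bar>x \<bullet> y\<bar>" using pi_gt3 by (intro cos_monotone_0_pi_le) auto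
      then have "cos 1 \<le> cos (x \<bullet> y)" by (simp only: cos_abs_real)
      then show ?thesis using phi by (intro mult_right_mono) (auto simp: lp_cutoff_def)
    qed
  qed
  also have "\<dots> = Re (osc 1 (\<lambda>x. complex_of_real (\<phi> x)) y)"
    unfolding osc_def integral_Re[OF ci, symmetric] re ..
  also have "\<dots> \<le> norm (osc 1 (\<lambda>x. complex_of_real (\<phi> x)) y)" by (rule complex_Re_le_cmod)
  finally show ?thesis .
qed

section \<open>Norm bounds for blocks prescribed on the Fourier side\<close>

text \<open>\<open>osc_swap\<close> moves the outer transform onto \<open>osc 1 F\<close>, inversion
  returns F, and a second swap produces the new integrand; the powers of 2 pi cancel. The functional
  is an integral on all functions, so its argument may be inserted without checking that it lies in
  \<open>schwartz\<close>.\<close>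

lemma dyadic_block_of_osc:
  fixes \<phi> :: "'a::euclidean_space \<Rightarrow> real" and F :: "'a \<Rightarrow> complex"
  assumes phi: "lp_cutoff \<phi>" and Fi: "integrable lborel F" and Fc: "continuous_on UNIV F"
    and Fb: "\<And>x. norm (F x) \<le> B" and oi: "integrable lborel (osc 1 F)"
  shows "represents (osc 1 (\<lambda>\<xi>. complex_of_real (lp_psi \<phi> (2 powr (- real_of_int k) *\<^sub>R \<xi>)) * F \<xi>))
    (dyadic_block \<phi> k (\<lambda>v. LINT x|lborel. osc 1 F x * v x))"
proof -
  let ?n = "DIM('a)"
  define m where "m \<xi> = complex_of_real (lp_psi \<phi> (2 powr (- real_of_int k) *\<^sub>R \<xi>))" for \<xi>
  have mc: "continuous_on UNIV m"
    unfolding m_def by (intro continuous_intros continuous_on_compose2[OF lp_psi_continuous[OF phi]]) auto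
  have mz: "m \<xi> = 0" if "2 * 2 powr real_of_int k \<le> norm \<xi>" for \<xi>
  proof -
    have "2 * 2 powr real_of_int k * 2 powr (- real_of_int k) \<le> norm \<xi> * 2 powr (- real_of_int k)"
      using that by (intro mult_right_mono) auto
    moreover have "2 * 2 powr real_of_int k * 2 powr (- real_of_int k) = (2::real)"
      unfolding mult.assoc powr_add[symmetric] by simp
    ultimately have "2 \<le> norm \<xi> * 2 powr (- real_of_int k)" by (simp only:)
    moreover have "norm (2 powr (- real_of_int k) *\<^sub>R \<xi>) = norm \<xi> * 2 powr (- real_of_int k)" by simp
    ultimately have "2 \<le> norm (2 powr (- real_of_int k) *\<^sub>R \<xi>)" by (simp only:)
    then show ?thesis using lp_psi_support[OF phi] by (simp add: m_def)
  qed
  have [measurable]: "m \<in> borel_measurable borel" by (intro borel_measurable_continuous_onI mc)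
  have [measurable]: "F \<in> borel_measurable borel" using Fi by (auto dest: borel_measurable_integrable)
  have mi: "integrable lborel m" by (rule continuous_compact_support_integrable[OF mc mz])
  obtain M where M: "0 \<le> M" "\<And>\<xi>. norm (m \<xi>) \<le> M"
    by (rule continuous_compact_support_bounded[OF mc mz]) auto
  have mFi: "integrable lborel (\<lambda>\<xi>. m \<xi> * F \<xi>)"
  proof (rule Bochner_Integration.integrable_bound)
    show "integrable lborel (\<lambda>\<xi>. M * norm (F \<xi>))" using Fi by simp
    show "AE \<xi> in lborel. norm (m \<xi> * F \<xi>) \<le> norm (M * norm (F \<xi>))"
      using M by (intro AE_I2) (simp add: norm_mult mult_right_mono)
  qed measurable
  let ?c = "complex_of_real (1 / (2 * pi) ^ ?n)"
  have main: "integrable lborel (\<lambda>x. osc 1 (\<lambda>\<xi>. m \<xi> * F \<xi>) x * f x) \<and>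
      dyadic_block \<phi> k (\<lambda>v. LINT x|lborel. osc 1 F x * v x) f = (LINT x|lborel. osc 1 (\<lambda>\<xi>. m \<xi> * F \<xi>) x * f x)"
    if f: "f \<in> schwartz" for f
  proof -
    have fi: "integrable lborel f" by (rule schwartz_integrable[OF f])
    have [measurable]: "f \<in> borel_measurable borel" using fi by (auto dest: borel_measurable_integrable)
    have [measurable]: "osc 1 f \<in> borel_measurable borel" by (rule borel_measurable_osc[OF fi])
    have [measurable]: "osc 1 (\<lambda>\<xi>. m \<xi> * F \<xi>) \<in> borel_measurable borel" by (rule borel_measurable_osc[OF mFi])
    have 1: "integrable lborel (\<lambda>x. osc 1 (\<lambda>\<xi>. m \<xi> * F \<xi>) x * f x)"
    proof (rule Bochner_Integration.integrable_bound)
      let ?I = "LINT \<xi>|lborel. norm (m \<xi> * F \<xi>)"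
      show "integrable lborel (\<lambda>x. ?I * norm (f x))" using fi by simp
      show "AE x in lborel. norm (osc 1 (\<lambda>\<xi>. m \<xi> * F \<xi>) x * f x) \<le> norm (?I * norm (f x))"
        unfolding norm_mult by (intro AE_I2) (simp add: mult_right_mono norm_osc_le[of 1 "\<lambda>\<xi>. m \<xi> * F \<xi>", unfolded norm_mult])
    qed measurable
    define g where "g \<xi> = m \<xi> * inv_fourier f \<xi>" for \<xi>
    have g: "g \<xi> = ?c * (m \<xi> * osc 1 f \<xi>)" for \<xi> unfolding g_def inv_fourier_osc by (simp only: mult_ac)
    have gi: "integrable lborel g"
      unfolding g
    proof (rule integrable_mult_right, rule Bochner_Integration.integrable_bound)
      let ?J = "LINT x|lborel. norm (f x)"
      show "integrable lborel (\<lambda>\<xi>. norm (m \<xi>) * ?J)" using mi by simp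
      show "AE \<xi> in lborel. norm (m \<xi> * osc 1 f \<xi>) \<le> norm (norm (m \<xi>) * ?J)"
        unfolding norm_mult by (intro AE_I2) (simp add: mult_left_mono norm_osc_le)
    qed measurable
    have "dyadic_block \<phi> k (\<lambda>v. LINT x|lborel. osc 1 F x * v x) f = (LINT x|lborel. osc 1 F x * osc (- 1) g x)"
      unfolding dyadic_block_def dist_inv_fourier_def dist_mult_def dist_fourier_def fourier_osc g_def m_def ..
    also have "\<dots> = (LINT \<xi>|lborel. osc (- 1) (osc 1 F) \<xi> * g \<xi>)" by (rule osc_swap[OF oi gi, symmetric])
    also have "\<dots> = (LINT \<xi>|lborel. (m \<xi> * F \<xi>) * osc 1 f \<xi>)"
    proof (intro Bochner_Integration.integral_cong refl)
      fix \<xi>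
      have "complex_of_real ((2 * pi) ^ ?n) * ?c = 1" unfolding of_real_mult[symmetric] by simp
      moreover have "complex_of_real ((2 * pi) ^ ?n) * F \<xi> * (?c * (m \<xi> * osc 1 f \<xi>)) =
          complex_of_real ((2 * pi) ^ ?n) * ?c * (m \<xi> * F \<xi> * osc 1 f \<xi>)"
        by (simp only: mult_ac)
      ultimately have "complex_of_real ((2 * pi) ^ ?n) * F \<xi> * (?c * (m \<xi> * osc 1 f \<xi>)) = 1 * (m \<xi> * F \<xi> * osc 1 f \<xi>)"
        by (simp only:)
      then show "osc (- 1) (osc 1 F) \<xi> * g \<xi> = (m \<xi> * F \<xi>) * osc 1 f \<xi>"
        unfolding fourier_inversion[OF Fi Fc Fb oi] g by simp
    qed
    also have "\<dots> = (LINT x|lborel. osc 1 (\<lambda>\<xi>. m \<xi> * F \<xi>) x * f x)" by (rule osc_swap[OF mFi fi, symmetric])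
    finally show ?thesis using 1 by blast
  qed
  then show ?thesis
    unfolding represents_def m_def[symmetric] using borel_measurable_osc[OF mFi] by simp
qed

lemma besov_seminorm_le_card:
  assumes r: "1 \<le> r" and T: "finite T" "T \<noteq> {}" and D: "0 \<le> D"
    and le: "\<And>k. k \<in> T \<Longrightarrow> dist_Lq_norm q (dyadic_block \<phi> k u) \<le> ennreal (D * 2 powr (- (real_of_int k * s)))"
    and z: "\<And>k. k \<notin> T \<Longrightarrow> dist_Lq_norm q (dyadic_block \<phi> k u) = 0"
  shows "besov_seminorm \<phi> s q r u \<le> ennreal (D * real (card T) powr (1 / enn2real r))"
proof -
  define d where "d k = dist_Lq_norm q (dyadic_block \<phi> k u)" for k
  \<comment> \<open>For r = \<infinity> the exponent \<open>1 / enn2real r\<close> is 0, and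
    positivity of the cardinality makes that power equal to 1.\<close>
  have c1: "0 < real (card T)" using T by (simp add: card_gt_0_iff)
  have le': "ennreal (2 powr (real_of_int k * s)) * d k \<le> ennreal D * indicator T k" for k
  proof (cases "k \<in> T")
    case True
    have "ennreal (2 powr (real_of_int k * s)) * d k \<le> ennreal (2 powr (real_of_int k * s)) * ennreal (D * 2 powr (- (real_of_int k * s)))"
      unfolding d_def by (intro mult_left_mono le True) simp
    also have "\<dots> = ennreal (2 powr (real_of_int k * s) * (D * 2 powr (- (real_of_int k * s))))"
      by (rule ennreal_mult'[symmetric]) simp
    also have "2 powr (real_of_int k * s) * (D * 2 powr (- (real_of_int k * s))) = D"
      unfolding mult.left_commute[of _ D] powr_add[symmetric] by simp
    finally show ?thesis using True by simp
  next
    case False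
    then show ?thesis using z[OF False] by (simp add: d_def)
  qed
  show ?thesis
  proof (cases "r = \<infinity>")
    case True
    have "(SUP k. ennreal (2 powr (real_of_int k * s)) * d k) \<le> ennreal D"
      by (rule SUP_least, rule order_trans[OF le']) (simp split: split_indicator)
    then show ?thesis unfolding besov_seminorm_def if_P[OF True] d_def using True c1 by simp
  next
    case False
    define k where "k = enn2real r"
    have k: "1 \<le> k" using enn2real_ge_1[OF r False] by (simp add: k_def)
    have "(\<integral>\<^sup>+ j. ennreal (2 powr (real_of_int j * s * k)) * epowr (d j) k \<partial>count_space UNIV)
      \<le> (\<integral>\<^sup>+ j. ennreal (D powr k) * indicator T j \<partial>count_space UNIV)"
    proof (intro nn_integral_mono)
      fix j
      have "ennreal (2 powr (real_of_int j * s * k)) * epowr (d j) k = epowr (ennreal (2 powr (real_of_int j * s)) * d j) k"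
        using k by (subst epowr_powr_mult[symmetric]) (simp_all add: powr_powr)
      also have "\<dots> \<le> epowr (ennreal D * indicator T j) k" by (rule epowr_mono[OF le']) (use k in simp)
      also have "\<dots> = ennreal (D powr k) * indicator T j"
        using D k by (auto simp: epowr_ennreal epowr_def split: split_indicator)
      finally show "ennreal (2 powr (real_of_int j * s * k)) * epowr (d j) k \<le> ennreal (D powr k) * indicator T j" .
    qed
    also have "\<dots> = ennreal (D powr k) * of_nat (card T)"
      using T by (simp add: nn_integral_cmult_indicator)
    also have "\<dots> = ennreal (D powr k * real (card T))"
      by (simp add: ennreal_mult ennreal_of_nat_eq_real_of_nat)
    finally have "epowr (\<integral>\<^sup>+ j. ennreal (2 powr (real_of_int j * s * k)) * epowr (d j) k \<partial>count_space UNIV) (1 / k)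
      \<le> epowr (ennreal (D powr k * real (card T))) (1 / k)"
      by (rule epowr_mono) (use k in simp)
    also have "\<dots> = ennreal (D * real (card T) powr (1 / k))"
      using D k by (simp add: epowr_ennreal powr_mult powr_powr)
    finally show ?thesis unfolding besov_seminorm_finite_exponent[OF False] d_def k_def .
  qed
qed

text \<open>On the interval from V \<mu> i / \<Lambda> to V \<mu> i the rearrangement is at least c
  \<mu>(i)^(-1/p), so the weighted rearrangement is at least a constant independent of i. Separation
  by \<Lambda> makes these intervals disjoint, and each carries at least 1 - 1 / \<Lambda> of the
  measure ds / s.\<close>

lemma lorentz_norm_ge_levels:
  fixes G :: "'a::euclidean_space \<Rightarrow> complex" and \<mu> :: "nat \<Rightarrow> real"
  assumes [measurable]: "G \<in> borel_measurable borel"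
    and r: "1 \<le> r" and p: "0 < p" and c: "0 < c" and V: "0 < V" and L: "1 < \<Lambda>"
    and mu: "\<And>i. 0 < \<mu> i" and sep: "\<And>i j. i \<noteq> j \<Longrightarrow> \<mu> i \<le> \<mu> j / \<Lambda> \<or> \<mu> j \<le> \<mu> i / \<Lambda>"
    and d: "\<And>i. i \<in> I \<Longrightarrow> ennreal (V * \<mu> i) \<le> distribution_fun G (ennreal (c * \<mu> i powr (- (1 / p))))"
    and I: "finite I"
  shows "ennreal (c * (V / \<Lambda>) powr (1 / p) * (1 - 1 / \<Lambda>) powr (1 / r) * real (card I) powr (1 / r)) \<le> lorentz_norm p (ennreal r) G"
proof -
  define \<kappa> where "\<kappa> = c * (V / \<Lambda>) powr (1 / p)"
  have \<kappa>: "0 < \<kappa>" using c V L by (simp add: \<kappa>_def)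
  define J where "J i = {V * \<mu> i / \<Lambda><..<V * \<mu> i}" for i
  have re: "ennreal \<kappa> \<le> ennreal (s powr (1 / p)) * rearrangement G s" if i: "i \<in> I" and s: "s \<in> J i" for i s
  proof -
    have s0: "0 < V * \<mu> i / \<Lambda>" using V mu[of i] L by simp
    have s1: "V * \<mu> i / \<Lambda> < s" "s < V * \<mu> i" using s by (auto simp: J_def)
    have "ennreal (c * \<mu> i powr (- (1 / p))) \<le> rearrangement G s"
      unfolding rearrangement_def
    proof (rule Inf_greatest, clarify, rule ccontr)
      fix t assume t: "distribution_fun G t \<le> ennreal s" "\<not> ennreal (c * \<mu> i powr (- (1 / p))) \<le> t"
      have "ennreal (V * \<mu> i) \<le> distribution_fun G (ennreal (c * \<mu> i powr (- (1 / p))))" by (rule d[OF i])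
      also have "\<dots> \<le> ennreal s"
      proof -
        have "t \<le> ennreal (c * \<mu> i powr (- (1 / p)))" using t(2) by simp
        then have "distribution_fun G (ennreal (c * \<mu> i powr (- (1 / p)))) \<le> distribution_fun G t"
          unfolding distribution_fun_def
          by (intro emeasure_mono Collect_mono impI) (erule order_trans, assumption, measurable)
        then show ?thesis using t(1) by simp
      qed
      finally have "V * \<mu> i \<le> s" using s0 s1 by simp
      then show False using s1 by simp
    qed
    moreover have "(V * \<mu> i / \<Lambda>) powr (1 / p) \<le> s powr (1 / p)" using s0 s1 p by (intro powr_mono2) auto
    ultimately have "ennreal ((V * \<mu> i / \<Lambda>) powr (1 / p)) * ennreal (c * \<mu> i powr (- (1 / p))) \<le> ennreal (s powr (1 / p)) * rearrangement G s"
      by (intro mult_mono ennreal_leI) auto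
    moreover have "ennreal ((V * \<mu> i / \<Lambda>) powr (1 / p)) * ennreal (c * \<mu> i powr (- (1 / p))) = ennreal \<kappa>"
    proof -
      have "V * \<mu> i / \<Lambda> = (V / \<Lambda>) * \<mu> i" by simp
      then have "(V * \<mu> i / \<Lambda>) powr (1 / p) = (V / \<Lambda>) powr (1 / p) * \<mu> i powr (1 / p)" by (simp only: powr_mult)
      then have "(V * \<mu> i / \<Lambda>) powr (1 / p) * (c * \<mu> i powr (- (1 / p))) = \<kappa> * (\<mu> i powr (1 / p) * \<mu> i powr (- (1 / p)))"
        unfolding \<kappa>_def by (simp only: mult_ac)
      moreover have "\<mu> i powr (1 / p) * \<mu> i powr (- (1 / p)) = 1"
        unfolding powr_add[symmetric] using mu[of i] by simp
      ultimately have "(V * \<mu> i / \<Lambda>) powr (1 / p) * (c * \<mu> i powr (- (1 / p))) = \<kappa> * 1" by (simp only:)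
      then show ?thesis by (subst ennreal_mult'[symmetric]) simp_all
    qed
    ultimately show ?thesis by simp
  qed
  have disj: "disjoint_family_on J UNIV"
    unfolding disjoint_family_on_def
  proof (intro ballI impI)
    fix i j :: nat assume "i \<noteq> j"
    from sep[OF this] show "J i \<inter> J j = {}"
    proof
      assume "\<mu> i \<le> \<mu> j / \<Lambda>"
      then have "V * \<mu> i \<le> V * (\<mu> j / \<Lambda>)" using V by (intro mult_left_mono) auto
      then show ?thesis by (auto simp: J_def)
    next
      assume "\<mu> j \<le> \<mu> i / \<Lambda>"
      then have "V * \<mu> j \<le> V * (\<mu> i / \<Lambda>)" using V by (intro mult_left_mono) auto
      then show ?thesis by (auto simp: J_def)
    qed
  qed
  have "ennreal (\<kappa> powr r * (1 - 1 / \<Lambda>) * real (card I)) = (\<Sum>i\<in>I. ennreal (\<kappa> powr r * (1 - 1 / \<Lambda>)))"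
    using L by (simp add: ennreal_mult' mult.commute ennreal_of_nat_eq_real_of_nat)
  also have "\<dots> = (\<Sum>i\<in>I. \<integral>\<^sup>+ s. ennreal (\<kappa> powr r / (V * \<mu> i)) * indicator (J i) s \<partial>lborel)"
  proof (rule sum.cong[OF refl])
    fix i
    have Vm: "0 < V * \<mu> i" using V mu[of i] by simp
    have le: "V * \<mu> i / \<Lambda> \<le> V * \<mu> i" using divide_left_mono[of 1 \<Lambda> "V * \<mu> i"] Vm L by simp
    have "(\<integral>\<^sup>+ s. ennreal (\<kappa> powr r / (V * \<mu> i)) * indicator (J i) s \<partial>lborel) = ennreal (\<kappa> powr r / (V * \<mu> i)) * ennreal (V * \<mu> i - V * \<mu> i / \<Lambda>)"
      using le by (subst nn_integral_cmult_indicator) (auto simp: J_def)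
    also have "\<dots> = ennreal (\<kappa> powr r / (V * \<mu> i) * (V * \<mu> i - V * \<mu> i / \<Lambda>))"
      by (rule ennreal_mult'[symmetric]) (use Vm in simp)
    also have "\<kappa> powr r / (V * \<mu> i) * (V * \<mu> i - V * \<mu> i / \<Lambda>) = \<kappa> powr r * (1 - 1 / \<Lambda>)"
    proof -
      have "a / v * (v - v / l) = a * (1 - 1 / l)" if "v \<noteq> 0" for a v l :: real
        using that by (simp add: right_diff_distrib)
      from this[OF less_imp_neq[OF Vm, symmetric]] show ?thesis .
    qed
    finally show "ennreal (\<kappa> powr r * (1 - 1 / \<Lambda>)) = (\<integral>\<^sup>+ s. ennreal (\<kappa> powr r / (V * \<mu> i)) * indicator (J i) s \<partial>lborel)" by simp
  qed
  also have "\<dots> = (\<integral>\<^sup>+ s. (\<Sum>i\<in>I. ennreal (\<kappa> powr r / (V * \<mu> i)) * indicator (J i) s) \<partial>lborel)"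
    by (rule nn_integral_sum[symmetric]) (simp add: J_def)
  also have "\<dots> \<le> (\<integral>\<^sup>+ s \<in> {0<..}. epowr (ennreal (s powr (1 / p)) * rearrangement G s) r / ennreal s \<partial>lborel)"
  proof (intro nn_integral_mono)
    fix s :: real
    show "(\<Sum>i\<in>I. ennreal (\<kappa> powr r / (V * \<mu> i)) * indicator (J i) s)
        \<le> epowr (ennreal (s powr (1 / p)) * rearrangement G s) r / ennreal s * indicator {0<..} s"
    proof (cases "\<exists>i\<in>I. s \<in> J i")
      case True
      then obtain i where i: "i \<in> I" "s \<in> J i" by blast
      have "0 < V * \<mu> i / \<Lambda>" using V mu[of i] L by simp
      then have s: "0 < s" "s \<le> V * \<mu> i" using i(2) by (auto simp: J_def)
      have "s \<notin> J j" if "j \<noteq> i" for j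
        using disj i(2) that by (auto simp: disjoint_family_on_def)
      then have "(\<Sum>j\<in>I. ennreal (\<kappa> powr r / (V * \<mu> j)) * indicator (J j) s) = (\<Sum>j\<in>I. if j = i then ennreal (\<kappa> powr r / (V * \<mu> i)) else 0)"
        using i by (intro sum.cong) auto
      also have "\<dots> = ennreal (\<kappa> powr r / (V * \<mu> i))" using I i by simp
      also have "\<dots> \<le> ennreal (\<kappa> powr r / s)"
        using s by (intro ennreal_leI divide_left_mono) auto
      also have "\<dots> = epowr (ennreal \<kappa>) r / ennreal s"
        using s \<kappa> by (simp add: divide_ennreal epowr_ennreal)
      also have "\<dots> \<le> epowr (ennreal (s powr (1 / p)) * rearrangement G s) r / ennreal s"
        using r by (intro divide_right_mono_ennreal epowr_mono re[OF i]) auto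
      finally show ?thesis using s by simp
    next
      case False
      then have "(\<Sum>i\<in>I. ennreal (\<kappa> powr r / (V * \<mu> i)) * indicator (J i) s) = 0" by (intro sum.neutral) auto
      then show ?thesis by simp
    qed
  qed
  finally have "epowr (ennreal (\<kappa> powr r * (1 - 1 / \<Lambda>) * real (card I))) (1 / r) \<le>
     epowr (\<integral>\<^sup>+ s \<in> {0<..}. epowr (ennreal (s powr (1 / p)) * rearrangement G s) r / ennreal s \<partial>lborel) (1 / r)"
    by (rule epowr_mono) (use r in simp)
  moreover have "epowr (ennreal (\<kappa> powr r * (1 - 1 / \<Lambda>) * real (card I))) (1 / r) =
      ennreal (\<kappa> * (1 - 1 / \<Lambda>) powr (1 / r) * real (card I) powr (1 / r))"
  proof -
    have "0 \<le> \<kappa> powr r * (1 - 1 / \<Lambda>) * real (card I)" using L by simp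
    moreover have "(\<kappa> powr r * (1 - 1 / \<Lambda>) * real (card I)) powr (1 / r) = \<kappa> * (1 - 1 / \<Lambda>) powr (1 / r) * real (card I) powr (1 / r)"
      unfolding powr_mult powr_powr using \<kappa> r by simp
    ultimately show ?thesis by (simp only: epowr_ennreal)
  qed
  moreover have e: "enn2real (ennreal r) = r" "ennreal r \<noteq> \<infinity>" using r by auto
  ultimately show ?thesis unfolding lorentz_norm_def if_not_P[OF e(2)] e(1) \<kappa>_def by simp
qed

lemma summation_exponent_less:
  assumes r01: "1 \<le> r0" "1 \<le> r1" and th: "0 < \<theta>" "\<theta> < 1"
    and rs: "1 / rstar = ennreal (1 - \<theta>) / r0 + ennreal \<theta> / r1"
    and r: "1 \<le> r" and less: "r < rstar"
  shows "r \<noteq> \<infinity>"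
    and "(1 - \<theta>) * (1 / enn2real r0) + \<theta> * (1 / enn2real r1) < 1 / enn2real r"
proof -
  let ?k0 = "1 / enn2real r0" and ?k1 = "1 / enn2real r1"
  define v where "v = (1 - \<theta>) * ?k0 + \<theta> * ?k1"
  have v0: "0 \<le> v" unfolding v_def using th by simp
  have rv: "1 / rstar = ennreal v"
    unfolding rs v_def by (rule interpolated_reciprocal[OF r01 th])
  show rfin: "r \<noteq> \<infinity>" using less by auto
  define s where "s = enn2real r"
  have s: "1 \<le> s" "r = ennreal s"
    using enn2real_ge_1[OF r rfin] rfin by (simp_all add: s_def less_top)
  show "v < 1 / enn2real r"
  proof (cases "rstar = \<infinity>")
    case True
    then have "ennreal v = 0" using rv by simp
    then show ?thesis using v0 s(1) by (simp add: s_def)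
  next
    case False
    define t where "t = enn2real rstar"
    have t: "rstar = ennreal t" "0 \<le> t" using False by (simp_all add: t_def less_top)
    have st: "s < t" using less s t by (simp add: ennreal_less_iff)
    have "1 / rstar = ennreal (1 / t)" using divide_ennreal[of 1 t] st s(1) t(1) by simp
    then have "v = 1 / t" using rv v0 t by simp
    also have "\<dots> < 1 / s" using st s(1) by (intro divide_strict_left_mono) auto
    finally show ?thesis by (simp add: s_def)
  qed
qed

text \<open>Two or more scales away, the rescaled point has norm at least 3/4 * 4 = 3 or at most 5/4
  * 1/4 = 5/16, hence lies outside the support of \<psi>.\<close>

lemma lp_psi_zero_off_annulus:
  assumes phi: "lp_cutoff \<phi>"
    and xi: "3 / 4 * 2 powr real_of_int j \<le> norm \<xi>" "norm \<xi> \<le> 5 / 4 * 2 powr real_of_int j"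
    and k: "k \<le> j - 2 \<or> j + 2 \<le> k"
  shows "lp_psi \<phi> (2 powr (- real_of_int k) *\<^sub>R \<xi>) = 0"
proof (rule lp_psi_support[OF phi])
  have nz: "norm (2 powr (- real_of_int k) *\<^sub>R \<xi>) = norm \<xi> * 2 powr (- real_of_int k)" by simp
  have e: "a * 2 powr real_of_int j * 2 powr (- real_of_int k) = a * 2 powr (real_of_int j - real_of_int k)" for a
    unfolding mult.assoc powr_add[symmetric] by simp
  have lo: "3 / 4 * 2 powr (real_of_int j - real_of_int k) \<le> norm \<xi> * 2 powr (- real_of_int k)"
    using mult_right_mono[OF xi(1), of "2 powr (- real_of_int k)"] unfolding e by simp
  have hi: "norm \<xi> * 2 powr (- real_of_int k) \<le> 5 / 4 * 2 powr (real_of_int j - real_of_int k)"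
    using mult_right_mono[OF xi(2), of "2 powr (- real_of_int k)"] unfolding e by simp
  show "norm (2 powr (- real_of_int k) *\<^sub>R \<xi>) \<le> 1 / 2 \<or> 2 \<le> norm (2 powr (- real_of_int k) *\<^sub>R \<xi>)"
    using k
  proof
    assume "k \<le> j - 2"
    then have "2 powr 2 \<le> 2 powr (real_of_int j - real_of_int k)" by (intro powr_mono) auto
    then have "4 \<le> 2 powr (real_of_int j - real_of_int k)" by simp
    then show ?thesis unfolding nz using lo by linarith
  next
    assume "j + 2 \<le> k"
    then have "2 powr (real_of_int j - real_of_int k) \<le> 2 powr (-2)" by (intro powr_mono) auto
    moreover have "2 powr (-2) = (1 / 4 :: real)" by (simp add: powr_minus)
    ultimately show ?thesis unfolding nz using hi by linarith
  qed
qed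

lemma osc_packet_integrable:
  fixes \<phi> :: "'a::euclidean_space \<Rightarrow> real"
  assumes phi: "lp_cutoff \<phi>" and R: "0 < R"
  shows "integrable lborel (osc 1 (packet \<phi> h R a w))"
proof -
  let ?\<eta> = "osc 1 (\<lambda>\<zeta>. complex_of_real (\<phi> \<zeta>))"
  have i: "integrable lborel (\<lambda>x. complex_of_real (\<phi> x))"
    using lp_cutoff_integrable[OF phi] by simp
  have [measurable]: "?\<eta> \<in> borel_measurable borel" by (rule borel_measurable_osc[OF i])
  obtain C where C: "0 \<le> C" "\<And>\<xi>. norm (?\<eta> \<xi>) \<le> C / (1 + norm \<xi>) ^ (2 * DIM('a))"
    by (rule lp_cutoff_osc_decay[OF phi]) auto
  have wi: "integrable lborel (\<lambda>x::'a. C * (1 / (1 + norm x) ^ (2 * DIM('a))))"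
    by (intro integrable_mult_right integrable_inverse_power_norm) simp
  have \<eta>i: "integrable lborel ?\<eta>"
    by (rule Bochner_Integration.integrable_bound[OF wi]) (use C in auto)
  have "integrable lborel (\<lambda>x. ?\<eta> (- (a /\<^sub>R R) + (1 / R) *\<^sub>R x))"
    using R by (intro integrable_lborel_affine[OF \<eta>i]) simp
  moreover have "- (a /\<^sub>R R) + (1 / R) *\<^sub>R x = (x - a) /\<^sub>R R" for x
    by (simp add: inverse_eq_divide scaleR_diff_right)
  ultimately have "integrable lborel (\<lambda>x. ?\<eta> ((x - a) /\<^sub>R R))" by simp
  then have "integrable lborel (\<lambda>x. cis (w \<bullet> x) * ?\<eta> ((x - a) /\<^sub>R R))"
    by (rule integrable_cis_mult) measurable
  then have "integrable lborel (\<lambda>x. complex_of_real h * (cis (w \<bullet> x) * ?\<eta> ((x - a) /\<^sub>R R)))"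
    by (rule integrable_mult_right)
  then show ?thesis unfolding osc_packet[OF phi R, abs_def] by (simp only: mult.assoc)
qed

lemma osc_sum:
  assumes "\<And>i. i \<in> I \<Longrightarrow> integrable lborel (P i)"
  shows "osc \<sigma> (\<lambda>\<xi>. \<Sum>i\<in>I. P i \<xi>) x = (\<Sum>i\<in>I. osc \<sigma> (P i) x)"
proof -
  have "(LINT \<xi>|lborel. (\<Sum>i\<in>I. cis (\<sigma> * (\<xi> \<bullet> x)) * P i \<xi>)) = (\<Sum>i\<in>I. (LINT \<xi>|lborel. cis (\<sigma> * (\<xi> \<bullet> x)) * P i \<xi>))"
    by (rule Bochner_Integration.integral_sum) (intro integrable_cis_mult assms, assumption, measurable)
  then show ?thesis unfolding osc_def by (simp only: sum_distrib_left)
qed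

lemma tempered_integral:
  fixes f :: "'a::euclidean_space \<Rightarrow> complex"
  assumes f: "integrable lborel f"
  shows "tempered (\<lambda>v. LINT x|lborel. f x * v x)" and "represents f (\<lambda>v. LINT x|lborel. f x * v x)"
proof -
  have [measurable]: "f \<in> borel_measurable borel" using f by (auto dest: borel_measurable_integrable)
  have i: "integrable lborel (\<lambda>x. f x * v x)" if v: "v \<in> schwartz" for v
  proof -
    have [measurable]: "v \<in> borel_measurable borel" by (rule schwartz_measurable[OF v])
    obtain M where M: "0 \<le> M" "\<And>x. norm (v x) \<le> M" by (rule schwartz_bounded[OF v]) auto
    show ?thesis
    proof (rule Bochner_Integration.integrable_bound)
      show "integrable lborel (\<lambda>x. M * norm (f x))" using f by simp
      show "AE x in lborel. norm (f x * v x) \<le> norm (M * norm (f x))"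
        unfolding norm_mult using mult_left_mono[OF M(2) norm_ge_zero] M(1) by (intro AE_I2) (simp add: mult.commute)
    qed measurable
  qed
  show "represents f (\<lambda>v. LINT x|lborel. f x * v x)" unfolding represents_def using i by simp
  define C where "C = (LINT x|lborel. norm (f x))"
  have C: "0 \<le> C" by (simp add: C_def)
  have "ennreal (norm (LINT x|lborel. f x * v x)) \<le> ennreal C * schwartz_seminorm 0 v" if v: "v \<in> schwartz" for v
  proof -
    have fin: "schwartz_seminorm 0 v < \<infinity>" using v by (simp add: schwartz_def)
    define S where "S = enn2real (schwartz_seminorm 0 v)"
    have S: "schwartz_seminorm 0 v = ennreal S" "0 \<le> S" using fin by (simp_all add: S_def)
    have vS: "norm (v x) \<le> S" for x using schwartz_seminorm_ge[of x 0 v] S by simp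
    have "norm (LINT x|lborel. f x * v x) \<le> (LINT x|lborel. norm (f x * v x))" by (rule integral_norm_bound)
    also have "\<dots> \<le> (LINT x|lborel. norm (f x) * S)"
    proof (rule integral_mono)
      show "integrable lborel (\<lambda>x. norm (f x * v x))" by (rule integrable_norm[OF i[OF v]])
      show "integrable lborel (\<lambda>x. norm (f x) * S)" using f by simp
      show "norm (f x * v x) \<le> norm (f x) * S" for x unfolding norm_mult by (rule mult_left_mono[OF vS]) simp
    qed
    also have "\<dots> = C * S" by (simp add: C_def)
    finally show ?thesis unfolding S(1) using C S(2) by (simp add: ennreal_mult[symmetric] ennreal_leI)
  qed
  moreover have "(LINT x|lborel. f x * (v x + w x)) = (LINT x|lborel. f x * v x) + (LINT x|lborel. f x * w x)"
    if "v \<in> schwartz" "w \<in> schwartz" for v w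
    unfolding distrib_left by (rule Bochner_Integration.integral_add[OF i[OF that(1)] i[OF that(2)]])
  moreover have "(LINT x|lborel. f x * (c * v x)) = c * (LINT x|lborel. f x * v x)" for c v
    unfolding mult.left_commute[of "f _" c] by (rule integral_mult_right_zero)
  ultimately show "tempered (\<lambda>v. LINT x|lborel. f x * v x)" unfolding tempered_def by blast
qed

lemma dist_Lq_norm_le: "represents g u \<Longrightarrow> dist_Lq_norm q u \<le> Lq_norm q g"
  unfolding dist_Lq_norm_def by (rule INF_lower) simp

section \<open>Superposition of wave packets\<close>

text \<open>For R >= 1 the packet lives within distance 1 of its centre, and j >= 2 makes this at
  most a quarter of the centre's norm.\<close>

lemma packet_annulus:
  fixes e :: "'a::euclidean_space"
  assumes phi: "lp_cutoff \<phi>" and R: "1 \<le> R" and e: "norm e = 1" and j: "2 \<le> j"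
    and nz: "packet \<phi> h R a (2 powr real_of_int j *\<^sub>R e) \<xi> \<noteq> 0"
  shows "3 / 4 * 2 powr real_of_int j \<le> norm \<xi>" "norm \<xi> \<le> 5 / 4 * 2 powr real_of_int j"
proof -
  let ?w = "2 powr real_of_int j *\<^sub>R e"
  have w: "norm ?w = 2 powr real_of_int j" using e by simp
  have "2 powr 2 \<le> 2 powr real_of_int j" using j by (intro powr_mono) auto
  then have j4: "4 \<le> 2 powr real_of_int j" by simp
  have R0: "0 < R" using R by simp
  have "norm (\<xi> - ?w) < 1 / R" using packet_zero[OF phi R0, of \<xi> ?w h a] nz by fastforce
  also have "1 / R \<le> 1" using R by simp
  finally have d: "norm (\<xi> - ?w) < 1" .
  show "3 / 4 * 2 powr real_of_int j \<le> norm \<xi>"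
    using norm_triangle_ineq2[of ?w \<xi>] d j4 unfolding w norm_minus_commute[of ?w \<xi>] by linarith
  show "norm \<xi> \<le> 5 / 4 * 2 powr real_of_int j"
    using norm_triangle_ineq2[of \<xi> ?w] d j4 unfolding w by linarith
qed

text \<open>With frequencies spaced by a factor \<open>8\<close>, each dyadic block meets at most one packet.\<close>

definition packet_sum :: "('a::euclidean_space \<Rightarrow> real) \<Rightarrow> 'a \<Rightarrow> nat \<Rightarrow> (nat \<Rightarrow> real) \<Rightarrow> (nat \<Rightarrow> real) \<Rightarrow> (nat \<Rightarrow> 'a) \<Rightarrow> 'a \<Rightarrow> complex"
  where "packet_sum \<phi> e N h R a \<xi> =
    (\<Sum>i\<in>{1..N}. packet \<phi> (h i) (R i) (a i) (2 powr real_of_int (3 * int i) *\<^sub>R e) \<xi>)"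

lemma
  fixes \<phi> :: "'a::euclidean_space \<Rightarrow> real"
  assumes phi: "lp_cutoff \<phi>" and e: "norm e = 1" and R: "\<And>i. 1 \<le> R i"
  shows packet_sum_continuous: "continuous_on UNIV (packet_sum \<phi> e N h R a)"
    and packet_sum_integrable: "integrable lborel (packet_sum \<phi> e N h R a)"
    and packet_sum_bounded: "\<exists>B. \<forall>\<xi>. norm (packet_sum \<phi> e N h R a \<xi>) \<le> B"
    and osc_packet_sum: "osc 1 (packet_sum \<phi> e N h R a) x =
      (\<Sum>i\<in>{1..N}. osc 1 (packet \<phi> (h i) (R i) (a i) (2 powr real_of_int (3 * int i) *\<^sub>R e)) x)"
    and osc_packet_sum_integrable: "integrable lborel (osc 1 (packet_sum \<phi> e N h R a))"
proof -
  let ?P = "\<lambda>i. packet \<phi> (h i) (R i) (a i) (2 powr real_of_int (3 * int i) *\<^sub>R e)"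
  have R0: "0 < R i" for i using R[of i] by simp
  show "continuous_on UNIV (packet_sum \<phi> e N h R a)"
    unfolding packet_sum_def[abs_def] by (intro continuous_on_sum packet_continuous phi)
  have Pi: "integrable lborel (?P i)" for i by (rule packet_integrable[OF phi R0])
  show "integrable lborel (packet_sum \<phi> e N h R a)"
    unfolding packet_sum_def[abs_def] by (intro Bochner_Integration.integrable_sum Pi)
  have "\<exists>B. \<forall>\<xi>. norm (?P i \<xi>) \<le> B" for i
    using continuous_compact_support_bounded[OF packet_continuous[OF phi], of _ "h i" "R i" "a i" "2 powr real_of_int (3 * int i) *\<^sub>R e"]
      packet_compact_support[OF phi R0[of i]] by metis
  then obtain B where B: "\<And>i \<xi>. norm (?P i \<xi>) \<le> B i" by metis
  show "\<exists>B. \<forall>\<xi>. norm (packet_sum \<phi> e N h R a \<xi>) \<le> B"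
    unfolding packet_sum_def by (intro exI[of _ "\<Sum>i\<in>{1..N}. B i"] allI sum_norm_le B)
  have s: "osc 1 (packet_sum \<phi> e N h R a) = (\<lambda>x. \<Sum>i\<in>{1..N}. osc 1 (?P i) x)"
    unfolding packet_sum_def[abs_def] by (intro ext osc_sum Pi)
  then show "osc 1 (packet_sum \<phi> e N h R a) x = (\<Sum>i\<in>{1..N}. osc 1 (?P i) x)" by simp
  show "integrable lborel (osc 1 (packet_sum \<phi> e N h R a))"
    unfolding s by (intro Bochner_Integration.integrable_sum osc_packet_integrable phi R0)
qed

text \<open>Packet i is seen exactly by the indices 3 i - 1, 3 i, 3 i + 1 at most. For i from 1 to N
  these triples tile the range 2 to 3 N + 1, and on each packet the three multipliers sum to
  1.\<close>

lemma multiplier_packet_sum: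
  fixes \<phi> :: "'a::euclidean_space \<Rightarrow> real"
  assumes phi: "lp_cutoff \<phi>" and e: "norm e = 1" and R: "\<And>i. 1 \<le> R i"
  defines "m \<equiv> \<lambda>k \<xi>. complex_of_real (lp_psi \<phi> (2 powr (- real_of_int k) *\<^sub>R \<xi>))"
  shows "\<And>k. k \<notin> {2..3 * int N + 1} \<Longrightarrow> m k \<xi> * packet_sum \<phi> e N h R a \<xi> = 0"
    and "\<And>k i. i \<in> {1..N} \<Longrightarrow> \<bar>k - 3 * int i\<bar> \<le> 1 \<Longrightarrow> m k \<xi> * packet_sum \<phi> e N h R a \<xi> =
        m k \<xi> * packet \<phi> (h i) (R i) (a i) (2 powr real_of_int (3 * int i) *\<^sub>R e) \<xi>"
    and "(\<Sum>k\<in>{2..3 * int N + 1}. m k \<xi> * packet_sum \<phi> e N h R a \<xi>) = packet_sum \<phi> e N h R a \<xi>"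
proof -
  let ?P = "\<lambda>i. packet \<phi> (h i) (R i) (a i) (2 powr real_of_int (3 * int i) *\<^sub>R e)"
  have z: "m k \<xi> * ?P i \<xi> = 0" if i: "i \<in> {1..N}" and k: "\<not> \<bar>k - 3 * int i\<bar> \<le> 1" for k i
  proof (cases "?P i \<xi> = 0")
    case False
    have j: "2 \<le> 3 * int i" using i by simp
    have "lp_psi \<phi> (2 powr (- real_of_int k) *\<^sub>R \<xi>) = 0"
      by (rule lp_psi_zero_off_annulus[OF phi packet_annulus[OF phi R e j False]]) (use k in linarith)
    then show ?thesis by (simp add: m_def)
  qed simp
  show 1: "m k \<xi> * packet_sum \<phi> e N h R a \<xi> = 0" if "k \<notin> {2..3 * int N + 1}" for k
    unfolding packet_sum_def sum_distrib_left
  proof (rule sum.neutral, rule ballI)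
    fix i assume i: "i \<in> {1..N}"
    then have "1 \<le> int i" "int i \<le> int N" by auto
    then have "\<not> \<bar>k - 3 * int i\<bar> \<le> 1" using that by auto
    then show "m k \<xi> * ?P i \<xi> = 0" by (rule z[OF i])
  qed
  show 2: "m k \<xi> * packet_sum \<phi> e N h R a \<xi> = m k \<xi> * ?P i \<xi>"
    if i: "i \<in> {1..N}" and k: "\<bar>k - 3 * int i\<bar> \<le> 1" for k i
  proof -
    have "m k \<xi> * packet_sum \<phi> e N h R a \<xi> = (\<Sum>l\<in>{1..N}. m k \<xi> * ?P l \<xi>)"
      unfolding packet_sum_def sum_distrib_left ..
    also have "\<dots> = (\<Sum>l\<in>{1..N}. if l = i then m k \<xi> * ?P i \<xi> else 0)"
    proof (rule sum.cong[OF refl])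
      fix l assume l: "l \<in> {1..N}"
      show "m k \<xi> * ?P l \<xi> = (if l = i then m k \<xi> * ?P i \<xi> else 0)"
      proof (cases "l = i")
        case False
        then have nk: "\<not> \<bar>k - 3 * int l\<bar> \<le> 1" using k by linarith
        show ?thesis using z[OF l nk] False by simp
      qed simp
    qed
    also have "\<dots> = m k \<xi> * ?P i \<xi>" using i by simp
    finally show ?thesis .
  qed
  have "(\<Sum>k\<in>{2..3 * int N + 1}. m k \<xi> * ?P i \<xi>) = ?P i \<xi>" if i: "i \<in> {1..N}" for i
  proof (cases "?P i \<xi> = 0")
    case False
    have j: "2 \<le> 3 * int i" using i by simp
    let ?T = "{3 * int i - 1, 3 * int i, 3 * int i + 1}"
    have "1 \<le> int i" "int i \<le> int N" using i by auto
    then have sub: "?T \<subseteq> {2..3 * int N + 1}" by auto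
    have "(\<Sum>k\<in>{2..3 * int N + 1}. m k \<xi> * ?P i \<xi>) = (\<Sum>k\<in>?T. m k \<xi> * ?P i \<xi>)"
    proof (rule sum.mono_neutral_right[OF _ sub], simp, rule ballI)
      fix k assume "k \<in> {2..3 * int N + 1} - ?T"
      then have "\<not> \<bar>k - 3 * int i\<bar> \<le> 1" by auto
      then show "m k \<xi> * ?P i \<xi> = 0" by (rule z[OF i])
    qed
    also have "\<dots> = (m (3 * int i - 1) \<xi> + m (3 * int i) \<xi> + m (3 * int i + 1) \<xi>) * ?P i \<xi>"
      by (simp add: distrib_right)
    also have "m (3 * int i - 1) \<xi> + m (3 * int i) \<xi> + m (3 * int i + 1) \<xi> = 1"
      using lp_psi_sum[OF phi packet_annulus[OF phi R e j False]]
      unfolding m_def of_real_add[symmetric] by (simp only: of_real_1)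
    finally show ?thesis by simp
  qed simp
  then have "(\<Sum>i\<in>{1..N}. \<Sum>k\<in>{2..3 * int N + 1}. m k \<xi> * ?P i \<xi>) = (\<Sum>i\<in>{1..N}. ?P i \<xi>)"
    by (rule sum.cong[OF refl])
  moreover have "(\<Sum>k\<in>{2..3 * int N + 1}. m k \<xi> * packet_sum \<phi> e N h R a \<xi>) = (\<Sum>i\<in>{1..N}. \<Sum>k\<in>{2..3 * int N + 1}. m k \<xi> * ?P i \<xi>)"
    unfolding packet_sum_def sum_distrib_left by (rule sum.swap)
  ultimately show "(\<Sum>k\<in>{2..3 * int N + 1}. m k \<xi> * packet_sum \<phi> e N h R a \<xi>) = packet_sum \<phi> e N h R a \<xi>"
    by (simp only: packet_sum_def)
qed

text \<open>The constants C and W enter as parameters, so that the block bounds do not deteriorate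
  with the number N of packets.\<close>

lemma
  fixes \<phi> :: "'a::euclidean_space \<Rightarrow> real" and e :: 'a and N :: nat and a :: "nat \<Rightarrow> 'a"
  assumes phi: "lp_cutoff \<phi>" and e: "norm e = 1" and R: "\<And>i. 1 \<le> R i" and h: "\<And>i. 0 \<le> h i"
    and C: "0 \<le> C" "\<And>h R \<epsilon> a w x. 0 \<le> h \<Longrightarrow> 0 < R \<Longrightarrow> 0 \<le> \<epsilon> \<Longrightarrow> \<epsilon> \<le> R \<Longrightarrow>
      norm (osc 1 (\<lambda>\<xi>. complex_of_real (lp_psi \<phi> (\<epsilon> *\<^sub>R \<xi>)) * packet \<phi> h R a w \<xi>) x)
        \<le> h * C / (1 + norm (x - a) / R) ^ (2 * DIM('a))"
    and W: "1 \<le> W" "(LINT x::'a|lborel. 1 / (1 + norm x) ^ (2 * DIM('a))) \<le> W"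
  defines "u \<equiv> \<lambda>v. LINT x|lborel. osc 1 (packet_sum \<phi> e N h R a) x * v x"
  shows packet_sum_block_norm: "\<And>k i q. i \<in> {1..N} \<Longrightarrow> \<bar>k - 3 * int i\<bar> \<le> 1 \<Longrightarrow> 1 \<le> q \<Longrightarrow>
      dist_Lq_norm q (dyadic_block \<phi> k u) \<le> ennreal (h i * C * W * (R i ^ DIM('a)) powr (1 / enn2real q))"
    and packet_sum_block_zero: "\<And>k q. k \<notin> {2..3 * int N + 1} \<Longrightarrow> 1 \<le> q \<Longrightarrow> dist_Lq_norm q (dyadic_block \<phi> k u) = 0"
    and packet_sum_reproduced: "\<And>f. f \<in> schwartz \<Longrightarrow> ((\<lambda>k. dyadic_block \<phi> k u f) has_sum u f) UNIV"
proof -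
  let ?F = "packet_sum \<phi> e N h R a"
  define m where "m k \<xi> = complex_of_real (lp_psi \<phi> (2 powr (- real_of_int k) *\<^sub>R \<xi>))" for k \<xi>
  have R0: "0 < R i" for i using R[of i] by simp
  have Fi: "integrable lborel ?F" by (rule packet_sum_integrable[OF phi e R])
  have Fc: "continuous_on UNIV ?F" by (rule packet_sum_continuous[OF phi e R])
  obtain B where B: "\<And>\<xi>. norm (?F \<xi>) \<le> B" using packet_sum_bounded[where R=R and h=h and a=a and N=N, OF phi e R] by blast
  have oi: "integrable lborel (osc 1 ?F)" by (rule osc_packet_sum_integrable[OF phi e R])
  have rep: "represents (osc 1 (\<lambda>\<xi>. m k \<xi> * ?F \<xi>)) (dyadic_block \<phi> k u)" for k
    unfolding u_def m_def by (rule dyadic_block_of_osc[OF phi Fi Fc B oi])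
  have m1: "m k \<xi> * ?F \<xi> = 0" if "k \<notin> {2..3 * int N + 1}" for k \<xi>
    unfolding m_def by (rule multiplier_packet_sum(1)[OF phi e R that])
  have m2: "m k \<xi> * ?F \<xi> = m k \<xi> * packet \<phi> (h i) (R i) (a i) (2 powr real_of_int (3 * int i) *\<^sub>R e) \<xi>"
    if "i \<in> {1..N}" "\<bar>k - 3 * int i\<bar> \<le> 1" for k i \<xi>
    unfolding m_def by (rule multiplier_packet_sum(2)[OF phi e R that])
  have m3: "(\<Sum>k\<in>{2..3 * int N + 1}. m k \<xi> * ?F \<xi>) = ?F \<xi>" for \<xi>
    unfolding m_def by (rule multiplier_packet_sum(3)[OF phi e R])
  have osc0: "osc 1 (\<lambda>\<xi>. m k \<xi> * ?F \<xi>) x = 0" if "k \<notin> {2..3 * int N + 1}" for k x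
    unfolding m1[OF that] osc_def by simp
  have mPi: "integrable lborel (\<lambda>\<xi>. m k \<xi> * ?F \<xi>)" for k
  proof (cases "k \<in> {2..3 * int N + 1}")
    case True
    have mc: "continuous_on UNIV (m k)"
      unfolding m_def by (intro continuous_intros continuous_on_compose2[OF lp_psi_continuous[OF phi]]) auto
    \<comment> \<open>A crude support radius: the sum of all N packet radii bounds each of
      them.\<close>
    define r where "r = (\<Sum>i\<in>{1..N}. norm (2 powr real_of_int (3 * int i) *\<^sub>R e) + 1 / R i)"
    show ?thesis
    proof (rule continuous_compact_support_integrable[where r=r])
      show "continuous_on UNIV (\<lambda>\<xi>. m k \<xi> * ?F \<xi>)" by (intro continuous_on_mult mc Fc)
      fix \<xi> :: 'a assume r: "r \<le> norm \<xi>"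
      have "?F \<xi> = 0"
        unfolding packet_sum_def
      proof (rule sum.neutral, rule ballI)
        fix i assume i: "i \<in> {1..N}"
        have "norm (2 powr real_of_int (3 * int i) *\<^sub>R e) + 1 / R i \<le> r"
          unfolding r_def using less_imp_le[OF R0] by (intro member_le_sum[OF i]) (auto intro!: add_nonneg_nonneg)
        then show "packet \<phi> (h i) (R i) (a i) (2 powr real_of_int (3 * int i) *\<^sub>R e) \<xi> = 0"
          using r by (intro packet_compact_support[OF phi R0]) simp
      qed
      then show "m k \<xi> * ?F \<xi> = 0" by simp
    qed
  qed (simp add: m1)
  show "dist_Lq_norm q (dyadic_block \<phi> k u) \<le> ennreal (h i * C * W * (R i ^ DIM('a)) powr (1 / enn2real q))"
    if i: "i \<in> {1..N}" and k: "\<bar>k - 3 * int i\<bar> \<le> 1" and q: "1 \<le> q" for k i q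
  proof (rule order_trans[OF dist_Lq_norm_le[OF rep]])
    \<comment> \<open>All indices involved are nonnegative, so 2^(-k) <= 1 <= R i, the width
      condition of \<open>multiplier_packet_bound\<close>.\<close>
    have "1 \<le> int i" using i by simp
    then have k0: "0 \<le> k" using k by linarith
    have "2 powr (- real_of_int k) \<le> 2 powr 0" using k0 by (intro powr_mono) auto
    then have eps: "2 powr (- real_of_int k) \<le> R i" using R[of i] by simp
    show "Lq_norm q (osc 1 (\<lambda>\<xi>. m k \<xi> * ?F \<xi>)) \<le> ennreal (h i * C * W * (R i ^ DIM('a)) powr (1 / enn2real q))"
    proof (rule Lq_norm_envelope[OF borel_measurable_osc[OF mPi] q R0 _ _ W])
      show "0 \<le> h i * C" using h C(1) by simp
      show "norm (osc 1 (\<lambda>\<xi>. m k \<xi> * ?F \<xi>) x) \<le> h i * C / (1 + norm (x - a i) / R i) ^ (2 * DIM('a))" for x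
        unfolding m2[OF i k] unfolding m_def by (rule C(2)[OF h R0 _ eps]) simp
    qed
  qed
  show "dist_Lq_norm q (dyadic_block \<phi> k u) = 0" if k: "k \<notin> {2..3 * int N + 1}" and q: "1 \<le> q" for k q
  proof -
    have "Lq_norm q (osc 1 (\<lambda>\<xi>. m k \<xi> * ?F \<xi>)) \<le> ennreal (0 * W * (1 ^ DIM('a)) powr (1 / enn2real q))"
      by (rule Lq_norm_envelope[where R=1 and H=0 and a=0, OF borel_measurable_osc[OF mPi] q _ _ _ W])
         (simp_all add: osc0[OF k])
    then show ?thesis using dist_Lq_norm_le[OF rep, of q k] by simp
  qed
  show "((\<lambda>k. dyadic_block \<phi> k u f) has_sum u f) UNIV" if f: "f \<in> schwartz" for f
  proof (rule has_sum_finite_neutralI[of "{2..3 * int N + 1}"])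
    have bl: "dyadic_block \<phi> k u f = (LINT x|lborel. osc 1 (\<lambda>\<xi>. m k \<xi> * ?F \<xi>) x * f x)"
      "integrable lborel (\<lambda>x. osc 1 (\<lambda>\<xi>. m k \<xi> * ?F \<xi>) x * f x)" for k
      using rep[of k] f by (simp_all add: represents_def)
    show "dyadic_block \<phi> k u f = 0" if "k \<in> UNIV - {2..3 * int N + 1}" for k
      using that unfolding bl by (simp add: osc0)
    have "(\<Sum>k\<in>{2..3 * int N + 1}. dyadic_block \<phi> k u f) = (LINT x|lborel. (\<Sum>k\<in>{2..3 * int N + 1}. osc 1 (\<lambda>\<xi>. m k \<xi> * ?F \<xi>) x * f x))"
      unfolding bl(1) by (rule Bochner_Integration.integral_sum[symmetric]) (rule bl(2))
    also have "(\<lambda>x. \<Sum>k\<in>{2..3 * int N + 1}. osc 1 (\<lambda>\<xi>. m k \<xi> * ?F \<xi>) x * f x) = (\<lambda>x. osc 1 ?F x * f x)"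
    proof
      fix x
      have "osc 1 ?F x = osc 1 (\<lambda>\<xi>. \<Sum>k\<in>{2..3 * int N + 1}. m k \<xi> * ?F \<xi>) x" unfolding m3 ..
      also have "\<dots> = (\<Sum>k\<in>{2..3 * int N + 1}. osc 1 (\<lambda>\<xi>. m k \<xi> * ?F \<xi>) x)" by (rule osc_sum) (rule mPi)
      finally show "(\<Sum>k\<in>{2..3 * int N + 1}. osc 1 (\<lambda>\<xi>. m k \<xi> * ?F \<xi>) x * f x) = osc 1 ?F x * f x"
        by (simp only: sum_distrib_right)
    qed
    finally show "u f = (\<Sum>k\<in>{2..3 * int N + 1}. dyadic_block \<phi> k u f)" by (simp only: u_def)
  qed auto
qed

text \<open>The centres lie on a line with spacing S. Near its centre packet i contributes at least
  2 c h i, while S is so large that the tails of all others together contribute at most c h i.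
  First-order decay of the profile is enough for this.\<close>

lemma separated_packets_lower_bound:
  fixes \<phi> :: "'a::euclidean_space \<Rightarrow> real" and e :: 'a
  assumes phi: "lp_cutoff \<phi>" and e: "norm e = 1" and R: "\<And>i. 1 \<le> R i" and h: "\<And>i. 0 < h i" and N: "1 \<le> N"
    and C: "0 \<le> C" "\<And>\<xi>. norm (osc 1 (\<lambda>x. complex_of_real (\<phi> x)) \<xi>) \<le> C / (1 + norm \<xi>) ^ 1"
    and c: "0 < c" "2 * c \<le> cos 1 * (LINT x|lborel. \<phi> x)"
  obtains a where "\<And>i x. i \<in> {1..N} \<Longrightarrow> norm (x - a i) \<le> R i \<Longrightarrow>
      c * h i \<le> norm (osc 1 (packet_sum \<phi> e N h R a) x)"
proof -
  have R0: "0 < R i" for i using R[of i] by simp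
  \<comment> \<open>The distance beyond which the tail of packet l is below the share c h i /
    N.\<close>
  define Q where "Q i l = real N * (h l * C * R l) / (c * h i)" for i l
  have Q0: "0 \<le> Q i l" for i l using c C(1) h[of i] h[of l] R0[of l] by (simp add: Q_def)
  \<comment> \<open>The final 1 keeps x strictly away from the other centres, because the tail bound
    divides by that distance.\<close>
  define S where "S = (\<Sum>i\<in>{1..N}. R i + (\<Sum>l\<in>{1..N}. Q i l)) + 1"
  have S: "R i + Q i l + 1 \<le> S" if i: "i \<in> {1..N}" and l: "l \<in> {1..N}" for i l
  proof -
    have "Q i l \<le> (\<Sum>l\<in>{1..N}. Q i l)" using Q0 l by (intro member_le_sum[of l]) auto
    then have "R i + Q i l \<le> R i + (\<Sum>l\<in>{1..N}. Q i l)" by simp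
    also have "\<dots> \<le> (\<Sum>i\<in>{1..N}. R i + (\<Sum>l\<in>{1..N}. Q i l))"
      using Q0 less_imp_le[OF R0] i by (intro member_le_sum[of i]) (auto intro!: add_nonneg_nonneg sum_nonneg)
    finally show ?thesis by (simp add: S_def)
  qed
  have S0: "0 \<le> S" using S[of 1 1] N R0[of 1] Q0[of 1 1] by simp
  define a where "a i = (S * real i) *\<^sub>R e" for i
  let ?\<eta> = "osc 1 (\<lambda>x. complex_of_real (\<phi> x))"
  let ?P = "\<lambda>i. packet \<phi> (h i) (R i) (a i) (2 powr real_of_int (3 * int i) *\<^sub>R e)"
  have nP: "norm (osc 1 (?P i) x) = h i * norm (?\<eta> ((x - a i) /\<^sub>R R i))" for i x
    unfolding osc_packet[OF phi R0] norm_mult using h[of i] by simp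
  have "c * h i \<le> norm (osc 1 (packet_sum \<phi> e N h R a) x)"
    if i: "i \<in> {1..N}" and x: "norm (x - a i) \<le> R i" for i x
  proof -
    have "norm ((x - a i) /\<^sub>R R i) = norm (x - a i) / R i"
      using R0[of i] by (simp only: norm_scaleR abs_inverse abs_of_pos divide_inverse mult.commute)
    then have "norm ((x - a i) /\<^sub>R R i) \<le> 1" using x R0[of i] by simp
    from osc_norm_le_one_lower_bound[OF phi this] c(2) have "2 * c \<le> norm (?\<eta> ((x - a i) /\<^sub>R R i))" by linarith
    then have "h i * (2 * c) \<le> norm (osc 1 (?P i) x)" unfolding nP using h[of i] by (intro mult_left_mono) auto
    then have main: "2 * (c * h i) \<le> norm (osc 1 (?P i) x)" by (simp only: mult_ac)
    have other: "norm (osc 1 (?P l) x) \<le> c * h i / real N" if l: "l \<in> {1..N} - {i}" for l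
    proof -
      have "1 \<le> \<bar>real i - real l\<bar>" using l by auto
      then have "S * 1 \<le> S * \<bar>real i - real l\<bar>" using S0 by (intro mult_left_mono)
      also have "S * \<bar>real i - real l\<bar> = norm (a i - a l)"
        unfolding a_def scaleR_diff_left[symmetric] right_diff_distrib[symmetric] using e S0 by (simp add: abs_mult)
      finally have "S \<le> norm (a i - a l)" by simp
      also have "norm (a i - a l) \<le> norm (x - a l) + norm (x - a i)"
        using norm_triangle_ineq4[of "x - a l" "x - a i"] by simp
      finally have "Q i l + 1 \<le> norm (x - a l)" using S[OF i, of l] l x by simp
      then have d: "Q i l \<le> norm (x - a l)" "0 < norm (x - a l)" using Q0[of i l] by auto
      have Rl: "0 < R l" by (rule R0)
      have "norm (osc 1 (?P l) x) \<le> h l * (C / (1 + norm ((x - a l) /\<^sub>R R l)) ^ 1)"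
        unfolding nP using h[of l] by (intro mult_left_mono C(2)) simp
      also have "\<dots> \<le> h l * (C / (norm (x - a l) / R l))"
      proof -
        have nl: "norm ((x - a l) /\<^sub>R R l) = norm (x - a l) / R l" using Rl by (simp add: divide_inverse mult.commute)
        define z where "z = norm (x - a l) / R l"
        have z: "0 < z" using d(2) Rl by (simp add: z_def)
        have "C / (1 + z) ^ 1 \<le> C / z"
          using divide_left_mono[of z "1 + z" C] z C(1) mult_pos_pos[of "1 + z" z] by simp
        then show ?thesis unfolding nl z_def[symmetric] using h[of l] by (intro mult_left_mono) auto
      qed
      also have "\<dots> = h l * C * R l / norm (x - a l)" by simp
      also have "\<dots> \<le> c * h i / real N"
      proof -
        have "real N * (h l * C * R l) \<le> norm (x - a l) * (c * h i)"
          using d(1) c h[of i] by (simp add: Q_def pos_divide_le_eq)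
        then have "h l * C * R l * real N \<le> c * h i * norm (x - a l)" by (simp only: mult_ac)
        then show ?thesis using d(2) N by (simp add: frac_le_eq divide_le_eq pos_le_divide_eq)
      qed
      finally show ?thesis .
    qed
    have "norm (\<Sum>l\<in>{1..N} - {i}. osc 1 (?P l) x) \<le> (\<Sum>l\<in>{1..N} - {i}. c * h i / real N)"
      by (rule sum_norm_le) (rule other)
    also have "\<dots> \<le> (\<Sum>l\<in>{1..N}. c * h i / real N)"
      using c h[of i] by (intro sum_mono2) auto
    also have "\<dots> = c * h i" using N by simp
    finally have rest: "norm (\<Sum>l\<in>{1..N} - {i}. osc 1 (?P l) x) \<le> c * h i" .
    have "osc 1 (packet_sum \<phi> e N h R a) x = osc 1 (?P i) x + (\<Sum>l\<in>{1..N} - {i}. osc 1 (?P l) x)"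
      unfolding osc_packet_sum[OF phi e R] using i by (intro sum.remove) auto
    then show ?thesis
      using norm_diff_ineq[of "osc 1 (?P i) x" "\<Sum>l\<in>{1..N} - {i}. osc 1 (?P l) x"] main rest by simp
  qed
  then show ?thesis using that by blast
qed

section \<open>Choice of the parameters and growth in the number of packets\<close>

text \<open>D and c' must not depend on N; whatever does, apart from the powers of N, is collected
  in A and B, whose interpolated product is 1. The lower bound is stated for every representing g,
  since the inequality to be refuted supplies its own.\<close>

lemma packet_family:
  fixes \<phi> :: "'a::euclidean_space \<Rightarrow> real"
  assumes phi: "lp_cutoff \<phi>" and ab: "0 < \<alpha>" "0 < \<beta>"
    and q: "1 \<le> q0" "1 \<le> q1" "q0 \<noteq> q1" and r01: "1 \<le> r0" "1 \<le> r1"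
    and th: "\<theta> = \<alpha> / (\<alpha> + \<beta>)"
    and p: "0 < p" "1 / p = (1 - \<theta>) * (1 / enn2real q0) + \<theta> * (1 / enn2real q1)"
    and r: "1 \<le> r"
  obtains D c' where "0 < D" "0 < c'" "\<And>N. 1 \<le> N \<Longrightarrow> \<exists>u A B.
      u \<in> besov_inter \<phi> \<alpha> q0 r0 \<beta> q1 r1 \<and> 0 < A \<and> 0 < B \<and> A powr (1 - \<theta>) * B powr \<theta> = 1 \<and>
      besov_seminorm \<phi> \<alpha> q0 r0 u \<le> ennreal (D * A * (3 * real N) powr (1 / enn2real r0)) \<and>
      besov_seminorm \<phi> (- \<beta>) q1 r1 u \<le> ennreal (D * B * (3 * real N) powr (1 / enn2real r1)) \<and>
      (\<forall>g. represents g u \<longrightarrow> ennreal (c' * real N powr (1 / r)) \<le> lorentz_norm p (ennreal r) g)"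
proof -
  let ?n = "DIM('a)" and ?i0 = "1 / enn2real q0" and ?i1 = "1 / enn2real q1"
  define \<delta> where "\<delta> = ?i0 - ?i1"
  have \<delta>: "\<delta> \<noteq> 0" using inverse_exponents_neq[OF q] by (simp add: \<delta>_def)
  have \<theta>ab: "(\<alpha> + \<beta>) * \<theta> = \<alpha>" "(\<alpha> + \<beta>) * (1 - \<theta>) = \<beta>" using ab by (simp_all add: th field_simps)
  have pe: "?i0 - 1 / p = \<theta> * \<delta>" "?i1 - 1 / p = - ((1 - \<theta>) * \<delta>)"
  proof -
    have "x - ((1 - t) * x + t * y) = t * (x - y)" "y - ((1 - t) * x + t * y) = - ((1 - t) * (x - y))" for x y t :: real
      by (simp_all add: algebra_simps)
    then show "?i0 - 1 / p = \<theta> * \<delta>" "?i1 - 1 / p = - ((1 - \<theta>) * \<delta>)" unfolding p(2) \<delta>_def by blast+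
  qed
  obtain e :: 'a where "e \<in> Basis" using nonempty_Basis by blast
  then have e: "norm e = 1" by simp
  obtain C1 where C1: "0 \<le> C1" "\<And>h R \<epsilon> a w x. 0 \<le> h \<Longrightarrow> 0 < R \<Longrightarrow> 0 \<le> \<epsilon> \<Longrightarrow> \<epsilon> \<le> R \<Longrightarrow>
      norm (osc 1 (\<lambda>\<xi>. complex_of_real (lp_psi \<phi> (\<epsilon> *\<^sub>R \<xi>)) * packet \<phi> h R a w \<xi>) x)
        \<le> h * C1 / (1 + norm (x - a) / R) ^ (2 * ?n)"
    by (rule multiplier_packet_bound[OF phi]) auto
  obtain C2 where C2: "0 \<le> C2" "\<And>\<xi>. norm (osc 1 (\<lambda>x. complex_of_real (\<phi> x)) \<xi>) \<le> C2 / (1 + norm \<xi>) ^ 1"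
    by (rule lp_cutoff_osc_decay[OF phi, of 1]) (rule that)
  define W where "W = max 1 (LINT x::'a|lborel. 1 / (1 + norm x) ^ (2 * ?n))"
  have W: "1 \<le> W" "(LINT x::'a|lborel. 1 / (1 + norm x) ^ (2 * ?n)) \<le> W" by (simp_all add: W_def)
  define c where "c = cos 1 * (LINT x|lborel. \<phi> x) / 2"
  have "0 < cos (1::real)" using pi_gt3 by (intro cos_gt_zero) auto
  then have c: "0 < c" "2 * c \<le> cos 1 * (LINT x|lborel. \<phi> x)"
    using lp_cutoff_integral_pos[OF phi] by (simp_all add: c_def)
  define V where "V = unit_ball_vol (real ?n)"
  have V: "0 < V" by (simp add: V_def unit_ball_vol_pos)
  \<comment> \<open>Chosen so that \<mu> i, up to a factor independent of i, has powers \<theta>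
    \<delta> and -(1 - \<theta>) \<delta> equal to 2^(-3 i \<alpha>) and 2^(3 i \<beta>): exactly
    the dyadic weights at frequency 2^(3 i).\<close>
  define \<kappa> where "\<kappa> = 3 * (\<alpha> + \<beta>) / \<delta>"
  have \<kappa>\<delta>: "\<kappa> * (\<theta> * \<delta>) = 3 * \<alpha>" "\<kappa> * ((1 - \<theta>) * \<delta>) = 3 * \<beta>"
  proof -
    have "\<kappa> * (\<theta> * \<delta>) = 3 * ((\<alpha> + \<beta>) * \<theta>)" "\<kappa> * ((1 - \<theta>) * \<delta>) = 3 * ((\<alpha> + \<beta>) * (1 - \<theta>))"
      using \<delta> by (simp_all add: \<kappa>_def)
    then show "\<kappa> * (\<theta> * \<delta>) = 3 * \<alpha>" "\<kappa> * ((1 - \<theta>) * \<delta>) = 3 * \<beta>" unfolding \<theta>ab by simp_all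
  qed
  have \<kappa>: "0 < \<bar>\<kappa>\<bar>" using ab \<delta> by (simp add: \<kappa>_def)
  define \<Lambda> where "\<Lambda> = 2 powr \<bar>\<kappa>\<bar>"
  have L: "1 < \<Lambda>" using powr_less_mono[OF \<kappa>, of 2] by (simp add: \<Lambda>_def)
  \<comment> \<open>The powers of 2 absorb the offset of at most one between k and 3 i; the added 1
    keeps D positive even if C1 is 0.\<close>
  define D where "D = C1 * W * (2 powr \<alpha> + 2 powr \<beta>) + 1"
  have CW: "0 \<le> C1 * W" using C1(1) W(1) by simp
  have D: "0 < D" unfolding D_def by (intro add_nonneg_pos mult_nonneg_nonneg[OF CW]) auto
  have DCW: "C1 * W * 2 powr \<alpha> \<le> D" "C1 * W * 2 powr \<beta> \<le> D"
    using CW mult_nonneg_nonneg[OF CW, of "2 powr \<alpha>"] mult_nonneg_nonneg[OF CW, of "2 powr \<beta>"]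
    by (simp_all add: D_def distrib_left)
  define c' where "c' = c * (V / \<Lambda>) powr (1 / p) * (1 - 1 / \<Lambda>) powr (1 / r)"
  have c': "0 < c'" unfolding c'_def using c V L by (intro mult_pos_pos) auto
  have "\<exists>u A B. u \<in> besov_inter \<phi> \<alpha> q0 r0 \<beta> q1 r1 \<and> 0 < A \<and> 0 < B \<and> A powr (1 - \<theta>) * B powr \<theta> = 1 \<and>
      besov_seminorm \<phi> \<alpha> q0 r0 u \<le> ennreal (D * A * (3 * real N) powr (1 / enn2real r0)) \<and>
      besov_seminorm \<phi> (- \<beta>) q1 r1 u \<le> ennreal (D * B * (3 * real N) powr (1 / enn2real r1)) \<and>
      (\<forall>g. represents g u \<longrightarrow> ennreal (c' * real N powr (1 / r)) \<le> lorentz_norm p (ennreal r) g)"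
    if N: "1 \<le> N" for N
  proof -
    \<comment> \<open>The term |\<kappa>| N is the logarithm of the large factor \<lambda>. It makes
      \<mu> i >= 1 for all i <= N whatever the sign of \<kappa>.\<close>
    define \<mu> where "\<mu> i = 2 powr (\<bar>\<kappa>\<bar> * real N - \<kappa> * real i)" for i :: nat
    have \<mu>0: "0 < \<mu> i" for i by (simp add: \<mu>_def)
    have \<mu>1: "1 \<le> \<mu> i" if "i \<le> N" for i
    proof -
      have "\<kappa> * real i \<le> \<bar>\<kappa>\<bar> * real N" using that by (intro mult_mono) auto
      then show ?thesis unfolding \<mu>_def by (intro ge_one_powr_ge_zero) auto
    qed
    \<comment> \<open>Beyond N the value 1 is a filler, because the packet lemmas ask for 1 <= R i
      at every index.\<close>
    define R where "R i = (if i \<le> N then \<mu> i powr (1 / real ?n) else 1)" for i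
    have R: "1 \<le> R i" for i using \<mu>1[of i] by (auto simp: R_def intro!: ge_one_powr_ge_zero)
    have Rn: "R i ^ ?n = \<mu> i" if "i \<in> {1..N}" for i
      using that \<mu>0[of i] by (simp add: R_def powr_power)
    define h where "h i = \<mu> i powr (- (1 / p))" for i
    have h: "0 < h i" for i using \<mu>0[of i] by (simp add: h_def)
    obtain a where a: "\<And>i x. i \<in> {1..N} \<Longrightarrow> norm (x - a i) \<le> R i \<Longrightarrow> c * h i \<le> norm (osc 1 (packet_sum \<phi> e N h R a) x)"
      using separated_packets_lower_bound[where \<phi>=\<phi> and R=R and h=h and c=c, OF phi e R h N C2 c] by blast
    let ?f = "osc 1 (packet_sum \<phi> e N h R a)"
    define u where "u = (\<lambda>v. LINT x|lborel. ?f x * v x)"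
    have fi: "integrable lborel ?f" by (rule osc_packet_sum_integrable[OF phi e R])
    have [measurable]: "?f \<in> borel_measurable borel" using fi by (auto dest: borel_measurable_integrable)
    have block: "dist_Lq_norm q (dyadic_block \<phi> k u) \<le> ennreal (h i * C1 * W * (R i ^ ?n) powr (1 / enn2real q))"
      if "i \<in> {1..N}" "\<bar>k - 3 * int i\<bar> \<le> 1" "1 \<le> q" for k i q
      unfolding u_def by (rule packet_sum_block_norm[where h=h and R=R, OF phi e R less_imp_le[OF h] C1 W that])
    have block0: "dist_Lq_norm q (dyadic_block \<phi> k u) = 0" if "k \<notin> {2..3 * int N + 1}" "1 \<le> q" for k q
      unfolding u_def by (rule packet_sum_block_zero[where h=h and R=R, OF phi e R less_imp_le[OF h] C1 W that])
    have repr: "((\<lambda>k. dyadic_block \<phi> k u f) has_sum u f) UNIV" if "f \<in> schwartz" for f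
      unfolding u_def by (rule packet_sum_reproduced[where h=h and R=R, OF phi e R less_imp_le[OF h] C1 W that])
    \<comment> \<open>A and B are the powers \<theta> \<delta> and -(1 - \<theta>) \<delta> of
      \<lambda>, so \<lambda> drops out of the interpolated product.\<close>
    define A where "A = 2 powr (\<bar>\<kappa>\<bar> * real N * (\<theta> * \<delta>))"
    define B where "B = 2 powr (\<bar>\<kappa>\<bar> * real N * - ((1 - \<theta>) * \<delta>))"
    have AB: "0 < A" "0 < B" by (simp_all add: A_def B_def)
    have AB1: "A powr (1 - \<theta>) * B powr \<theta> = 1"
      unfolding A_def B_def powr_powr powr_add[symmetric] by (simp add: algebra_simps)
    have s0: "h i * (R i ^ ?n) powr ?i0 = A * 2 powr (- (3 * real i * \<alpha>))" if i: "i \<in> {1..N}" for i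
    proof -
      have "h i * (R i ^ ?n) powr ?i0 = \<mu> i powr (?i0 - 1 / p)"
        unfolding Rn[OF i] h_def powr_add[symmetric] by simp
      also have "\<dots> = 2 powr ((\<bar>\<kappa>\<bar> * real N - \<kappa> * real i) * (\<theta> * \<delta>))" unfolding pe \<mu>_def powr_powr ..
      also have "(\<bar>\<kappa>\<bar> * real N - \<kappa> * real i) * (\<theta> * \<delta>) = \<bar>\<kappa>\<bar> * real N * (\<theta> * \<delta>) + - (real i * (\<kappa> * (\<theta> * \<delta>)))"
        by (simp add: algebra_simps)
      also have "real i * (\<kappa> * (\<theta> * \<delta>)) = 3 * real i * \<alpha>" unfolding \<kappa>\<delta> by simp
      finally show ?thesis unfolding powr_add A_def .
    qed
    have s1: "h i * (R i ^ ?n) powr ?i1 = B * 2 powr (3 * real i * \<beta>)" if i: "i \<in> {1..N}" for i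
    proof -
      have "h i * (R i ^ ?n) powr ?i1 = \<mu> i powr (?i1 - 1 / p)"
        unfolding Rn[OF i] h_def powr_add[symmetric] by simp
      also have "\<dots> = 2 powr ((\<bar>\<kappa>\<bar> * real N - \<kappa> * real i) * - ((1 - \<theta>) * \<delta>))" unfolding pe \<mu>_def powr_powr ..
      also have "(\<bar>\<kappa>\<bar> * real N - \<kappa> * real i) * - ((1 - \<theta>) * \<delta>) = \<bar>\<kappa>\<bar> * real N * - ((1 - \<theta>) * \<delta>) + real i * (\<kappa> * ((1 - \<theta>) * \<delta>))"
        by (simp add: algebra_simps)
      also have "real i * (\<kappa> * ((1 - \<theta>) * \<delta>)) = 3 * real i * \<beta>" unfolding \<kappa>\<delta> by simp
      finally show ?thesis unfolding powr_add B_def .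
    qed
    \<comment> \<open>The multiple of 3 nearest to k is found by rounding: 3 i - 1, 3 i and 3 i + 1
      all give (k + 1) div 3 = i.\<close>
    have near: "\<exists>i\<in>{1..N}. \<bar>k - 3 * int i\<bar> \<le> 1" if "k \<in> {2..3 * int N + 1}" for k
    proof -
      have k: "2 \<le> k" "k \<le> 3 * int N + 1" using that by auto
      define i where "i = nat ((k + 1) div 3)"
      have "1 \<le> (k + 1) div 3" "(k + 1) div 3 \<le> int N" using k by linarith+
      then have "int i = (k + 1) div 3" "i \<in> {1..N}" by (auto simp: i_def)
      then show ?thesis by (intro bexI[of _ i]) linarith+
    qed
    let ?T = "{2..3 * int N + 1}"
    have T: "finite ?T" "?T \<noteq> {}" "real (card ?T) = 3 * real N" using N by auto
    have n0: "besov_seminorm \<phi> \<alpha> q0 r0 u \<le> ennreal (D * A * real (card ?T) powr (1 / enn2real r0))"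
    proof (rule besov_seminorm_le_card[OF r01(1) T(1,2) _ _ block0[OF _ q(1)]])
      show "0 \<le> D * A" using D AB by simp
      fix k assume "k \<in> ?T"
      from near[OF this] obtain i where i: "i \<in> {1..N}" "\<bar>k - 3 * int i\<bar> \<le> 1" by blast
      have "real_of_int k \<le> 3 * real i + 1" using i(2) by linarith
      then have "real_of_int k * \<alpha> \<le> (3 * real i + 1) * \<alpha>" using ab by (intro mult_right_mono) auto
      then have k: "2 powr (- (3 * real i * \<alpha>)) \<le> 2 powr (\<alpha> + - (real_of_int k * \<alpha>))"
        by (intro powr_mono) (simp_all add: algebra_simps)
      have "h i * C1 * W * (R i ^ ?n) powr ?i0 = C1 * W * (h i * (R i ^ ?n) powr ?i0)" by (simp only: mult_ac)
      also have "\<dots> \<le> C1 * W * (A * 2 powr (\<alpha> + - (real_of_int k * \<alpha>)))"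
        unfolding s0[OF i(1)] using k AB CW by (intro mult_left_mono) auto
      also have "\<dots> = (C1 * W * 2 powr \<alpha>) * (A * 2 powr (- (real_of_int k * \<alpha>)))"
        unfolding powr_add by (simp only: mult_ac)
      also have "\<dots> \<le> D * (A * 2 powr (- (real_of_int k * \<alpha>)))"
        using DCW AB by (intro mult_right_mono) auto
      finally have "h i * C1 * W * (R i ^ ?n) powr ?i0 \<le> D * A * 2 powr (- (real_of_int k * \<alpha>))"
        by (simp only: mult.assoc)
      then show "dist_Lq_norm q0 (dyadic_block \<phi> k u) \<le> ennreal (D * A * 2 powr (- (real_of_int k * \<alpha>)))"
        by (rule order_trans[OF block[OF i q(1)] ennreal_leI])
    qed
    have n1: "besov_seminorm \<phi> (- \<beta>) q1 r1 u \<le> ennreal (D * B * real (card ?T) powr (1 / enn2real r1))"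
    proof (rule besov_seminorm_le_card[OF r01(2) T(1,2) _ _ block0[OF _ q(2)]])
      show "0 \<le> D * B" using D AB by simp
      fix k assume "k \<in> ?T"
      from near[OF this] obtain i where i: "i \<in> {1..N}" "\<bar>k - 3 * int i\<bar> \<le> 1" by blast
      have "3 * real i \<le> real_of_int k + 1" using i(2) by linarith
      then have "3 * real i * \<beta> \<le> (real_of_int k + 1) * \<beta>" using ab by (intro mult_right_mono) auto
      then have k: "2 powr (3 * real i * \<beta>) \<le> 2 powr (\<beta> + - (real_of_int k * - \<beta>))"
        by (intro powr_mono) (simp_all add: algebra_simps)
      have "h i * C1 * W * (R i ^ ?n) powr ?i1 = C1 * W * (h i * (R i ^ ?n) powr ?i1)" by (simp only: mult_ac)
      also have "\<dots> \<le> C1 * W * (B * 2 powr (\<beta> + - (real_of_int k * - \<beta>)))"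
        unfolding s1[OF i(1)] using k AB CW by (intro mult_left_mono) auto
      also have "\<dots> = (C1 * W * 2 powr \<beta>) * (B * 2 powr (- (real_of_int k * - \<beta>)))"
        unfolding powr_add by (simp only: mult_ac)
      also have "\<dots> \<le> D * (B * 2 powr (- (real_of_int k * - \<beta>)))"
        using DCW AB by (intro mult_right_mono) auto
      finally have "h i * C1 * W * (R i ^ ?n) powr ?i1 \<le> D * B * 2 powr (- (real_of_int k * - \<beta>))"
        by (simp only: mult.assoc)
      then show "dist_Lq_norm q1 (dyadic_block \<phi> k u) \<le> ennreal (D * B * 2 powr (- (real_of_int k * - \<beta>)))"
        by (rule order_trans[OF block[OF i q(2)] ennreal_leI])
    qed
    have "besov_seminorm \<phi> \<alpha> q0 r0 u < \<infinity>" "besov_seminorm \<phi> (- \<beta>) q1 r1 u < \<infinity>"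
      using le_less_trans[OF n0 ennreal_less_top] le_less_trans[OF n1 ennreal_less_top] by simp_all
    then have uin: "u \<in> besov_inter \<phi> \<alpha> q0 r0 \<beta> q1 r1"
      unfolding besov_inter_def using repr tempered_integral(1)[OF fi] by (auto simp: u_def)
    have low: "ennreal (c' * real N powr (1 / r)) \<le> lorentz_norm p (ennreal r) g" if g: "represents g u" for g
    proof -
      have [measurable]: "g \<in> borel_measurable borel" using g by (simp add: represents_def)
      have ae: "AE x in lborel. g x = ?f x"
        using represents_unique[OF phi g] tempered_integral(2)[OF fi] unfolding u_def by blast
      have lev: "ennreal (V * \<mu> i) \<le> distribution_fun g (ennreal (c * \<mu> i powr (- (1 / p))))" if i: "i \<in> {1..N}" for i
      proof -
        have "ennreal (V * \<mu> i) = emeasure lborel (ball (a i) (R i))"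
          using R[of i] by (simp add: emeasure_ball V_def Rn[OF i])
        also have "\<dots> \<le> emeasure lborel {x. ennreal (c * h i) \<le> ennreal (norm (?f x))}"
        proof (rule emeasure_mono)
          show "ball (a i) (R i) \<subseteq> {x. ennreal (c * h i) \<le> ennreal (norm (?f x))}"
            using a[OF i] by (auto simp: dist_norm norm_minus_commute intro!: ennreal_leI)
        qed measurable
        also have "\<dots> = emeasure lborel {x. ennreal (c * h i) \<le> ennreal (norm (g x))}"
        proof (rule emeasure_eq_AE)
          show "AE x in lborel. x \<in> {x. ennreal (c * h i) \<le> ennreal (norm (?f x))} \<longleftrightarrow> x \<in> {x. ennreal (c * h i) \<le> ennreal (norm (g x))}"
            using ae by eventually_elim simp
        qed measurable
        finally show ?thesis by (simp add: distribution_fun_def h_def)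
      qed
      have sep: "\<mu> i \<le> \<mu> j / \<Lambda> \<or> \<mu> j \<le> \<mu> i / \<Lambda>" if "i \<noteq> j" for i j
      proof -
        have d: "\<mu> k / \<Lambda> = 2 powr (\<bar>\<kappa>\<bar> * real N - \<kappa> * real k - \<bar>\<kappa>\<bar>)" for k
          unfolding \<mu>_def \<Lambda>_def powr_diff ..
        have "1 \<le> \<bar>real i - real j\<bar>" using that by linarith
        then have "\<bar>\<kappa>\<bar> * 1 \<le> \<bar>\<kappa>\<bar> * \<bar>real i - real j\<bar>" by (intro mult_left_mono) auto
        also have "\<dots> = \<bar>\<kappa> * real i - \<kappa> * real j\<bar>" by (simp only: abs_mult[symmetric] right_diff_distrib)
        finally have "\<bar>\<kappa>\<bar> \<le> \<kappa> * real i - \<kappa> * real j \<or> \<bar>\<kappa>\<bar> \<le> \<kappa> * real j - \<kappa> * real i" by linarith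
        then show ?thesis
        proof
          assume "\<bar>\<kappa>\<bar> \<le> \<kappa> * real i - \<kappa> * real j"
          then have "\<mu> i \<le> \<mu> j / \<Lambda>" unfolding d unfolding \<mu>_def by (intro powr_mono) auto
          then show ?thesis ..
        next
          assume "\<bar>\<kappa>\<bar> \<le> \<kappa> * real j - \<kappa> * real i"
          then have "\<mu> j \<le> \<mu> i / \<Lambda>" unfolding d unfolding \<mu>_def by (intro powr_mono) auto
          then show ?thesis ..
        qed
      qed
      have "ennreal (c * (V / \<Lambda>) powr (1 / p) * (1 - 1 / \<Lambda>) powr (1 / r) * real (card {1..N}) powr (1 / r)) \<le> lorentz_norm p (ennreal r) g"
        by (rule lorentz_norm_ge_levels[where \<mu>=\<mu> and I="{1..N}", OF _ r p(1) c(1) V L \<mu>0 sep lev]) auto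
      then show ?thesis by (simp add: c'_def)
    qed
    show ?thesis using uin AB AB1 n0[unfolded T(3)] n1[unfolded T(3)] low by blast
  qed
  then show ?thesis using that[OF D c'] by blast
qed

text \<open>Inserting the packet family leaves N^(1/r) <= const * N^v with v = 1 / rstar < 1 / r (v
  = 0 when rstar is \<infinity>), which fails for large N.\<close>

lemma not_besov_lorentz_ineq_if_less:
  fixes \<phi> :: "'a::euclidean_space \<Rightarrow> real"
  assumes phi: "lp_cutoff \<phi>" and ab: "0 < \<alpha>" "0 < \<beta>"
    and q: "1 \<le> q0" "1 \<le> q1" "q0 \<noteq> q1" and r01: "1 \<le> r0" "1 \<le> r1"
    and th: "\<theta> = \<alpha> / (\<alpha> + \<beta>)"
    and p: "1 / ennreal p = ennreal (1 - \<theta>) / q0 + ennreal \<theta> / q1"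
    and rs: "1 / rstar = ennreal (1 - \<theta>) / r0 + ennreal \<theta> / r1"
    and r: "1 \<le> r" "r < rstar"
  shows "\<not> besov_lorentz_ineq \<phi> \<alpha> q0 r0 \<beta> q1 r1 \<theta> p r"
proof
  assume "besov_lorentz_ineq \<phi> \<alpha> q0 r0 \<beta> q1 r1 \<theta> p r"
  then obtain C where C: "\<And>u. u \<in> besov_inter \<phi> \<alpha> q0 r0 \<beta> q1 r1 \<Longrightarrow>
       \<exists>g. represents g u \<and> lorentz_norm p r g < \<infinity> \<and>
         lorentz_norm p r g \<le> ennreal C *
           epowr (besov_seminorm \<phi> \<alpha> q0 r0 u) (1 - \<theta>) *
           epowr (besov_seminorm \<phi> (- \<beta>) q1 r1 u) \<theta>"
    unfolding besov_lorentz_ineq_def by blast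
  have \<theta>: "0 < \<theta>" "\<theta> < 1" using ab by (auto simp: th)
  note p' = interpolated_exponent[OF q \<theta> p]
  note w = summation_exponent_less[OF r01 \<theta> rs r]
  let ?k0 = "1 / enn2real r0" and ?k1 = "1 / enn2real r1"
  define v where "v = (1 - \<theta>) * ?k0 + \<theta> * ?k1"
  define k where "k = enn2real r"
  have k: "1 \<le> k" using enn2real_ge_1[OF r(1) w(1)] by (simp add: k_def)
  have rk: "r = ennreal k" using w(1) by (simp add: k_def less_top)
  have vk: "0 < 1 / k - v" using w(2) by (simp add: v_def k_def)
  obtain D c' where D: "0 < D" "0 < c'" and fam: "\<And>N. 1 \<le> N \<Longrightarrow> \<exists>u A B.
      u \<in> besov_inter \<phi> \<alpha> q0 r0 \<beta> q1 r1 \<and> 0 < A \<and> 0 < B \<and> A powr (1 - \<theta>) * B powr \<theta> = 1 \<and>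
      besov_seminorm \<phi> \<alpha> q0 r0 u \<le> ennreal (D * A * (3 * real N) powr ?k0) \<and>
      besov_seminorm \<phi> (- \<beta>) q1 r1 u \<le> ennreal (D * B * (3 * real N) powr ?k1) \<and>
      (\<forall>g. represents g u \<longrightarrow> ennreal (c' * real N powr (1 / k)) \<le> lorentz_norm p (ennreal k) g)"
    by (rule packet_family[OF phi ab q r01 th p' k]) (rule that)
  have bound: "c' * real N powr (1 / k) \<le> \<bar>C\<bar> * D * 3 powr v * real N powr v" if N: "1 \<le> N" for N
  proof -
    obtain u A B where u: "u \<in> besov_inter \<phi> \<alpha> q0 r0 \<beta> q1 r1" and AB: "0 < A" "0 < B" "A powr (1 - \<theta>) * B powr \<theta> = 1"
      and n0: "besov_seminorm \<phi> \<alpha> q0 r0 u \<le> ennreal (D * A * (3 * real N) powr ?k0)"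
      and n1: "besov_seminorm \<phi> (- \<beta>) q1 r1 u \<le> ennreal (D * B * (3 * real N) powr ?k1)"
      and low: "\<And>g. represents g u \<Longrightarrow> ennreal (c' * real N powr (1 / k)) \<le> lorentz_norm p (ennreal k) g"
      using fam[OF N] by blast
    define M where "M = 3 * real N"
    have M: "0 < M" using N by (simp add: M_def)
    obtain g where g: "represents g u" "lorentz_norm p r g \<le> ennreal C *
           epowr (besov_seminorm \<phi> \<alpha> q0 r0 u) (1 - \<theta>) * epowr (besov_seminorm \<phi> (- \<beta>) q1 r1 u) \<theta>"
      using C[OF u] by blast
    have pos: "0 \<le> D * A * M powr ?k0" "0 \<le> D * B * M powr ?k1" using D AB by simp_all
    have "ennreal (c' * real N powr (1 / k)) \<le> lorentz_norm p r g" using low[OF g(1)] unfolding rk .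
    also note g(2)
    \<comment> \<open>C is an arbitrary real; passing to |C| keeps the right-hand side an honest
      real product.\<close>
    also have "ennreal C * epowr (besov_seminorm \<phi> \<alpha> q0 r0 u) (1 - \<theta>) * epowr (besov_seminorm \<phi> (- \<beta>) q1 r1 u) \<theta>
      \<le> ennreal \<bar>C\<bar> * ennreal ((D * A * M powr ?k0) powr (1 - \<theta>)) * ennreal ((D * B * M powr ?k1) powr \<theta>)"
      unfolding epowr_ennreal[OF pos(1), symmetric] epowr_ennreal[OF pos(2), symmetric]
      using n0 n1 \<theta> unfolding M_def[symmetric] by (intro mult_mono epowr_mono ennreal_leI) auto
    also have "\<dots> = ennreal (\<bar>C\<bar> * (D * A * M powr ?k0) powr (1 - \<theta>) * (D * B * M powr ?k1) powr \<theta>)"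
      by (simp add: ennreal_mult)
    also have "\<bar>C\<bar> * (D * A * M powr ?k0) powr (1 - \<theta>) * (D * B * M powr ?k1) powr \<theta> = \<bar>C\<bar> * D * M powr v"
    proof -
      have "\<bar>C\<bar> * (D * A * M powr ?k0) powr (1 - \<theta>) * (D * B * M powr ?k1) powr \<theta> =
          \<bar>C\<bar> * (D powr (1 - \<theta>) * D powr \<theta>) * (A powr (1 - \<theta>) * B powr \<theta>) * (M powr (?k0 * (1 - \<theta>)) * M powr (?k1 * \<theta>))"
        unfolding powr_mult powr_powr by (simp only: mult_ac)
      also have "D powr (1 - \<theta>) * D powr \<theta> = D" unfolding powr_add[symmetric] using D by simp
      also have "M powr (?k0 * (1 - \<theta>)) * M powr (?k1 * \<theta>) = M powr v"
        unfolding powr_add[symmetric] v_def by (simp only: mult.commute)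
      finally show ?thesis unfolding AB(3) by simp
    qed
    finally have "c' * real N powr (1 / k) \<le> \<bar>C\<bar> * D * M powr v"
      using D by (subst (asm) ennreal_le_iff) auto
    then show ?thesis unfolding M_def powr_mult by (simp only: mult.assoc)
  qed
  \<comment> \<open>The added 1 makes E strictly larger than the quotient of the constants, and N is
    taken so large that N^(1/k - v) >= E.\<close>
  define E where "E = \<bar>C\<bar> * D * 3 powr v / c' + 1"
  have E: "0 < E" using D by (simp add: E_def add_nonneg_pos)
  obtain N :: nat where N: "E powr (1 / (1 / k - v)) + 1 \<le> real N" using real_arch_simple by blast
  have N1: "1 \<le> N" using N powr_ge_zero[of E "1 / (1 / k - v)"] by linarith
  have Nv: "0 < real N powr v" using N1 by simp
  have "E = (E powr (1 / (1 / k - v))) powr (1 / k - v)" using E vk by (simp add: powr_powr)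
  also have "\<dots> \<le> real N powr (1 / k - v)" using N vk by (intro powr_mono2) auto
  finally have EN: "E * real N powr v \<le> real N powr (1 / k)"
    using Nv by (simp add: powr_diff pos_le_divide_eq)
  have "c' * (E * real N powr v) \<le> c' * real N powr (1 / k)" using D EN by (intro mult_left_mono) auto
  also have "\<dots> \<le> \<bar>C\<bar> * D * 3 powr v * real N powr v" by (rule bound[OF N1])
  finally have "(c' * E) * real N powr v \<le> (\<bar>C\<bar> * D * 3 powr v) * real N powr v" by (simp only: mult.assoc)
  then have "c' * E \<le> \<bar>C\<bar> * D * 3 powr v" using Nv by (rule mult_right_le_imp_le)
  moreover have "c' * E = \<bar>C\<bar> * D * 3 powr v + c'" using D by (simp add: E_def distrib_left)
  ultimately show False using D by simp
qed

text \<open>This admits r = rstar in the positive result, which asks for 1 <= r. Reciprocals of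
  exponents are at most 1, hence so is their convex combination v, while v rstar >= 1 in the finite
  case.\<close>

lemma one_le_summation_exponent:
  assumes r01: "1 \<le> r0" "1 \<le> r1" and th: "0 < \<theta>" "\<theta> < 1"
    and rs: "1 / rstar = ennreal (1 - \<theta>) / r0 + ennreal \<theta> / r1"
  shows "1 \<le> rstar"
proof (cases "rstar = \<infinity>")
  case False
  define t where "t = enn2real rstar"
  have t: "rstar = ennreal t" "0 \<le> t" using False by (simp_all add: t_def less_top)
  have le1: "1 / enn2real s \<le> 1" if "1 \<le> s" for s
    using enn2real_ge_1[OF that] by (cases "s = \<infinity>") auto
  define v where "v = (1 - \<theta>) * (1 / enn2real r0) + \<theta> * (1 / enn2real r1)"
  have "v \<le> (1 - \<theta>) * 1 + \<theta> * 1"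
    unfolding v_def using th le1[OF r01(1)] le1[OF r01(2)] by (intro add_mono mult_left_mono) auto
  then have "v * t \<le> 1 * t" using t(2) by (intro mult_right_mono) auto
  moreover have "1 \<le> v * t"
    unfolding v_def t_def by (rule summation_exponent_ge[OF r01 th rs order_refl False])
  ultimately show ?thesis unfolding t(1) by simp
qed simp

theorem theorem3:
  fixes \<phi> :: "real ^ 'n \<Rightarrow> real"
    and \<alpha> \<beta> \<theta> p :: real
    and q0 q1 r0 r1 rstar :: ennreal
  assumes "lp_cutoff \<phi>"
    and "0 < \<alpha>" and "0 < \<beta>"
    and "1 \<le> q0" and "1 \<le> q1" and "1 \<le> r0" and "1 \<le> r1"
    and "q0 \<noteq> q1"
    and "\<theta> = \<alpha> / (\<alpha> + \<beta>)"
    and "1 / ennreal p = ennreal (1 - \<theta>) / q0 + ennreal \<theta> / q1"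
    and "1 / rstar = ennreal (1 - \<theta>) / r0 + ennreal \<theta> / r1"
  shows "(\<forall>r. 1 \<le> r \<and> rstar < r \<longrightarrow> besov_lorentz_ineq \<phi> \<alpha> q0 r0 \<beta> q1 r1 \<theta> p r) \<and>
    ((rstar = r0 \<and> r0 = r1) \<or> (r0 = q0 \<and> r1 = q1) \<or> (1 < p \<and> p \<le> 2 \<and> rstar = ennreal p)
       \<longrightarrow> besov_lorentz_ineq \<phi> \<alpha> q0 r0 \<beta> q1 r1 \<theta> p rstar) \<and>
    (\<forall>r. 1 \<le> r \<and> r < rstar \<longrightarrow> \<not> besov_lorentz_ineq \<phi> \<alpha> q0 r0 \<beta> q1 r1 \<theta> p r)"
proof -
  have rstar: "1 \<le> rstar"
    by (rule one_le_summation_exponent[OF assms(6,7) _ _ assms(11)]) (use assms in auto)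
  have upper: "besov_lorentz_ineq \<phi> \<alpha> q0 r0 \<beta> q1 r1 \<theta> p r" if "1 \<le> r" "rstar \<le> r" for r
    using besov_lorentz_ineq_if_ge assms that by blast
  have lower: "\<not> besov_lorentz_ineq \<phi> \<alpha> q0 r0 \<beta> q1 r1 \<theta> p r" if "1 \<le> r" "r < rstar" for r
    using not_besov_lorentz_ineq_if_less assms that by blast
  show ?thesis using rstar upper lower by (auto intro: less_imp_le)
qed

end
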